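(* Let $M$ be a normal toric binoid. Let $U'\subseteq U$ be any two open subsets of $\operatorname{Spec}M$ such that $U^{(1)}=U'^{(1)}$, that is, such that $U$ and $U'$ contain the same prime ideals of height one. Then there is an injective group homomorphism $\operatorname{Pic}(U)\longrightarrow\operatorname{Pic}(U')$.
   Context: A (commutative) binoid is a commutative monoid $(M,+,0)$ with an absorbing element $\infty$; $M^\bullet=M\smallsetminus\{\infty\}$. It is integral if $M^\bullet$ is a submonoid, cancellative if $a+b=a+c\neq\infty$ implies $b=c$, and torsion-free if $na=nb\neq\infty$ with $n\geq1$ implies $a=b$. A toric binoid is a finitely generated, integral, cancellative and torsion-free binoid. For such $M$, the difference group is $\Gamma^\bullet=-M^\bullet+M^\bullet$ (the group of differences of $M^\bullet$), and $M$ is normal if $\gamma\in\Gamma^\bullet$ and $n\gamma\in M^\bullet$ for some $n\ge1$ imply $\gamma\in M^\bullet$. A prime ideal is a subset $\mathfrak p\ni\infty$ with $\mathfrak p+M\subseteq\mathfrak p$ and $M\smallsetminus\mathfrak p$ a submonoid. $\operatorname{Spec}M$ is the set of prime ideals, with the topology having the sets $D(f)=\{\mathfrak p\mid f\notin\mathfrak p\}$, $f\in M$, as basis. The height of $\mathfrak p$ is the maximal length $n$ of a chain $\mathfrak p_0\subsetneq\dots\subsetneq\mathfrak p_n=\mathfrak p$ of prime ideals. The structure sheaf $\mathcal O_M$ is the sheaf of binoids on $\operatorname{Spec} M$ with $\mathcal O_M(D(f))=M_f$ (localization at $f$), and $\mathcal O_M^*$ is its sheaf of units (a sheaf of abelian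 groups). For an open subset $U$, $\operatorname{Pic}(U)$ is the group of isomorphism classes of sheaves of $\mathcal O_M|_U$-sets that are locally isomorphic to $\mathcal O_M|_U$, with operation the smash product over $\mathcal O_M|_U$; it is isomorphic to $\mathrm H^1(U,\mathcal O_M^*|_U)$. *)

theory Defs
  imports
    "HOL-Algebra.Group"
    "HOL-Analysis.Function_Topology"
    "HOL-Library.Extended_Nat"
    "HOL-Library.FuncSet"
begin

section \<open>Binoids\<close>

text \<open>
  Binoids are written multiplicatively, on top of the record type \<open>monoid\<close>: the sum \<open>a + b\<close>
  is \<open>a \<otimes> b\<close>, the neutral element \<open>0\<close> is \<open>\<one>\<close>, the multiple \<open>n a\<close> is \<open>a [^] n\<close>, and the
  absorbing element \<open>\<infinity>\<close> is \<open>absorb\<close>.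
\<close>

record 'a binoid = "'a monoid" +
  absorb :: 'a

locale binoid = comm_monoid M for M (structure) +
  assumes absorb_closed: "absorb M \<in> carrier M"
    and absorb_mult: "a \<in> carrier M \<Longrightarrow> a \<otimes> absorb M = absorb M"

text \<open>The set \<open>M\<^sup>\<bullet>\<close> of the elements different from \<open>\<infinity>\<close>.\<close>

definition finite_part :: "('a, 'z) binoid_scheme \<Rightarrow> 'a set" where
  "finite_part M = carrier M - {absorb M}"

definition finitely_generated :: "('a, 'z) binoid_scheme \<Rightarrow> bool" where
  "finitely_generated M \<longleftrightarrow> (\<exists>B \<subseteq> carrier M. finite B \<and>
     (\<forall>H. submonoid H M \<and> absorb M \<in> H \<and> B \<subseteq> H \<longrightarrow> H = carrier M))"

definition integral_binoid :: "('a, 'z) binoid_scheme \<Rightarrow> bool" where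
  "integral_binoid M \<longleftrightarrow> submonoid (finite_part M) M"

definition cancellative :: "('a, 'z) binoid_scheme \<Rightarrow> bool" where
  "cancellative M \<longleftrightarrow> (\<forall>a \<in> carrier M. \<forall>b \<in> carrier M. \<forall>c \<in> carrier M.
     a \<otimes>\<^bsub>M\<^esub> b = a \<otimes>\<^bsub>M\<^esub> c \<and> a \<otimes>\<^bsub>M\<^esub> c \<noteq> absorb M \<longrightarrow> b = c)"

definition torsion_free :: "('a, 'z) binoid_scheme \<Rightarrow> bool" where
  "torsion_free M \<longleftrightarrow> (\<forall>a \<in> carrier M. \<forall>b \<in> carrier M. \<forall>n::nat. n \<ge> 1 \<and>
     a [^]\<^bsub>M\<^esub> n = b [^]\<^bsub>M\<^esub> n \<and> b [^]\<^bsub>M\<^esub> n \<noteq> absorb M \<longrightarrow> a = b)"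

locale toric_binoid = binoid +
  assumes finitely_generated: "finitely_generated M"
    and integral: "integral_binoid M"
    and cancellative: "cancellative M"
    and torsion_free: "torsion_free M"


section \<open>Localization, difference group, normality\<close>

text \<open>\<open>fraction M S a s\<close> is the fraction with numerator \<open>a\<close> and denominator \<open>s \<in> S\<close>, as an equivalence class of pairs.\<close>

definition fraction :: "('a, 'z) binoid_scheme \<Rightarrow> 'a set \<Rightarrow> 'a \<Rightarrow> 'a \<Rightarrow> ('a \<times> 'a) set" where
  "fraction M S a s = {(b, t). b \<in> carrier M \<and> t \<in> S \<and>
     (\<exists>u \<in> S. u \<otimes>\<^bsub>M\<^esub> (a \<otimes>\<^bsub>M\<^esub> t) = u \<otimes>\<^bsub>M\<^esub> (b \<otimes>\<^bsub>M\<^esub> s))}"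

definition localization :: "('a, 'z) binoid_scheme \<Rightarrow> 'a set \<Rightarrow> ('a \<times> 'a) set binoid" where
  "localization M S =
    \<lparr> carrier = {fraction M S a s | a s. a \<in> carrier M \<and> s \<in> S},
      mult = (\<lambda>x y. \<Union>(a, s) \<in> x. \<Union>(b, t) \<in> y. fraction M S (a \<otimes>\<^bsub>M\<^esub> b) (s \<otimes>\<^bsub>M\<^esub> t)),
      one = fraction M S \<one>\<^bsub>M\<^esub> \<one>\<^bsub>M\<^esub>,
      absorb = fraction M S (absorb M) \<one>\<^bsub>M\<^esub> \<rparr>"

definition localization_at_element :: "('a, 'z) binoid_scheme \<Rightarrow> 'a \<Rightarrow> ('a \<times> 'a) set binoid" where
  "localization_at_element M f = localization M {f [^]\<^bsub>M\<^esub> n | n::nat. True}"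

text \<open>For integral \<open>M\<close>, the group of differences of the monoid \<open>finite_part M\<close>.\<close>

definition difference_group :: "('a, 'z) binoid_scheme \<Rightarrow> ('a \<times> 'a) set binoid" where
  "difference_group M = (localization M (finite_part M))
    \<lparr> carrier := {fraction M (finite_part M) a b | a b. a \<in> finite_part M \<and> b \<in> finite_part M} \<rparr>"

definition normal_binoid :: "('a, 'z) binoid_scheme \<Rightarrow> bool" where
  "normal_binoid M \<longleftrightarrow>
     (let \<iota> = (\<lambda>a. fraction M (finite_part M) a \<one>\<^bsub>M\<^esub>) in
      \<forall>\<gamma> \<in> carrier (difference_group M). \<forall>n::nat.
        n \<ge> 1 \<and> \<gamma> [^]\<^bsub>difference_group M\<^esub> n \<in> \<iota> ` finite_part M \<longrightarrow> \<gamma> \<in> \<iota> ` finite_part M)"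


section \<open>The spectrum\<close>

definition prime_ideal :: "('a, 'z) binoid_scheme \<Rightarrow> 'a set \<Rightarrow> bool" where
  "prime_ideal M \<pp> \<longleftrightarrow> \<pp> \<subseteq> carrier M \<and> absorb M \<in> \<pp> \<and>
     (\<forall>a \<in> \<pp>. \<forall>b \<in> carrier M. a \<otimes>\<^bsub>M\<^esub> b \<in> \<pp>) \<and> submonoid (carrier M - \<pp>) M"

definition basic_open :: "('a, 'z) binoid_scheme \<Rightarrow> 'a \<Rightarrow> 'a set set" where
  "basic_open M f = {\<pp>. prime_ideal M \<pp> \<and> f \<notin> \<pp>}"

text \<open>
  The sets \<open>basic_open M f\<close> are closed under finite intersections and contain the whole spectrum
  (\<open>f = \<one>\<close>), so that they form a basis of the topology they generate.
\<close>

definition Spec :: "('a, 'z) binoid_scheme \<Rightarrow> 'a set topology" where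
  "Spec M = topology_generated_by (basic_open M ` carrier M)"

definition height :: "('a, 'z) binoid_scheme \<Rightarrow> 'a set \<Rightarrow> enat" where
  "height M \<pp> = (SUP n \<in> {n. \<exists>P. P n = \<pp> \<and> (\<forall>i \<le> n. prime_ideal M (P i)) \<and> (\<forall>i < n. P i \<subset> P (Suc i))}. enat n)"

definition height_one_points :: "('a, 'z) binoid_scheme \<Rightarrow> 'a set set \<Rightarrow> 'a set set" where
  "height_one_points M U = {\<pp> \<in> U. height M \<pp> = 1}"


section \<open>Sheaves\<close>

record ('x, 's, 'obj) presheaf =
  sec :: "'x set \<Rightarrow> 'obj"
  res :: "'x set \<Rightarrow> 'x set \<Rightarrow> 's \<Rightarrow> 's"  \<comment> \<open>\<open>res F V W\<close> restricts from \<open>V\<close> to \<open>W \<subseteq> V\<close>\<close>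

locale sheaf =
  fixes X :: "'x topology" and A :: "'x set \<Rightarrow> 's set" and \<rho> :: "'x set \<Rightarrow> 'x set \<Rightarrow> 's \<Rightarrow> 's"
  assumes res_closed:
      "\<lbrakk>openin X V; openin X W; W \<subseteq> V; s \<in> A V\<rbrakk> \<Longrightarrow> \<rho> V W s \<in> A W"
    and res_id: "\<lbrakk>openin X V; s \<in> A V\<rbrakk> \<Longrightarrow> \<rho> V V s = s"
    and res_res:
      "\<lbrakk>openin X V; openin X V'; openin X V''; V'' \<subseteq> V'; V' \<subseteq> V; s \<in> A V\<rbrakk>
        \<Longrightarrow> \<rho> V' V'' (\<rho> V V' s) = \<rho> V V'' s"
    and glue:
      "\<lbrakk>\<And>V. V \<in> \<V> \<Longrightarrow> openin X V; \<And>V. V \<in> \<V> \<Longrightarrow> \<sigma> V \<in> A V;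
        \<And>V W. \<lbrakk>V \<in> \<V>; W \<in> \<V>\<rbrakk> \<Longrightarrow> \<rho> V (V \<inter> W) (\<sigma> V) = \<rho> W (V \<inter> W) (\<sigma> W)\<rbrakk>
        \<Longrightarrow> \<exists>!t. t \<in> A (\<Union>\<V>) \<and> (\<forall>V \<in> \<V>. \<rho> (\<Union>\<V>) V t = \<sigma> V)"


section \<open>The structure sheaf\<close>

text \<open>
  Sections over \<open>V\<close> are the families of germs in the localizations at the primes of \<open>V\<close> which
  are locally given by a fraction, as for schemes.  See \<open>structure_sheaf_basic_open\<close> below for
  the values on the basic open sets.
\<close>

type_synonym 'a section_fun = "'a set \<Rightarrow> ('a \<times> 'a) set"

definition structure_sections :: "('a, 'z) binoid_scheme \<Rightarrow> 'a set set \<Rightarrow> 'a section_fun set" where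
  "structure_sections M V =
    {s \<in> (\<Pi>\<^sub>E \<pp> \<in> V. carrier (localization M (carrier M - \<pp>))).
      \<forall>\<pp> \<in> V. \<exists>W. openin (Spec M) W \<and> \<pp> \<in> W \<and> W \<subseteq> V \<and>
        (\<exists>a \<in> carrier M. \<exists>f \<in> carrier M. \<forall>\<qq> \<in> W. f \<notin> \<qq> \<and> s \<qq> = fraction M (carrier M - \<qq>) a f)}"

definition structure_sheaf ::
    "('a, 'z) binoid_scheme \<Rightarrow> ('a set, 'a section_fun, 'a section_fun binoid) presheaf" where
  "structure_sheaf M =
    \<lparr> sec = (\<lambda>V.
        \<lparr> carrier = structure_sections M V,
          mult = (\<lambda>s t. \<lambda>\<pp> \<in> V. s \<pp> \<otimes>\<^bsub>localization M (carrier M - \<pp>)\<^esub> t \<pp>),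
          one = (\<lambda>\<pp> \<in> V. \<one>\<^bsub>localization M (carrier M - \<pp>)\<^esub>),
          absorb = (\<lambda>\<pp> \<in> V. absorb (localization M (carrier M - \<pp>))) \<rparr>),
      res = (\<lambda>V W s. restrict s W) \<rparr>"


lemma openin_basic_open: "f \<in> carrier M \<Longrightarrow> openin (Spec M) (basic_open M f)"
  unfolding Spec_def by (simp add: topology_generated_by_Basis)

lemma (in binoid) basic_open_mult:
  assumes "f \<in> carrier M" "g \<in> carrier M"
  shows "basic_open M (f \<otimes> g) = basic_open M f \<inter> basic_open M g"
proof -
  have "f \<otimes> g \<in> p \<longleftrightarrow> f \<in> p \<or> g \<in> p" if "prime_ideal M p" for p
  proof -
    have "submonoid (carrier M - p) M" "\<forall>a\<in>p. \<forall>b\<in>carrier M. a \<otimes> b \<in> p"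
      using that by (auto simp: prime_ideal_def)
    then show ?thesis
      using assms submonoid.m_closed[of "carrier M - p" M f g] m_comm[of f g]
      by (metis DiffE DiffI)
  qed
  then show ?thesis by (auto simp: basic_open_def)
qed

lemma (in binoid) openin_Spec_iff:
  "openin (Spec M) U \<longleftrightarrow>
     (\<forall>\<pp> \<in> U. \<exists>f \<in> carrier M. \<pp> \<in> basic_open M f \<and> basic_open M f \<subseteq> U)"
proof
  assume "openin (Spec M) U"
  then have "generate_topology_on (basic_open M ` carrier M) U"
    by (simp add: Spec_def openin_topology_generated_by_iff)
  then show "\<forall>\<pp> \<in> U. \<exists>f \<in> carrier M. \<pp> \<in> basic_open M f \<and> basic_open M f \<subseteq> U"
  proof induction
    case (Int a b)
    show ?case
    proof
      fix p assume "p \<in> a \<inter> b"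
      then obtain f g where "f \<in> carrier M" "p \<in> basic_open M f" "basic_open M f \<subseteq> a"
        "g \<in> carrier M" "p \<in> basic_open M g" "basic_open M g \<subseteq> b" using Int by blast
      then show "\<exists>f\<in>carrier M. p \<in> basic_open M f \<and> basic_open M f \<subseteq> a \<inter> b"
        by (intro bexI[of _ "f \<otimes> g"]) (auto simp: basic_open_mult)
    qed
  qed (auto, blast)
next
  assume *: "\<forall>\<pp> \<in> U. \<exists>f \<in> carrier M. \<pp> \<in> basic_open M f \<and> basic_open M f \<subseteq> U"
  show "openin (Spec M) U"
  proof (subst openin_subopen, intro ballI)
    fix p assume "p \<in> U"
    with * obtain f where "f \<in> carrier M" "p \<in> basic_open M f" "basic_open M f \<subseteq> U" by blast
    then show "\<exists>T. openin (Spec M) T \<and> p \<in> T \<and> T \<subseteq> U"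
      by (intro exI[of _ "basic_open M f"]) (simp add: openin_basic_open)
  qed
qed

context binoid
begin

lemma absorb_left: "b \<in> carrier M \<Longrightarrow> absorb M \<otimes> b = absorb M"
  using m_comm absorb_closed absorb_mult by metis

lemma fraction_refl:
  assumes "submonoid S M" "a \<in> carrier M" "s \<in> S"
  shows "(a, s) \<in> fraction M S a s"
  using assms submonoid.one_closed[OF assms(1)] by (auto simp: fraction_def)

lemma fraction_mono:
  assumes S: "submonoid S M" and a: "a \<in> carrier M" "s \<in> S" "b \<in> carrier M" "t \<in> S"
    and u: "u \<in> S" "u \<otimes> (a \<otimes> t) = u \<otimes> (b \<otimes> s)"
  shows "fraction M S b t \<subseteq> fraction M S a s"
proof
  interpret S: submonoid S M by fact
  fix x assume "x \<in> fraction M S b t"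
  then obtain c r v where x: "x = (c, r)" "c \<in> carrier M" "r \<in> S" "v \<in> S"
    and v: "v \<otimes> (b \<otimes> r) = v \<otimes> (c \<otimes> t)" by (auto simp: fraction_def)
  have car: "s \<in> carrier M" "t \<in> carrier M" "u \<in> carrier M" "r \<in> carrier M" "v \<in> carrier M"
    using a u x S.subset by auto
  have "(u \<otimes> v \<otimes> t) \<otimes> (a \<otimes> r) = (v \<otimes> r) \<otimes> (u \<otimes> (a \<otimes> t))"
    using car a x by (simp add: m_ac)
  also have "\<dots> = (u \<otimes> s) \<otimes> (v \<otimes> (b \<otimes> r))"
    unfolding u(2) using car a x by (simp add: m_ac)
  also have "\<dots> = (u \<otimes> v \<otimes> t) \<otimes> (c \<otimes> s)"
    unfolding v using car a x by (simp add: m_ac)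
  finally show "x \<in> fraction M S a s"
    using a u x by (auto simp: fraction_def intro!: bexI[of _ "u \<otimes> v \<otimes> t"])
qed

lemma fraction_eq_iff:
  assumes S: "submonoid S M" and a: "a \<in> carrier M" "s \<in> S" "b \<in> carrier M" "t \<in> S"
  shows "fraction M S a s = fraction M S b t \<longleftrightarrow> (\<exists>u \<in> S. u \<otimes> (a \<otimes> t) = u \<otimes> (b \<otimes> s))"
proof
  assume "fraction M S a s = fraction M S b t"
  then have "(b, t) \<in> fraction M S a s" using fraction_refl[OF S a(3,4)] by simp
  then show "\<exists>u \<in> S. u \<otimes> (a \<otimes> t) = u \<otimes> (b \<otimes> s)" by (auto simp: fraction_def)
next
  assume "\<exists>u \<in> S. u \<otimes> (a \<otimes> t) = u \<otimes> (b \<otimes> s)"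
  then obtain u where u: "u \<in> S" "u \<otimes> (a \<otimes> t) = u \<otimes> (b \<otimes> s)" by blast
  show "fraction M S a s = fraction M S b t"
    using fraction_mono[OF S a u] fraction_mono[OF S a(3,4,1,2) u(1) u(2)[symmetric]] by blast
qed

lemma fraction_mult:
  assumes S: "submonoid S M" and a: "a \<in> carrier M" "s \<in> S" "b \<in> carrier M" "t \<in> S"
  shows "fraction M S a s \<otimes>\<^bsub>localization M S\<^esub> fraction M S b t = fraction M S (a \<otimes> b) (s \<otimes> t)"
proof -
  interpret S: submonoid S M by fact
  have *: "fraction M S (a' \<otimes> b') (s' \<otimes> t') = fraction M S (a \<otimes> b) (s \<otimes> t)"
    if "(a', s') \<in> fraction M S a s" "(b', t') \<in> fraction M S b t" for a' b' s' t'
  proof -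
    from that obtain u v where uv: "u \<in> S" "v \<in> S" "u \<otimes> (a \<otimes> s') = u \<otimes> (a' \<otimes> s)"
      "v \<otimes> (b \<otimes> t') = v \<otimes> (b' \<otimes> t)" and c: "a' \<in> carrier M" "b' \<in> carrier M" "s' \<in> S" "t' \<in> S"
      by (auto simp: fraction_def)
    have car: "s \<in> carrier M" "t \<in> carrier M" "u \<in> carrier M" "v \<in> carrier M"
      "s' \<in> carrier M" "t' \<in> carrier M" using a uv c S.subset by auto
    have "(u \<otimes> v) \<otimes> ((a' \<otimes> b') \<otimes> (s \<otimes> t)) = (u \<otimes> (a' \<otimes> s)) \<otimes> (v \<otimes> (b' \<otimes> t))"
      using car a c by (simp add: m_ac)
    also have "\<dots> = (u \<otimes> v) \<otimes> ((a \<otimes> b) \<otimes> (s' \<otimes> t'))"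
      unfolding uv(3,4)[symmetric] using car a c by (simp add: m_ac)
    finally show ?thesis using a c uv S by (subst fraction_eq_iff) auto
  qed
  have ne: "fraction M S a s \<noteq> {}" "fraction M S b t \<noteq> {}"
    using fraction_refl[OF S a(1,2)] fraction_refl[OF S a(3,4)] by auto
  have "(\<Union>x \<in> fraction M S a s. \<Union>y \<in> fraction M S b t. fraction M S (fst x \<otimes> fst y) (snd x \<otimes> snd y))
      = (\<Union>x \<in> fraction M S a s. \<Union>y \<in> fraction M S b t. fraction M S (a \<otimes> b) (s \<otimes> t))"
  proof (intro SUP_cong refl)
    fix x y assume "x \<in> fraction M S a s" "y \<in> fraction M S b t"
    then show "fraction M S (fst x \<otimes> fst y) (snd x \<otimes> snd y) = fraction M S (a \<otimes> b) (s \<otimes> t)"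
      by (intro *) simp_all
  qed
  also have "\<dots> = fraction M S (a \<otimes> b) (s \<otimes> t)"
    using ne by simp
  finally show ?thesis by (simp add: localization_def case_prod_unfold)
qed

lemma submonoid_powers:
  assumes "f \<in> carrier M" shows "submonoid {f [^] n | n::nat. True} M"
proof
  show "{f [^] n |n::nat. True} \<subseteq> carrier M" using assms by auto
  fix x y assume "x \<in> {f [^] n |n::nat. True}" "y \<in> {f [^] n |n::nat. True}"
  then obtain m n :: nat where "x = f [^] m" "y = f [^] n" by auto
  then have "x \<otimes> y = f [^] (m + n)" using assms by (simp add: nat_pow_mult)
  then show "x \<otimes> y \<in> {f [^] n |n::nat. True}" by auto
next
  show "\<one> \<in> {f [^] n |n::nat. True}" by (auto intro: exI[of _ "0::nat"])
qed

lemma prime_pow_notin: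
  assumes "prime_ideal M p" "f \<in> carrier M" "f \<notin> p" shows "f [^] (n::nat) \<notin> p"
proof -
  interpret P: submonoid "carrier M - p" M using assms by (simp add: prime_ideal_def)
  have "f [^] n \<in> carrier M - p" 
  proof (induction n)
    case 0
    show ?case using P.one_closed by simp
  next
    case (Suc n)
    then show ?case using P.m_closed[of "f [^] n" f] assms by simp
  qed
  then show ?thesis by blast
qed

text \<open>The closed point of \<open>basic_open M f\<close>.\<close>

lemma closed_point:
  assumes f: "f \<in> carrier M" and nil: "\<And>n::nat. f [^] n \<noteq> absorb M"
  defines "m \<equiv> {a \<in> carrier M. \<forall>b \<in> carrier M. \<forall>n::nat. a \<otimes> b \<noteq> f [^] n}"
  shows "m \<in> basic_open M f" and "\<And>U. openin (Spec M) U \<Longrightarrow> m \<in> U \<Longrightarrow> basic_open M f \<subseteq> U"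
proof -
  have one: "\<one> \<notin> m" using f by (auto simp: m_def intro!: bexI[of _ f] exI[of _ "1::nat"])
  have fm: "f \<notin> m" using f by (auto simp: m_def intro!: bexI[of _ "\<one>"] exI[of _ "1::nat"])
  have am: "absorb M \<in> m"
    using nil absorb_left absorb_closed by (auto simp: m_def) metis
  have id: "a \<otimes> b \<in> m" if "a \<in> m" "b \<in> carrier M" for a b
    using that by (auto simp: m_def m_assoc)
  have mult: "x \<otimes> y \<notin> m" if x: "x \<in> carrier M - m" and y: "y \<in> carrier M - m" for x y
  proof -
    obtain b c and n k :: nat where bc: "b \<in> carrier M" "c \<in> carrier M" "x \<otimes> b = f [^] n" "y \<otimes> c = f [^] k"
      using x y by (auto simp: m_def)
    have "(x \<otimes> y) \<otimes> (b \<otimes> c) = (x \<otimes> b) \<otimes> (y \<otimes> c)" using x y bc(1,2) by (simp add: m_ac)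
    also have "\<dots> = f [^] (n + k)" using f bc by (simp add: nat_pow_mult)
    finally show ?thesis using bc by (auto simp: m_def)
  qed
  have "submonoid (carrier M - m) M"
    using one mult by unfold_locales auto
  then show mD: "m \<in> basic_open M f"
    using am id fm by (auto simp: basic_open_def prime_ideal_def) (auto simp: m_def)
  fix U assume "openin (Spec M) U" "m \<in> U"
  then obtain g where g: "g \<in> carrier M" "g \<notin> m" "basic_open M g \<subseteq> U"
    by (auto simp: openin_Spec_iff basic_open_def)
  then obtain b and n::nat where b: "b \<in> carrier M" "g \<otimes> b = f [^] n" by (auto simp: m_def)
  have "basic_open M f \<subseteq> basic_open M g"
  proof
    fix p assume "p \<in> basic_open M f"
    then have p: "prime_ideal M p" "f \<notin> p" by (auto simp: basic_open_def)
    then have "g \<otimes> b \<notin> p" using prime_pow_notin f b by simp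
    then have "g \<notin> p" using p(1) b(1) unfolding prime_ideal_def by blast
    then show "p \<in> basic_open M g" using p(1) by (simp add: basic_open_def)
  qed
  then show "basic_open M f \<subseteq> U" using g by blast
qed

text \<open>The canonical map from \<open>M\<^sub>f\<close> to the sections over \<open>basic_open M f\<close> is an isomorphism of binoids.\<close>

theorem structure_sheaf_basic_open:
  assumes f: "f \<in> carrier M"
  obtains \<phi> where "\<phi> \<in> iso (localization_at_element M f) (sec (structure_sheaf M) (basic_open M f))"
    and "\<phi> (absorb (localization_at_element M f)) = absorb (sec (structure_sheaf M) (basic_open M f))"
    and "\<And>a n. a \<in> carrier M \<Longrightarrow> \<phi> (fraction M {f [^] n | n::nat. True} a (f [^] (n::nat)))
           = (\<lambda>\<pp> \<in> basic_open M f. fraction M (carrier M - \<pp>) a (f [^] n))"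
proof -
  define S where "S = {f [^] n | n::nat. True}"
  define D where "D = basic_open M f"
  define \<phi> where "\<phi> x = (\<lambda>\<pp> \<in> D. fraction M (carrier M - \<pp>) (fst (SOME y. y \<in> x)) (snd (SOME y. y \<in> x)))" for x
  have S: "submonoid S M" using submonoid_powers[OF f] by (simp add: S_def)
  have SI: "f [^] n \<in> S" for n :: nat by (auto simp: S_def)
  have D: "submonoid (carrier M - p) M" "S \<subseteq> carrier M - p" if "p \<in> D" for p
    using that f prime_pow_notin by (auto simp: D_def basic_open_def prime_ideal_def S_def)
  have \<phi>: "\<phi> (fraction M S a s) = (\<lambda>\<pp> \<in> D. fraction M (carrier M - \<pp>) a s)" if as: "a \<in> carrier M" "s \<in> S" for a s
  proof -
    define y where "y = (SOME y. y \<in> fraction M S a s)"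
    have "y \<in> fraction M S a s" unfolding y_def using fraction_refl[OF S as] by (rule someI)
    then have y: "fst y \<in> carrier M" "snd y \<in> S" "\<exists>u\<in>S. u \<otimes> (a \<otimes> snd y) = u \<otimes> (fst y \<otimes> s)"
      by (auto simp: fraction_def)
    have "fraction M (carrier M - p) (fst y) (snd y) = fraction M (carrier M - p) a s" if "p \<in> D" for p
    proof -
      have "s \<in> carrier M - p" "snd y \<in> carrier M - p" using D(2)[OF that] as y by auto
      moreover have "\<exists>u \<in> carrier M - p. u \<otimes> (a \<otimes> snd y) = u \<otimes> (fst y \<otimes> s)"
        using y(3) D(2)[OF that] by blast
      ultimately show ?thesis
        by (intro fraction_eq_iff[OF D(1)[OF that] as(1) _ y(1), THEN iffD2, symmetric])
    qed
    then show ?thesis unfolding \<phi>_def y_def[symmetric] by (rule restrict_ext)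
  qed
  let ?L = "localization M S" and ?O = "sec (structure_sheaf M) D"
  have L: "x \<in> carrier ?L \<longleftrightarrow> (\<exists>a s. a \<in> carrier M \<and> s \<in> S \<and> x = fraction M S a s)" for x
    by (auto simp: localization_def)
  have LE: thesis if "x \<in> carrier ?L" "\<And>a s. \<lbrakk>a \<in> carrier M; s \<in> S; x = fraction M S a s\<rbrakk> \<Longrightarrow> thesis" for x thesis
    using that L[of x] by auto
  have O: "carrier ?O = structure_sections M D"
    "mult ?O = (\<lambda>s t. \<lambda>\<pp> \<in> D. s \<pp> \<otimes>\<^bsub>localization M (carrier M - \<pp>)\<^esub> t \<pp>)"
    by (auto simp: structure_sheaf_def)
  have oD: "openin (Spec M) D" unfolding D_def using f by (rule openin_basic_open)
  have closed: "\<phi> x \<in> carrier ?O" if x: "x \<in> carrier ?L" for x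
  proof -
    obtain a s where as: "a \<in> carrier M" "s \<in> S" "x = fraction M S a s" using x by (rule LE)
    have "s \<in> carrier M" using as submonoid.subset[OF S] by blast
    have s: "s \<notin> p" if "p \<in> D" for p using D(2)[OF that] as(2) by blast
    have 1: "(\<lambda>\<pp> \<in> D. fraction M (carrier M - \<pp>) a s) \<in> (\<Pi>\<^sub>E \<pp> \<in> D. carrier (localization M (carrier M - \<pp>)))"
      using as(1) s \<open>s \<in> carrier M\<close> by (auto simp: localization_def)
    have 2: "\<exists>W. openin (Spec M) W \<and> p \<in> W \<and> W \<subseteq> D \<and> (\<exists>b \<in> carrier M. \<exists>g \<in> carrier M. \<forall>q \<in> W. g \<notin> q \<and>
        (\<lambda>\<pp> \<in> D. fraction M (carrier M - \<pp>) a s) q = fraction M (carrier M - q) b g)" if "p \<in> D" for p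
      using that oD as(1) s \<open>s \<in> carrier M\<close>
      by (intro exI[of _ D] conjI bexI[of _ a] bexI[of _ s]) auto
    show ?thesis unfolding as(3) \<phi>[OF as(1,2)] O structure_sections_def using 1 2 by blast
  qed
  have mult: "\<phi> (x \<otimes>\<^bsub>?L\<^esub> y) = \<phi> x \<otimes>\<^bsub>?O\<^esub> \<phi> y" if xy: "x \<in> carrier ?L" "y \<in> carrier ?L" for x y
  proof -
    obtain a s b t where as: "a \<in> carrier M" "s \<in> S" "x = fraction M S a s"
      "b \<in> carrier M" "t \<in> S" "y = fraction M S b t" using xy by (elim LE) (rule that)
    have "s \<otimes> t \<in> S" using S as submonoid.m_closed by metis
    have "fraction M (carrier M - p) (a \<otimes> b) (s \<otimes> t) =
      fraction M (carrier M - p) a s \<otimes>\<^bsub>localization M (carrier M - p)\<^esub> fraction M (carrier M - p) b t" if "p \<in> D" for p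
      using fraction_mult[OF D(1)[OF that] as(1) _ as(4), of s t] D(2)[OF that] as(2,5) by auto
    then show ?thesis
      unfolding as(3,6) fraction_mult[OF S as(1,2,4,5)] O
      using as \<open>s \<otimes> t \<in> S\<close> by (simp add: \<phi> cong: restrict_cong)
  qed
  have bij: "bij_betw \<phi> (carrier ?L) (carrier ?O)"
  proof (cases "\<exists>n::nat. f [^] n = absorb M")
    case True
    then have "absorb M \<in> S" using SI by metis
    have De: "D = {}"
    proof (rule equals0I)
      fix p assume p: "p \<in> D"
      then have "absorb M \<notin> p" using D(2) \<open>absorb M \<in> S\<close> by blast
      then show False using p by (simp add: D_def basic_open_def prime_ideal_def)
    qed
    have "x = fraction M S \<one> \<one>" if x: "x \<in> carrier ?L" for x
    proof -
      obtain a s where as: "a \<in> carrier M" "s \<in> S" "x = fraction M S a s" using x by (rule LE)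
      then have "s \<in> carrier M" using submonoid.subset[OF S] by blast
      show ?thesis unfolding as(3) fraction_eq_iff[OF S as(1,2) one_closed submonoid.one_closed[OF S]]
        using as \<open>absorb M \<in> S\<close> \<open>s \<in> carrier M\<close>
        by (intro bexI[of _ "absorb M"]) (simp_all add: absorb_left)
    qed
    moreover have "fraction M S \<one> \<one> \<in> carrier ?L" by (subst L) (use submonoid.one_closed[OF S] in auto)
    ultimately have "carrier ?L = {fraction M S \<one> \<one>}" by blast
    moreover have "carrier ?O = {\<lambda>x. undefined}" by (simp only: O(1)) (simp add: structure_sections_def De)
    moreover have "\<phi> (fraction M S \<one> \<one>) = (\<lambda>x. undefined)" by (auto simp: \<phi>_def De)
    ultimately show ?thesis by (simp add: bij_betw_def)
  next
    case False
    define m where "m = {a \<in> carrier M. \<forall>b \<in> carrier M. \<forall>n::nat. a \<otimes> b \<noteq> f [^] n}"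
    have nil: "f [^] n \<noteq> absorb M" for n :: nat using False by blast
    have mD: "m \<in> D"
      unfolding m_def D_def by (rule closed_point(1)[OF f nil])
    have mU: "D \<subseteq> U" if "openin (Spec M) U" "m \<in> U" for U
      using that unfolding m_def D_def by (rule closed_point(2)[OF f nil])
    have div: "\<exists>b \<in> carrier M. a \<otimes> b \<in> S" if "a \<in> carrier M" "a \<notin> m" for a
      using that by (auto simp: m_def S_def)
    show ?thesis unfolding bij_betw_def
    proof
      show "inj_on \<phi> (carrier ?L)"
      proof (rule inj_onI)
        fix x y assume "x \<in> carrier ?L" "y \<in> carrier ?L" and eq: "\<phi> x = \<phi> y"
        then obtain a s b t where as: "a \<in> carrier M" "s \<in> S" "x = fraction M S a s"
          "b \<in> carrier M" "t \<in> S" "y = fraction M S b t" by (elim LE) (rule that)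
        have st: "s \<in> carrier M" "t \<in> carrier M" using as submonoid.subset[OF S] by blast+
        have "fraction M (carrier M - m) a s = fraction M (carrier M - m) b t"
          using fun_cong[OF eq, of m] mD as \<phi> by simp
        moreover have "s \<in> carrier M - m" "t \<in> carrier M - m" using as D(2)[OF mD] by blast+
        ultimately have "\<exists>u \<in> carrier M - m. u \<otimes> (a \<otimes> t) = u \<otimes> (b \<otimes> s)"
          using fraction_eq_iff[OF D(1)[OF mD] as(1) _ as(4)] by simp
        then obtain u where u: "u \<in> carrier M" "u \<notin> m" "u \<otimes> (a \<otimes> t) = u \<otimes> (b \<otimes> s)"
          by blast
        then obtain v where v: "v \<in> carrier M" "u \<otimes> v \<in> S" using div by blast
        have "(u \<otimes> v) \<otimes> (a \<otimes> t) = v \<otimes> (u \<otimes> (a \<otimes> t))" using u(1) v(1) as(1,4) st by (simp add: m_ac)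
        also have "\<dots> = (u \<otimes> v) \<otimes> (b \<otimes> s)" unfolding u(3) using u(1) v(1) as(1,4) st by (simp add: m_ac)
        finally show "x = y" unfolding as(3,6) fraction_eq_iff[OF S as(1,2,4,5)] using v(2) by blast
      qed
      show "\<phi> ` carrier ?L = carrier ?O"
      proof
        show "\<phi> ` carrier ?L \<subseteq> carrier ?O" using closed by blast
        show "carrier ?O \<subseteq> \<phi> ` carrier ?L"
        proof
          fix \<sigma> assume "\<sigma> \<in> carrier ?O"
          then have \<sigma>: "\<sigma> \<in> structure_sections M D" by (simp only: O)
          then have ext: "\<sigma> \<in> extensional D" by (simp add: structure_sections_def PiE_def)
          obtain W a g where W: "openin (Spec M) W" "m \<in> W" and ag: "a \<in> carrier M" "g \<in> carrier M"
            and Wag: "\<forall>q \<in> W. g \<notin> q \<and> \<sigma> q = fraction M (carrier M - q) a g"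
          proof -
            from \<sigma> have "\<forall>p \<in> D. \<exists>W. openin (Spec M) W \<and> p \<in> W \<and> W \<subseteq> D \<and> (\<exists>a \<in> carrier M.
              \<exists>g \<in> carrier M. \<forall>q \<in> W. g \<notin> q \<and> \<sigma> q = fraction M (carrier M - q) a g)"
              by (simp add: structure_sections_def)
            from bspec[OF this mD] show thesis by (elim exE conjE bexE) (rule that)
          qed
          have g: "g \<notin> q" "\<sigma> q = fraction M (carrier M - q) a g" if "q \<in> D" for q
            using Wag mU[OF W] that by auto
          obtain b where b: "b \<in> carrier M" "g \<otimes> b \<in> S" using div[of g] ag(2) g(1)[OF mD] by blast
          have "\<sigma> q = fraction M (carrier M - q) (a \<otimes> b) (g \<otimes> b)" if q: "q \<in> D" for q
          proof -
            have "g \<otimes> b \<in> carrier M - q" using D[OF q] b by blast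
            then have "fraction M (carrier M - q) a g = fraction M (carrier M - q) (a \<otimes> b) (g \<otimes> b)"
              using ag b q g(1)[OF q] submonoid.one_closed[OF D(1)[OF q]]
              by (intro fraction_eq_iff[OF D(1)[OF q], THEN iffD2] bexI[of _ "\<one>"]) (simp_all add: m_ac)
            then show ?thesis using g(2)[OF q] by simp
          qed
          then have "\<sigma> = \<phi> (fraction M S (a \<otimes> b) (g \<otimes> b))"
            using ag(1) b ext by (intro extensionalityI[of _ D]) (simp_all add: \<phi>)
          moreover have "fraction M S (a \<otimes> b) (g \<otimes> b) \<in> carrier ?L"
            by (subst L) (use ag b in auto)
          ultimately show "\<sigma> \<in> \<phi> ` carrier ?L" by (rule image_eqI)
        qed
      qed
    qed
  qed
  have abs: "\<phi> (absorb ?L) = absorb ?O"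
    using \<phi>[OF absorb_closed submonoid.one_closed[OF S]]
    by (auto simp: localization_def structure_sheaf_def cong: restrict_cong)
  have "\<phi> \<in> hom ?L ?O" using closed mult by (rule homI)
  then have iso: "\<phi> \<in> iso ?L ?O" using bij by (simp add: iso_def)
  show thesis
  proof (rule that)
    show "\<phi> \<in> iso (localization_at_element M f) (sec (structure_sheaf M) (basic_open M f))"
      using iso by (simp add: localization_at_element_def S_def D_def)
    show "\<phi> (absorb (localization_at_element M f)) = absorb (sec (structure_sheaf M) (basic_open M f))"
      using abs by (simp add: localization_at_element_def S_def D_def)
    show "\<phi> (fraction M {f [^] n | n::nat. True} a (f [^] n)) =
      (\<lambda>\<pp> \<in> basic_open M f. fraction M (carrier M - \<pp>) a (f [^] n))" if "a \<in> carrier M" for a and n :: nat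
      using \<phi>[OF that SI] by (simp add: S_def D_def)
  qed
qed

end


section \<open>Sets over a binoid and their smash product\<close>

record ('r, 's) bset =
  points :: "'s set"
  basept :: 's
  act :: "'r \<Rightarrow> 's \<Rightarrow> 's"

locale binoid_set = binoid M for M (structure) +
  fixes S :: "('a, 's) bset"
  assumes basept_closed: "basept S \<in> points S"
    and act_closed: "\<lbrakk>a \<in> carrier M; s \<in> points S\<rbrakk> \<Longrightarrow> act S a s \<in> points S"
    and act_one: "s \<in> points S \<Longrightarrow> act S \<one> s = s"
    and act_mult: "\<lbrakk>a \<in> carrier M; b \<in> carrier M; s \<in> points S\<rbrakk>
      \<Longrightarrow> act S (a \<otimes> b) s = act S a (act S b s)"
    and act_absorb: "s \<in> points S \<Longrightarrow> act S (absorb M) s = basept S"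
    and act_basept: "a \<in> carrier M \<Longrightarrow> act S a (basept S) = basept S"

definition bset_iso :: "('r, 'z) binoid_scheme \<Rightarrow> ('r, 's) bset \<Rightarrow> ('r, 't) bset \<Rightarrow> ('s \<Rightarrow> 't) \<Rightarrow> bool" where
  "bset_iso M S T \<phi> \<longleftrightarrow> bij_betw \<phi> (points S) (points T) \<and> \<phi> (basept S) = basept T \<and>
     (\<forall>a \<in> carrier M. \<forall>s \<in> points S. \<phi> (act S a s) = act T a (\<phi> s))"

definition regular_bset :: "('r, 'z) binoid_scheme \<Rightarrow> ('r, 'r) bset" where
  "regular_bset M = \<lparr> points = carrier M, basept = absorb M, act = mult M \<rparr>"

text \<open>
  \<open>S \<and>\<^sub>M T\<close> is the quotient of \<open>S \<times> T\<close> by the equivalence relation generated by collapsing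
  \<open>S \<times> {basept} \<union> {basept} \<times> T\<close> to a point and by \<open>(a s, t) \<sim> (s, a t)\<close>.
\<close>

inductive_set smash_rel :: "('r, 'z) binoid_scheme \<Rightarrow> ('r, 's) bset \<Rightarrow> ('r, 't) bset \<Rightarrow> (('s \<times> 't) \<times> ('s \<times> 't)) set"
  for M S T where
  smash_refl: "\<lbrakk>s \<in> points S; t \<in> points T\<rbrakk> \<Longrightarrow> ((s, t), (s, t)) \<in> smash_rel M S T"
| smash_sym: "(x, y) \<in> smash_rel M S T \<Longrightarrow> (y, x) \<in> smash_rel M S T"
| smash_trans: "\<lbrakk>(x, y) \<in> smash_rel M S T; (y, z) \<in> smash_rel M S T\<rbrakk> \<Longrightarrow> (x, z) \<in> smash_rel M S T"
| smash_collapse_left: "t \<in> points T \<Longrightarrow> ((basept S, t), (basept S, basept T)) \<in> smash_rel M S T"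
| smash_collapse_right: "s \<in> points S \<Longrightarrow> ((s, basept T), (basept S, basept T)) \<in> smash_rel M S T"
| smash_balanced: "\<lbrakk>a \<in> carrier M; s \<in> points S; t \<in> points T\<rbrakk>
    \<Longrightarrow> ((act S a s, t), (s, act T a t)) \<in> smash_rel M S T"

definition smash :: "('r, 'z) binoid_scheme \<Rightarrow> ('r, 's) bset \<Rightarrow> ('r, 't) bset \<Rightarrow> ('r, ('s \<times> 't) set) bset" where
  "smash M S T =
    \<lparr> points = (points S \<times> points T) // smash_rel M S T,
      basept = smash_rel M S T `` {(basept S, basept T)},
      act = (\<lambda>a c. \<Union>(s, t) \<in> c. smash_rel M S T `` {(act S a s, t)}) \<rparr>"


section \<open>Sheaves of sets over a sheaf of binoids\<close>

text \<open>
  In what follows \<open>\<O>\<close> is a sheaf of binoids on \<open>X\<close>.  For open \<open>U\<close>, restricting \<open>\<O>\<close> or a sheaf of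
  \<open>\<O>\<close>-sets to \<open>U\<close> means to keep the record and to replace \<open>X\<close> by \<open>subtopology X U\<close>: all
  notions only inspect the values on open sets of the given space.
\<close>

locale oset_sheaf = sheaf X "\<lambda>V. points (sec F V)" "res F"
  for X :: "'x topology" and \<O> :: "('x, 'r, 'r binoid) presheaf"
    and F :: "('x, 's, ('r, 's) bset) presheaf" +
  assumes binoid_set_sec: "openin X V \<Longrightarrow> binoid_set (sec \<O> V) (sec F V)"
    and res_basept: "\<lbrakk>openin X V; openin X W; W \<subseteq> V\<rbrakk>
      \<Longrightarrow> res F V W (basept (sec F V)) = basept (sec F W)"
    and res_act: "\<lbrakk>openin X V; openin X W; W \<subseteq> V; a \<in> carrier (sec \<O> V); s \<in> points (sec F V)\<rbrakk>
      \<Longrightarrow> res F V W (act (sec F V) a s) = act (sec F W) (res \<O> V W a) (res F V W s)"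

definition regular_oset :: "('x, 'r, 'r binoid) presheaf \<Rightarrow> ('x, 'r, ('r, 'r) bset) presheaf" where
  "regular_oset \<O> = \<lparr> sec = (\<lambda>V. regular_bset (sec \<O> V)), res = res \<O> \<rparr>"

definition oset_isomorphic ::
    "'x topology \<Rightarrow> ('x, 'r, 'r binoid) presheaf \<Rightarrow> ('x, 's, ('r, 's) bset) presheaf \<Rightarrow>
     ('x, 't, ('r, 't) bset) presheaf \<Rightarrow> bool" where
  "oset_isomorphic X \<O> F G \<longleftrightarrow>
    (\<exists>\<phi>. (\<forall>V. openin X V \<longrightarrow> bset_iso (sec \<O> V) (sec F V) (sec G V) (\<phi> V)) \<and>
         (\<forall>V W. openin X V \<and> openin X W \<and> W \<subseteq> V \<longrightarrow>
            (\<forall>s \<in> points (sec F V). \<phi> W (res F V W s) = res G V W (\<phi> V s))))"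

definition invertible_oset ::
    "'x topology \<Rightarrow> ('x, 'r, 'r binoid) presheaf \<Rightarrow> ('x, 's, ('r, 's) bset) presheaf \<Rightarrow> bool" where
  "invertible_oset X \<O> F \<longleftrightarrow> oset_sheaf X \<O> F \<and>
    (\<forall>x \<in> topspace X. \<exists>W. openin X W \<and> x \<in> W \<and>
       oset_isomorphic (subtopology X W) \<O> F (regular_oset \<O>))"


subsection \<open>Sheafification and the smash product of sheaves\<close>

definition germ ::
    "'x topology \<Rightarrow> ('x, 's, ('r, 's) bset) presheaf \<Rightarrow> 'x \<Rightarrow> 'x set \<Rightarrow> 's \<Rightarrow> ('x set \<times> 's) set" where
  "germ X P x V s = {(V', s'). openin X V' \<and> x \<in> V' \<and> s' \<in> points (sec P V') \<and>
     (\<exists>W. openin X W \<and> x \<in> W \<and> W \<subseteq> V \<inter> V' \<and> res P V W s = res P V' W s')}"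

definition stalk ::
    "'x topology \<Rightarrow> ('x, 's, ('r, 's) bset) presheaf \<Rightarrow> 'x \<Rightarrow> ('x set \<times> 's) set set" where
  "stalk X P x = {germ X P x V s | V s. openin X V \<and> x \<in> V \<and> s \<in> points (sec P V)}"

definition sheafify ::
    "'x topology \<Rightarrow> ('x, 'r, 'r binoid) presheaf \<Rightarrow> ('x, 's, ('r, 's) bset) presheaf \<Rightarrow>
     ('x, 'x \<Rightarrow> ('x set \<times> 's) set, ('r, 'x \<Rightarrow> ('x set \<times> 's) set) bset) presheaf" where
  "sheafify X \<O> P =
    \<lparr> sec = (\<lambda>V.
        \<lparr> points = {\<sigma> \<in> (\<Pi>\<^sub>E x \<in> V. stalk X P x).
            \<forall>x \<in> V. \<exists>W. openin X W \<and> x \<in> W \<and> W \<subseteq> V \<and>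
              (\<exists>s \<in> points (sec P W). \<forall>y \<in> W. \<sigma> y = germ X P y W s)},
          basept = (\<lambda>x \<in> V. germ X P x V (basept (sec P V))),
          act = (\<lambda>a \<sigma>. \<lambda>x \<in> V. \<Union>(W, s) \<in> {(W, s) \<in> \<sigma> x. W \<subseteq> V}.
            germ X P x W (act (sec P W) (res \<O> V W a) s)) \<rparr>),
      res = (\<lambda>V W \<sigma>. restrict \<sigma> W) \<rparr>"

definition smash_presheaf ::
    "('x, 'r, 'r binoid) presheaf \<Rightarrow> ('x, 's, ('r, 's) bset) presheaf \<Rightarrow> ('x, 't, ('r, 't) bset) presheaf \<Rightarrow>
     ('x, ('s \<times> 't) set, ('r, ('s \<times> 't) set) bset) presheaf" where
  "smash_presheaf \<O> F G =
    \<lparr> sec = (\<lambda>V. smash (sec \<O> V) (sec F V) (sec G V)),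
      res = (\<lambda>V W c. \<Union>(s, t) \<in> c.
        smash_rel (sec \<O> W) (sec F W) (sec G W) `` {(res F V W s, res G V W t)}) \<rparr>"

definition smash_sheaf where
  "smash_sheaf X \<O> F G = sheafify X \<O> (smash_presheaf \<O> F G)"


section \<open>The Picard group\<close>

text \<open>
  Isomorphism classes are formed among the invertible sheaves whose sections are of the same type
  \<open>'r\<close> as those of \<open>\<O>\<close>.  The smash product of two such sheaves has sections of a different type;
  its class consists of the invertible sheaves with sections in \<open>'r\<close> that are isomorphic to it.
\<close>

definition invertible_iso_rel ::
    "'x topology \<Rightarrow> ('x, 'r, 'r binoid) presheaf \<Rightarrow> ('x, 's, ('r, 's) bset) presheaf rel" where
  "invertible_iso_rel X \<O> =
    {(F, G). invertible_oset X \<O> F \<and> invertible_oset X \<O> G \<and> oset_isomorphic X \<O> F G}"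

definition picard ::
    "'x topology \<Rightarrow> ('x, 'r, 'r binoid) presheaf \<Rightarrow> ('x, 'r, ('r, 'r) bset) presheaf set monoid" where
  "picard X \<O> =
    \<lparr> carrier = {F. invertible_oset X \<O> F} // invertible_iso_rel X \<O>,
      mult = (\<lambda>A B. {H. invertible_oset X \<O> H \<and>
        (\<exists>F \<in> A. \<exists>G \<in> B. oset_isomorphic X \<O> H (smash_sheaf X \<O> F G))}),
      one = invertible_iso_rel X \<O> `` {regular_oset \<O>} \<rparr>"

text \<open>
  For the structure sheaf, working with sections of the type \<open>'a section_fun\<close> is no restriction:
  sections of an invertible sheaf are determined by their germs, and the stalk at \<open>\<pp>\<close> is in
  bijection with the localization at \<open>\<pp>\<close>, so that every invertible sheaf is isomorphic to one
  whose sections over \<open>V\<close> are families of elements of these localizations indexed by \<open>V\<close>.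
\<close>

definition Pic :: "('a, 'z) binoid_scheme \<Rightarrow> 'a set set \<Rightarrow>
    ('a set, 'a section_fun, ('a section_fun, 'a section_fun) bset) presheaf set monoid" where
  "Pic M U = picard (subtopology (Spec M) U) (structure_sheaf M)"

end

theory Submission
  imports Defs "HOL-Algebra.FiniteProduct"
begin

text \<open>
  Every prime \<open>\<pp>\<close> has a least open neighbourhood, the set of primes contained in \<open>\<pp>\<close>, and the generic
  point \<open>{\<infinity>}\<close> lies in every nonempty open set.  Hence an invertible sheaf on \<open>U\<close> is trivial on each of
  these neighbourhoods, and comparing generators with one at the generic point turns it into
  a Cartier divisor: elements \<open>c \<pp>\<close> of the difference group \<open>\<Gamma>\<close>, one for each \<open>\<pp> \<in> U\<close>, such that
  \<open>c \<pp> / c \<qq>\<close> is a unit of \<open>M\<^sub>\<qq>\<close> for \<open>\<qq> \<subseteq> \<pp>\<close>.  The smash product multiplies divisors, and two of them give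
  isomorphic sheaves iff they differ by a constant \<open>\<gamma> \<in> \<Gamma>\<close> up to units of the \<open>M\<^sub>\<pp>\<close>.  So the Picard group
  is a group of divisor classes, restriction to \<open>U'\<close> restricts divisors, and its injectivity says that
  an element of \<open>\<Gamma>\<close> which is a unit in \<open>M\<^sub>\<qq>\<close> for all \<open>\<qq> \<subseteq> \<pp>\<close> of height one is a unit in \<open>M\<^sub>\<pp>\<close>.  This is
  the equality of \<open>M\<^sub>\<pp>\<close> with the intersection of these \<open>M\<^sub>\<qq>\<close>, which holds because \<open>M\<close> is normal.
\<close>

section \<open>Sheaves of sets over a sheaf of binoids\<close>

text \<open>Least neighbourhoods exist because a prime ideal is determined by which of the finitely
  many generators of \<open>M\<close> it contains; the product of the generators outside \<pp> cuts
  out the primes below \<pp>. Divisors make sense because \<open>M\<close> is integral and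
  cancellative: localization maps are then injective, so all stalks lie in one binoid, which is
  \<Gamma> with an absorbing element and has \<Gamma> as its unit group.

  The obstacle on the sheaf side is that sections of an abstract sheaf are not elements of this
  binoid, and that those of a smash product even have another type. A sheaf is therefore tied to its
  divisor by a value map (\<open>represents\<close>), and isomorphisms and products are read off
  from values.

  The equality of a stalk with the intersection of its height-one stalks is proved as for noetherian
  normal domains, without convex geometry: among the multiples of a fraction outside the stalk one
  has a maximal ideal of denominators; this ideal is prime, and normality forces height one. The
  chain condition behind this is Dickson's lemma: in any sequence of elements some term is a
  multiple of an earlier one.\<close>

abbreviation pts where
  "pts F V \<equiv> points (sec F V)"

text \<open>The empty family covers the empty set and imposes no condition, so the uniqueness in
  \<open>glue\<close> leaves exactly one section there. This settles the open set on which no germ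
  at a generic point exists.\<close>

lemma (in sheaf) sections_empty: "\<exists>z. A {} = {z}"
proof -
  have "\<exists>!t. t \<in> A (\<Union>{}) \<and> (\<forall>V \<in> {}. \<rho> (\<Union>{}) V t = undefined V)"
    by (rule glue[where \<V> = "{}"]) simp_all
  then show ?thesis by auto
qed

lemma (in sheaf) sheaf_subtopology:
  assumes "openin X U"
  shows "sheaf (subtopology X U) A \<rho>"
proof
  fix \<V> \<sigma>
  assume V: "\<And>V. V \<in> \<V> \<Longrightarrow> openin (subtopology X U) V" "\<And>V. V \<in> \<V> \<Longrightarrow> \<sigma> V \<in> A V"
    "\<And>V W. \<lbrakk>V \<in> \<V>; W \<in> \<V>\<rbrakk> \<Longrightarrow> \<rho> V (V \<inter> W) (\<sigma> V) = \<rho> W (V \<inter> W) (\<sigma> W)"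
  have "openin X V" if "V \<in> \<V>" for V
    using V(1)[OF that] assms by (simp add: openin_open_subtopology)
  then show "\<exists>!t. t \<in> A (\<Union>\<V>) \<and> (\<forall>V\<in>\<V>. \<rho> (\<Union>\<V>) V t = \<sigma> V)"
    using V(2,3) by (rule glue)
qed (use assms res_closed res_id res_res in \<open>simp_all add: openin_open_subtopology\<close>)

lemma (in oset_sheaf) oset_sheaf_subtopology:
  assumes "openin X U"
  shows "oset_sheaf (subtopology X U) \<O> F"
proof -
  interpret S: sheaf "subtopology X U" "\<lambda>V. pts F V" "res F"
    using assms by (rule sheaf_subtopology)
  show ?thesis
    by (intro oset_sheaf.intro oset_sheaf_axioms.intro S.sheaf_axioms)
      (use assms binoid_set_sec res_basept res_act in \<open>simp_all add: openin_open_subtopology\<close>)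
qed

lemma oset_isomorphicI:
  assumes "\<And>V. openin X V \<Longrightarrow> bset_iso (sec \<O> V) (sec F V) (sec G V) (\<phi> V)"
    and "\<And>V W s. \<lbrakk>openin X V; openin X W; W \<subseteq> V; s \<in> pts F V\<rbrakk>
      \<Longrightarrow> \<phi> W (res F V W s) = res G V W (\<phi> V s)"
  shows "oset_isomorphic X \<O> F G"
  unfolding oset_isomorphic_def using assms by (intro exI[of _ \<phi>]) simp

lemma oset_isomorphicE:
  assumes "oset_isomorphic X \<O> F G"
  obtains \<phi> where "\<And>V. openin X V \<Longrightarrow> bset_iso (sec \<O> V) (sec F V) (sec G V) (\<phi> V)"
    and "\<And>V W s. \<lbrakk>openin X V; openin X W; W \<subseteq> V; s \<in> pts F V\<rbrakk>
      \<Longrightarrow> \<phi> W (res F V W s) = res G V W (\<phi> V s)"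
proof -
  from assms obtain \<phi> where
    "(\<forall>V. openin X V \<longrightarrow> bset_iso (sec \<O> V) (sec F V) (sec G V) (\<phi> V)) \<and>
     (\<forall>V W. openin X V \<and> openin X W \<and> W \<subseteq> V \<longrightarrow>
        (\<forall>s \<in> pts F V. \<phi> W (res F V W s) = res G V W (\<phi> V s)))"
    unfolding oset_isomorphic_def by (elim exE)
  then show thesis by (intro that[of \<phi>]) simp_all
qed

lemma oset_isomorphic_subtopology:
  assumes "openin X U" and iso: "oset_isomorphic X \<O> F G"
  shows "oset_isomorphic (subtopology X U) \<O> F G"
proof -
  from iso obtain \<phi> where \<phi>:
    "\<And>V. openin X V \<Longrightarrow> bset_iso (sec \<O> V) (sec F V) (sec G V) (\<phi> V)"
    "\<And>V W s. \<lbrakk>openin X V; openin X W; W \<subseteq> V; s \<in> pts F V\<rbrakk>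
      \<Longrightarrow> \<phi> W (res F V W s) = res G V W (\<phi> V s)"
    by (rule oset_isomorphicE) blast
  then show ?thesis
    using assms(1) by (intro oset_isomorphicI[of _ _ _ _ \<phi>]) (simp_all add: openin_open_subtopology)
qed

lemma bset_iso_sym:
  assumes "binoid_set M S" and iso: "bset_iso M S T \<phi>"
  shows "bset_iso M T S (inv_into (points S) \<phi>)"
proof -
  interpret binoid_set M S by fact
  have bij: "bij_betw \<phi> (points S) (points T)" and base: "\<phi> (basept S) = basept T"
    and act: "\<And>a s. a \<in> carrier M \<Longrightarrow> s \<in> points S \<Longrightarrow> \<phi> (act S a s) = act T a (\<phi> s)"
    using iso by (auto simp: bset_iso_def)
  let ?\<psi> = "inv_into (points S) \<phi>"
  have \<psi>: "?\<psi> (\<phi> s) = s" if "s \<in> points S" for s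
    using bij_betw_inv_into_left[OF bij that] .
  have "?\<psi> (act T a t) = act S a (?\<psi> t)" if a: "a \<in> carrier M" and t: "t \<in> points T" for a t
  proof -
    obtain s where s: "s \<in> points S" "t = \<phi> s" using bij t by (auto simp: bij_betw_def)
    then show ?thesis using a act_closed \<psi> by (simp add: act[symmetric])
  qed
  moreover have "?\<psi> (basept T) = basept S" using \<psi>[OF basept_closed] base by simp
  ultimately show ?thesis using bij_betw_inv_into[OF bij] by (simp add: bset_iso_def)
qed

text \<open>Only \<open>F\<close> has to be a sheaf: the sections of \<open>G\<close> are images of
  sections of \<open>F\<close>, so compatibility with action and restriction is checked on
  preimages, and these stay in \<open>F\<close>.\<close>

lemma oset_isomorphic_sym:
  assumes "oset_sheaf X \<O> F" and iso: "oset_isomorphic X \<O> F G"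
  shows "oset_isomorphic X \<O> G F"
proof -
  interpret oset_sheaf X \<O> F by fact
  from iso obtain \<phi> where \<phi>: "\<And>V. openin X V \<Longrightarrow> bset_iso (sec \<O> V) (sec F V) (sec G V) (\<phi> V)"
    "\<And>V W s. \<lbrakk>openin X V; openin X W; W \<subseteq> V; s \<in> pts F V\<rbrakk>
      \<Longrightarrow> \<phi> W (res F V W s) = res G V W (\<phi> V s)"
    by (rule oset_isomorphicE) blast
  define \<psi> where "\<psi> V = inv_into (pts F V) (\<phi> V)" for V
  have "\<psi> W (res G V W t) = res F V W (\<psi> V t)"
    if V: "openin X V" "openin X W" "W \<subseteq> V" "t \<in> pts G V" for V W t
  proof -
    have bij: "bij_betw (\<phi> V) (pts F V) (pts G V)"
      "bij_betw (\<phi> W) (pts F W) (pts G W)"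
      using \<phi>(1) V by (auto simp: bset_iso_def)
    have "t \<in> \<phi> V ` pts F V" using V(4) by (simp add: bij_betw_imp_surj_on[OF bij(1)])
    then obtain s where s: "s \<in> pts F V" "t = \<phi> V s" by blast
    then have "res F V W s \<in> pts F W" using res_closed V by blast
    then have "\<psi> W (\<phi> W (res F V W s)) = res F V W s" "\<psi> V (\<phi> V s) = s"
      using s(1) bij by (simp_all add: \<psi>_def bij_betw_inv_into_left)
    then show ?thesis using s \<phi>(2)[OF V(1-3)] by simp
  qed
  moreover have "bset_iso (sec \<O> V) (sec G V) (sec F V) (\<psi> V)" if "openin X V" for V
    unfolding \<psi>_def using binoid_set_sec[OF that] \<phi>(1)[OF that] by (rule bset_iso_sym)
  ultimately show ?thesis by (intro oset_isomorphicI[of _ _ _ _ \<psi>])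
qed


section \<open>Cocycles and the sheaves they represent\<close>

text \<open>
  \<open>D x\<close> is the least neighbourhood of \<open>x\<close>, \<open>K\<close> the stalk of \<open>\<O>\<close> at the generic point \<open>\<eta>\<close>, \<open>R x\<close> the stalk
  at \<open>x\<close> as a subset of \<open>K\<close>, and \<open>ev V\<close> sends a section over \<open>V\<close> to its germ at \<open>\<eta>\<close>.
\<close>

locale generic_binoid_space = binoid K for K (structure) +
  fixes X :: "'x topology" and \<eta> :: 'x and D :: "'x \<Rightarrow> 'x set" and R :: "'x \<Rightarrow> 'a set"
    and \<O> :: "('x, 'r, 'r binoid) presheaf" and ev :: "'x set \<Rightarrow> 'r \<Rightarrow> 'a"
  assumes openin_D: "x \<in> topspace X \<Longrightarrow> openin X (D x)"
    and D_self: "x \<in> topspace X \<Longrightarrow> x \<in> D x"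
    and D_least: "\<lbrakk>openin X V; x \<in> V\<rbrakk> \<Longrightarrow> D x \<subseteq> V"
    and openin_generic: "openin X {\<eta>}"
    and generic_mem: "\<lbrakk>openin X V; V \<noteq> {}\<rbrakk> \<Longrightarrow> \<eta> \<in> V"
    and R_submonoid: "x \<in> topspace X \<Longrightarrow> submonoid (R x) K"
    and absorb_R: "x \<in> topspace X \<Longrightarrow> absorb K \<in> R x"
    and R_mono: "\<lbrakk>x \<in> topspace X; y \<in> D x\<rbrakk> \<Longrightarrow> R x \<subseteq> R y"
    and R_generic: "R \<eta> = carrier K"
    and binoid_O: "openin X V \<Longrightarrow> binoid (sec \<O> V)"
    and O_res_closed: "\<lbrakk>openin X V; openin X W; W \<subseteq> V; a \<in> carrier (sec \<O> V)\<rbrakk>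
      \<Longrightarrow> res \<O> V W a \<in> carrier (sec \<O> W)"
    and O_empty: "\<exists>z. carrier (sec \<O> {}) = {z}"
    and ev_bij: "\<lbrakk>openin X V; V \<noteq> {}\<rbrakk> \<Longrightarrow> bij_betw (ev V) (carrier (sec \<O> V)) (\<Inter>x \<in> V. R x)"
    and ev_mult: "\<lbrakk>openin X V; V \<noteq> {}; a \<in> carrier (sec \<O> V); b \<in> carrier (sec \<O> V)\<rbrakk>
      \<Longrightarrow> ev V (a \<otimes>\<^bsub>sec \<O> V\<^esub> b) = ev V a \<otimes> ev V b"
    and ev_one: "\<lbrakk>openin X V; V \<noteq> {}\<rbrakk> \<Longrightarrow> ev V \<one>\<^bsub>sec \<O> V\<^esub> = \<one>"
    and ev_absorb: "\<lbrakk>openin X V; V \<noteq> {}\<rbrakk> \<Longrightarrow> ev V (absorb (sec \<O> V)) = absorb K"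
    and ev_res: "\<lbrakk>openin X V; openin X W; W \<subseteq> V; W \<noteq> {}; a \<in> carrier (sec \<O> V)\<rbrakk>
      \<Longrightarrow> ev W (res \<O> V W a) = ev V a"
begin

abbreviation on :: "'x set \<Rightarrow> 'x topology" where
  "on U \<equiv> subtopology X U"

abbreviation scalars :: "'x set \<Rightarrow> 'r set" where
  "scalars V \<equiv> carrier (sec \<O> V)"

definition unit_germs :: "'x \<Rightarrow> 'a set" where
  "unit_germs x = {u \<in> Units K. u \<in> R x \<and> inv u \<in> R x}"

text \<open>These are local equations of a Cartier divisor; the corresponding Cech cocycle consists
  of the quotients \<open>c x \<otimes> inv (c x')\<close> on \<open>D x \<inter> D x'\<close>.
  Comparing \<open>x\<close> only with points of \<open>D x\<close> suffices, because two points are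
  then compared through every common point of their least neighbourhoods.\<close>

definition cocycles :: "'x set \<Rightarrow> ('x \<Rightarrow> 'a) set" where
  "cocycles U = {c \<in> U \<rightarrow> Units K. \<forall>x \<in> U. \<forall>y \<in> D x. c x \<otimes> inv (c y) \<in> unit_germs y}"

text \<open>The condition at \<open>x\<close> says that \<open>k\<close> lies in
  \<open>c x \<otimes> R x\<close>. Over nonempty open sets these are the sections of the subsheaf
  of the constant sheaf \<open>K\<close> that \<open>c x\<close> generates near
  \<open>x\<close>.\<close>

definition cocycle_sections :: "('x \<Rightarrow> 'a) \<Rightarrow> 'x set \<Rightarrow> 'a set" where
  "cocycle_sections c V = {k \<in> carrier K. \<forall>x \<in> V. inv (c x) \<otimes> k \<in> R x}"

text \<open>
  \<open>\<theta> V s\<close> is the germ of \<open>s\<close> at \<open>\<eta>\<close>, measured by a generator of the stalk at \<open>\<eta>\<close>; \<open>c x\<close> is the value of a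
  generator at \<open>x\<close>.  Nothing is required of \<open>\<theta> {}\<close>, as \<open>\<eta> \<notin> {}\<close>.
\<close>

definition represents ::
    "'x set \<Rightarrow> ('x, 's, ('r, 's) bset) presheaf \<Rightarrow> ('x \<Rightarrow> 'a) \<Rightarrow> ('x set \<Rightarrow> 's \<Rightarrow> 'a) \<Rightarrow> bool" where
  "represents U F c \<theta> \<longleftrightarrow>
    (\<exists>z. pts F {} = {z}) \<and>
    (\<forall>V. openin X V \<and> V \<subseteq> U \<longrightarrow> basept (sec F V) \<in> pts F V \<and>
      (\<forall>a \<in> scalars V. \<forall>s \<in> pts F V. act (sec F V) a s \<in> pts F V)) \<and>
    (\<forall>V W. openin X V \<and> openin X W \<and> W \<subseteq> V \<and> V \<subseteq> U \<longrightarrow>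
      (\<forall>s \<in> pts F V. res F V W s \<in> pts F W)) \<and>
    (\<forall>V. openin X V \<and> V \<subseteq> U \<and> V \<noteq> {} \<longrightarrow>
      bij_betw (\<theta> V) (pts F V) (cocycle_sections c V) \<and>
      \<theta> V (basept (sec F V)) = absorb K \<and>
      (\<forall>a \<in> scalars V. \<forall>s \<in> pts F V. \<theta> V (act (sec F V) a s) = ev V a \<otimes> \<theta> V s)) \<and>
    (\<forall>V W. openin X V \<and> openin X W \<and> W \<subseteq> V \<and> V \<subseteq> U \<and> W \<noteq> {} \<longrightarrow>
      (\<forall>s \<in> pts F V. \<theta> W (res F V W s) = \<theta> V s))"

lemma represents_empty: "represents U F c \<theta> \<Longrightarrow> \<exists>z. pts F {} = {z}"
  and represents_basept: "\<lbrakk>represents U F c \<theta>; openin X V; V \<subseteq> U\<rbrakk> \<Longrightarrow> basept (sec F V) \<in> pts F V"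
  and represents_act: "\<lbrakk>represents U F c \<theta>; openin X V; V \<subseteq> U; a \<in> scalars V; s \<in> pts F V\<rbrakk>
    \<Longrightarrow> act (sec F V) a s \<in> pts F V"
  and represents_res: "\<lbrakk>represents U F c \<theta>; openin X V; openin X W; W \<subseteq> V; V \<subseteq> U; s \<in> pts F V\<rbrakk>
    \<Longrightarrow> res F V W s \<in> pts F W"
  and represents_bij: "\<lbrakk>represents U F c \<theta>; openin X V; V \<subseteq> U; V \<noteq> {}\<rbrakk>
    \<Longrightarrow> bij_betw (\<theta> V) (pts F V) (cocycle_sections c V)"
  and value_basept: "\<lbrakk>represents U F c \<theta>; openin X V; V \<subseteq> U; V \<noteq> {}\<rbrakk> \<Longrightarrow> \<theta> V (basept (sec F V)) = absorb K"
  and value_act: "\<lbrakk>represents U F c \<theta>; openin X V; V \<subseteq> U; V \<noteq> {}; a \<in> scalars V; s \<in> pts F V\<rbrakk>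
    \<Longrightarrow> \<theta> V (act (sec F V) a s) = ev V a \<otimes> \<theta> V s"
  and value_res: "\<lbrakk>represents U F c \<theta>; openin X V; openin X W; W \<subseteq> V; V \<subseteq> U; W \<noteq> {}; s \<in> pts F V\<rbrakk>
    \<Longrightarrow> \<theta> W (res F V W s) = \<theta> V s"
  by (simp_all add: represents_def)

lemma representsI:
  assumes "\<exists>z. pts F {} = {z}"
    and "\<And>V. \<lbrakk>openin X V; V \<subseteq> U\<rbrakk> \<Longrightarrow> basept (sec F V) \<in> pts F V"
    and "\<And>V a s. \<lbrakk>openin X V; V \<subseteq> U; a \<in> scalars V; s \<in> pts F V\<rbrakk>
      \<Longrightarrow> act (sec F V) a s \<in> pts F V"
    and "\<And>V W s. \<lbrakk>openin X V; openin X W; W \<subseteq> V; V \<subseteq> U; s \<in> pts F V\<rbrakk>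
      \<Longrightarrow> res F V W s \<in> pts F W"
    and "\<And>V. \<lbrakk>openin X V; V \<subseteq> U; V \<noteq> {}\<rbrakk>
      \<Longrightarrow> bij_betw (\<theta> V) (pts F V) (cocycle_sections c V)"
    and "\<And>V. \<lbrakk>openin X V; V \<subseteq> U; V \<noteq> {}\<rbrakk> \<Longrightarrow> \<theta> V (basept (sec F V)) = absorb K"
    and "\<And>V a s. \<lbrakk>openin X V; V \<subseteq> U; V \<noteq> {}; a \<in> scalars V; s \<in> pts F V\<rbrakk>
      \<Longrightarrow> \<theta> V (act (sec F V) a s) = ev V a \<otimes> \<theta> V s"
    and "\<And>V W s. \<lbrakk>openin X V; openin X W; W \<subseteq> V; V \<subseteq> U; W \<noteq> {}; s \<in> pts F V\<rbrakk>
      \<Longrightarrow> \<theta> W (res F V W s) = \<theta> V s"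
  shows "represents U F c \<theta>"
  unfolding represents_def
  by (intro conjI allI impI ballI; (elim conjE)?; rule assms; assumption)

lemma value_mem:
  assumes "represents U F c \<theta>" "openin X V" "V \<subseteq> U" "V \<noteq> {}" "s \<in> pts F V"
  shows "\<theta> V s \<in> cocycle_sections c V" "\<theta> V s \<in> carrier K"
proof -
  show "\<theta> V s \<in> cocycle_sections c V"
    using represents_bij[OF assms(1-4)] assms(5) by (rule bij_betw_apply)
  then show "\<theta> V s \<in> carrier K" by (simp add: cocycle_sections_def)
qed

lemma value_inj:
  assumes "represents U F c \<theta>" "openin X V" "V \<subseteq> U" "V \<noteq> {}"
    "s \<in> pts F V" "t \<in> pts F V" "\<theta> V s = \<theta> V t"
  shows "s = t"
  using represents_bij[OF assms(1-4)] assms(5-7) by (meson bij_betw_def inj_onD)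

lemma value_surj:
  assumes "represents U F c \<theta>" "openin X V" "V \<subseteq> U" "V \<noteq> {}" "k \<in> cocycle_sections c V"
  obtains s where "s \<in> pts F V" "\<theta> V s = k"
  using represents_bij[OF assms(1-4)] assms(5) by (metis bij_betw_imp_surj_on imageE)

lemma represents_subset:
  assumes r: "represents U F c \<theta>" and "U' \<subseteq> U"
  shows "represents U' F c \<theta>"
proof -
  have U: "V \<subseteq> U" if "V \<subseteq> U'" for V using that assms(2) by blast
  show ?thesis
    by (rule representsI; (drule U)?)
      (simp_all add: represents_empty[OF r] represents_basept[OF r] represents_act[OF r]
        represents_res[OF r] represents_bij[OF r] value_basept[OF r] value_act[OF r] value_res[OF r])
qed

lemma represents_cocycle_cong:
  assumes r: "represents U F c \<theta>"
    and "\<And>V. \<lbrakk>openin X V; V \<subseteq> U; V \<noteq> {}\<rbrakk> \<Longrightarrow> cocycle_sections c V = cocycle_sections d V"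
  shows "represents U F d \<theta>"
  by (rule representsI)
    (simp_all add: represents_empty[OF r] represents_basept[OF r] represents_act[OF r]
      represents_res[OF r] represents_bij[OF r] value_basept[OF r] value_act[OF r] value_res[OF r]
      assms(2)[symmetric])

lemma openin_sub: "openin X U \<Longrightarrow> openin (on U) V \<longleftrightarrow> openin X V \<and> V \<subseteq> U"
  by (rule openin_open_subtopology)

lemma topspaceI: "\<lbrakk>openin X V; x \<in> V\<rbrakk> \<Longrightarrow> x \<in> topspace X"
  using openin_subset by blast

lemma generic_topspace: "\<eta> \<in> topspace X"
  using openin_generic topspaceI by blast

lemma R_closed: "x \<in> topspace X \<Longrightarrow> k \<in> R x \<Longrightarrow> k \<in> carrier K"
  and R_mult: "x \<in> topspace X \<Longrightarrow> k \<in> R x \<Longrightarrow> l \<in> R x \<Longrightarrow> k \<otimes> l \<in> R x"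
  and R_one: "x \<in> topspace X \<Longrightarrow> \<one> \<in> R x"
  using R_submonoid submonoid.mem_carrier submonoid.m_closed submonoid.one_closed by metis+

declare Units_closed [simp]

lemma Units_cancel:
  assumes "u \<in> Units K" "x \<in> carrier K"
  shows "inv u \<otimes> (u \<otimes> x) = x" "u \<otimes> (inv u \<otimes> x) = x"
proof -
  show "inv u \<otimes> (u \<otimes> x) = x" using assms m_assoc[of "inv u" u x] by simp
  show "u \<otimes> (inv u \<otimes> x) = x" using assms m_assoc[of u "inv u" x] by simp
qed

lemma inv_mult_Units:
  assumes "u \<in> Units K" "v \<in> Units K"
  shows "inv (u \<otimes> v) = inv u \<otimes> inv v"
proof (rule inv_unique[of _ "u \<otimes> v"])
  show "(u \<otimes> v) \<otimes> (inv u \<otimes> inv v) = \<one>"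
    using assms by (simp add: m_assoc m_lcomm[of v] Units_cancel)
qed (use assms in simp_all)

lemma unit_germs_one: "x \<in> topspace X \<Longrightarrow> \<one> \<in> unit_germs x"
  by (simp add: unit_germs_def R_one)

lemma unit_germs_mult:
  "\<lbrakk>x \<in> topspace X; u \<in> unit_germs x; v \<in> unit_germs x\<rbrakk> \<Longrightarrow> u \<otimes> v \<in> unit_germs x"
  by (simp add: unit_germs_def R_mult inv_mult_Units)

lemma unit_germs_inv: "u \<in> unit_germs x \<Longrightarrow> inv u \<in> unit_germs x"
  by (simp add: unit_germs_def)

lemma ev_mem:
  assumes "openin X V" "a \<in> scalars V" "x \<in> V"
  shows "ev V a \<in> R x" "ev V a \<in> carrier K"
proof -
  have "ev V a \<in> (\<Inter>x \<in> V. R x)" using ev_bij[OF assms(1)] assms(2,3) bij_betw_apply by fast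
  then show "ev V a \<in> R x" using assms by blast
  then show "ev V a \<in> carrier K" using R_closed[OF topspaceI[OF assms(1,3)]] by simp
qed

lemma ev_surj:
  assumes "openin X V" "V \<noteq> {}" "\<And>x. x \<in> V \<Longrightarrow> k \<in> R x"
  obtains a where "a \<in> scalars V" "ev V a = k"
proof -
  have "k \<in> ev V ` scalars V"
    using bij_betw_imp_surj_on[OF ev_bij[OF assms(1,2)]] assms(3) by simp
  then show thesis using that by blast
qed

text \<open>Nonemptiness matters: over the empty set the left side is \<open>carrier K\<close>,
  while the intersection is the whole type.\<close>

lemma cocycle_sections_one:
  assumes "V \<noteq> {}" "openin X V"
  shows "cocycle_sections (\<lambda>_. \<one>) V = (\<Inter>x \<in> V. R x)"
proof -
  obtain y where y: "y \<in> V" using assms(1) by blast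
  have "k \<in> carrier K" if "\<forall>x \<in> V. k \<in> R x" for k
    using that y R_closed[OF topspaceI[OF assms(2) y]] by blast
  then show ?thesis using R_closed[OF topspaceI[OF assms(2)]] by (auto simp: cocycle_sections_def)
qed

section \<open>Changing a cocycle by a constant and by units of the stalks\<close>

lemma cocycle_sections_scale:
  assumes "c \<in> V \<rightarrow> Units K" "\<gamma> \<in> Units K" "k \<in> carrier K"
  shows "\<gamma> \<otimes> k \<in> cocycle_sections (\<lambda>x. c x \<otimes> \<gamma>) V \<longleftrightarrow> k \<in> cocycle_sections c V"
proof -
  have "inv (c x \<otimes> \<gamma>) \<otimes> (\<gamma> \<otimes> k) = inv (c x) \<otimes> k" if "x \<in> V" for x
  proof -
    have cx: "c x \<in> Units K" using assms that by blast
    have "inv (c x \<otimes> \<gamma>) \<otimes> (\<gamma> \<otimes> k) = inv \<gamma> \<otimes> (\<gamma> \<otimes> (inv (c x) \<otimes> k))"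
      using cx assms by (simp add: inv_mult_Units m_ac)
    then show ?thesis using Units_cancel cx assms by simp
  qed
  then show ?thesis using assms by (simp add: cocycle_sections_def)
qed

text \<open>Dividing the chosen generator at \<eta> by \<gamma> multiplies all values by \<gamma>,
  and the values \<open>c x\<close> of the local generators with them.\<close>

lemma represents_scale:
  assumes r: "represents U F c \<theta>" and c: "c \<in> U \<rightarrow> Units K" and \<gamma>: "\<gamma> \<in> Units K"
  shows "represents U F (\<lambda>x. c x \<otimes> \<gamma>) (\<lambda>V s. \<gamma> \<otimes> \<theta> V s)"
proof (rule representsI)
  fix V assume V: "openin X V" "V \<subseteq> U" "V \<noteq> {}"
  have cV: "c \<in> V \<rightarrow> Units K" using c V by blast
  have "bij_betw (\<lambda>k. \<gamma> \<otimes> k) (cocycle_sections c V) (cocycle_sections (\<lambda>x. c x \<otimes> \<gamma>) V)"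
  proof (rule bij_betwI[where g = "\<lambda>k. inv \<gamma> \<otimes> k"])
    show "(\<lambda>k. \<gamma> \<otimes> k) \<in> cocycle_sections c V \<rightarrow> cocycle_sections (\<lambda>x. c x \<otimes> \<gamma>) V"
      using cocycle_sections_scale[OF cV \<gamma>] by (auto simp: cocycle_sections_def)
    show "(\<lambda>k. inv \<gamma> \<otimes> k) \<in> cocycle_sections (\<lambda>x. c x \<otimes> \<gamma>) V \<rightarrow> cocycle_sections c V"
    proof
      fix k assume k: "k \<in> cocycle_sections (\<lambda>x. c x \<otimes> \<gamma>) V"
      then have kc: "k \<in> carrier K" by (simp add: cocycle_sections_def)
      show "inv \<gamma> \<otimes> k \<in> cocycle_sections c V"
        using cocycle_sections_scale[OF cV \<gamma>, of "inv \<gamma> \<otimes> k"] k kc \<gamma> by (simp add: Units_cancel)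
    qed
  qed (use \<gamma> in \<open>auto simp: cocycle_sections_def Units_cancel\<close>)
  from bij_betw_trans[OF represents_bij[OF r V] this]
  show "bij_betw (\<lambda>s. \<gamma> \<otimes> \<theta> V s) (pts F V) (cocycle_sections (\<lambda>x. c x \<otimes> \<gamma>) V)"
    by (simp add: comp_def)
next
  fix V a s assume V: "openin X V" "V \<subseteq> U" "V \<noteq> {}" "a \<in> scalars V" "s \<in> pts F V"
  have "ev V a \<in> carrier K" using V ev_mem by blast
  then show "\<gamma> \<otimes> \<theta> V (act (sec F V) a s) = ev V a \<otimes> (\<gamma> \<otimes> \<theta> V s)"
    using value_mem(2)[OF r] value_act[OF r] V \<gamma> by (simp add: m_ac)
next
  fix V W s assume V: "openin X V" "openin X W" "W \<subseteq> V" "V \<subseteq> U" "W \<noteq> {}" "s \<in> pts F V"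
  then show "\<gamma> \<otimes> \<theta> W (res F V W s) = \<gamma> \<otimes> \<theta> V s" by (simp add: value_res[OF r])
next
  fix V assume "openin X V" "V \<subseteq> U" "V \<noteq> {}"
  then show "\<gamma> \<otimes> \<theta> V (basept (sec F V)) = absorb K"
    using \<gamma> by (simp add: value_basept[OF r] absorb_mult)
qed (fact represents_empty[OF r] | erule (4) represents_res[OF r] |
    erule (3) represents_act[OF r] | erule (1) represents_basept[OF r])+

lemma cocycle_sections_mono:
  assumes "openin X V" "c \<in> V \<rightarrow> Units K" "d \<in> V \<rightarrow> Units K"
    and "\<And>x. x \<in> V \<Longrightarrow> c x \<otimes> inv (d x) \<in> R x"
  shows "cocycle_sections c V \<subseteq> cocycle_sections d V"
proof
  fix k assume k: "k \<in> cocycle_sections c V"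
  have "inv (d x) \<otimes> k \<in> R x" if x: "x \<in> V" for x
  proof -
    have u: "c x \<in> Units K" "d x \<in> Units K" using assms x by blast+
    have kk: "k \<in> carrier K" "inv (c x) \<otimes> k \<in> R x" using k x by (auto simp: cocycle_sections_def)
    have "(c x \<otimes> inv (d x)) \<otimes> (inv (c x) \<otimes> k) = c x \<otimes> (inv (c x) \<otimes> (inv (d x) \<otimes> k))"
      using u kk by (simp add: m_ac)
    also have "\<dots> = inv (d x) \<otimes> k" using u kk Units_cancel by simp
    finally show ?thesis using R_mult[OF topspaceI[OF assms(1) x] assms(4)[OF x] kk(2)] by simp
  qed
  then show "k \<in> cocycle_sections d V" using k by (simp add: cocycle_sections_def)
qed

lemma cocycle_sections_cong:
  assumes "openin X V" "c \<in> V \<rightarrow> Units K" "d \<in> V \<rightarrow> Units K"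
    and "\<And>x. x \<in> V \<Longrightarrow> c x \<otimes> inv (d x) \<in> unit_germs x"
  shows "cocycle_sections c V = cocycle_sections d V"
proof
  show "cocycle_sections c V \<subseteq> cocycle_sections d V"
    using assms by (intro cocycle_sections_mono) (auto simp: unit_germs_def)
  have "d x \<otimes> inv (c x) \<in> R x" if x: "x \<in> V" for x
  proof -
    have u: "c x \<in> Units K" "d x \<in> Units K" using assms x by blast+
    then have "inv (c x \<otimes> inv (d x)) = d x \<otimes> inv (c x)" by (simp add: inv_mult_Units m_comm)
    then show ?thesis using assms(4)[OF x] by (simp add: unit_germs_def)
  qed
  then show "cocycle_sections d V \<subseteq> cocycle_sections c V"
    using assms by (intro cocycle_sections_mono) auto
qed

text \<open>The constant \<gamma> only changes the generator at \<eta>, and a unit of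
  \<open>R x\<close> does not change \<open>c x \<otimes> R x\<close>. So one and the same sheaf,
  with rescaled values, has both cocycles.\<close>

lemma represents_twist:
  assumes r: "represents U F c \<theta>" and U: "openin X U" and c: "c \<in> U \<rightarrow> Units K" and d: "d \<in> U \<rightarrow> Units K"
    and \<gamma>: "\<gamma> \<in> Units K" and cd: "\<And>x. x \<in> U \<Longrightarrow> c x \<otimes> inv (d x) \<otimes> \<gamma> \<in> unit_germs x"
  shows "represents U F d (\<lambda>V s. \<gamma> \<otimes> \<theta> V s)"
proof (rule represents_cocycle_cong[OF represents_scale[OF r c \<gamma>]])
  fix V assume V: "openin X V" "V \<subseteq> U" "V \<noteq> {}"
  show "cocycle_sections (\<lambda>x. c x \<otimes> \<gamma>) V = cocycle_sections d V"
  proof (rule cocycle_sections_cong[OF V(1)])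
    fix x assume x: "x \<in> V"
    have "c x \<otimes> \<gamma> \<otimes> inv (d x) = c x \<otimes> inv (d x) \<otimes> \<gamma>"
    proof -
      have "c x \<in> Units K" "d x \<in> Units K" using c d x V by blast+
      then show ?thesis using \<gamma> by (simp add: m_ac)
    qed
    then show "c x \<otimes> \<gamma> \<otimes> inv (d x) \<in> unit_germs x" using cd x V by auto
  qed (use c d \<gamma> V in auto)
qed

lemma represents_regular: "represents U (regular_oset \<O>) (\<lambda>_. \<one>) ev"
proof (rule representsI)
  show "\<exists>z. points (sec (regular_oset \<O>) {}) = {z}"
    using O_empty by (simp add: regular_oset_def regular_bset_def)
next
  fix V assume "openin X V"
  then interpret O: binoid "sec \<O> V" by (rule binoid_O)
  show "basept (sec (regular_oset \<O>) V) \<in> points (sec (regular_oset \<O>) V)"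
    using O.absorb_closed by (simp add: regular_oset_def regular_bset_def)
  fix a s assume "a \<in> scalars V" "s \<in> points (sec (regular_oset \<O>) V)"
  then show "act (sec (regular_oset \<O>) V) a s \<in> points (sec (regular_oset \<O>) V)"
    by (simp add: regular_oset_def regular_bset_def)
next
  fix V assume V: "openin X V" "V \<noteq> {}"
  then show "bij_betw (ev V) (points (sec (regular_oset \<O>) V)) (cocycle_sections (\<lambda>_. \<one>) V)"
    by (simp add: regular_oset_def regular_bset_def cocycle_sections_one ev_bij)
qed (simp_all add: regular_oset_def regular_bset_def O_res_closed ev_absorb ev_mult ev_res)


text \<open>Over a nonempty open set both sheaves take the same values in \<open>K\<close>, so the
  isomorphism goes through \<open>K\<close>; it respects action and restriction because values do
  and \<theta>' is injective. Over the empty set, where there are no values, the unique section is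
  mapped to the unique section.\<close>

lemma represents_isomorphic:
  assumes r: "represents U F c \<theta>" and r': "represents U G c \<theta>'" and U: "openin X U"
  shows "oset_isomorphic (on U) \<O> F G"
proof -
  obtain y where y: "pts F {} = {y}" using represents_empty[OF r] by blast
  obtain z where z: "pts G {} = {z}" using represents_empty[OF r'] by blast
  define \<phi> where "\<phi> V s = (if V = {} then z else inv_into (pts G V) (\<theta>' V) (\<theta> V s))" for V s
  have \<phi>: "\<phi> V s \<in> pts G V" if "openin X V" "V \<subseteq> U" "s \<in> pts F V" for V s
    using bij_betw_apply[OF bij_betw_inv_into[OF represents_bij[OF r' that(1,2)]]]
      value_mem(1)[OF r that(1,2) _ that(3)] z by (auto simp: \<phi>_def)
  have val: "\<theta>' V (\<phi> V s) = \<theta> V s"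
    if "openin X V" "V \<subseteq> U" "V \<noteq> {}" "s \<in> pts F V" for V s
    using bij_betw_inv_into_right[OF represents_bij[OF r' that(1-3)]]
      value_mem(1)[OF r that] that by (auto simp: \<phi>_def)
  have "bset_iso (sec \<O> V) (sec F V) (sec G V) (\<phi> V)" if V: "openin X V" "V \<subseteq> U" for V
  proof (cases "V = {}")
    case True
    have "basept (sec F {}) = y" "basept (sec G {}) = z"
      using represents_basept[OF r V] represents_basept[OF r' V] y z True by simp_all
    moreover have "act (sec G {}) a z = z" if "a \<in> scalars {}" for a
      using represents_act[OF r' V, of a z] z that True by simp
    ultimately show ?thesis
      using True y z by (simp add: bset_iso_def \<phi>_def bij_betw_def)
  next
    case False
    note V = V False
    have "\<phi> V = inv_into (pts G V) (\<theta>' V) \<circ> \<theta> V" using False by (auto simp: \<phi>_def)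
    then have "bij_betw (\<phi> V) (pts F V) (pts G V)"
      using bij_betw_trans[OF represents_bij[OF r V] bij_betw_inv_into[OF represents_bij[OF r' V]]] by simp
    moreover have "\<phi> V (basept (sec F V)) = basept (sec G V)"
      using V represents_basept[OF r] represents_basept[OF r']
      by (intro value_inj[OF r' V]) (simp_all add: \<phi> val value_basept[OF r] value_basept[OF r'])
    moreover have "\<phi> V (act (sec F V) a s) = act (sec G V) a (\<phi> V s)"
      if "a \<in> scalars V" "s \<in> pts F V" for a s
      using V that represents_act[OF r] represents_act[OF r']
      by (intro value_inj[OF r' V]) (simp_all add: \<phi> val value_act[OF r] value_act[OF r'])
    ultimately show ?thesis by (simp add: bset_iso_def)
  qed
  moreover have "\<phi> W (res F V W s) = res G V W (\<phi> V s)"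
    if V: "openin X V" "V \<subseteq> U" "openin X W" "W \<subseteq> V" "s \<in> pts F V" for V W s
  proof (cases "W = {}")
    case True
    then show ?thesis using represents_res[OF r' V(1,3,4,2) \<phi>] V z by (simp add: \<phi>_def)
  next
    case False
    then have ne: "V \<noteq> {}" using V by blast
    have WU: "W \<subseteq> U" using V by blast
    note res = represents_res[OF r V(1,3,4,2,5)]
    have "\<theta>' W (res G V W (\<phi> V s)) = \<theta> V s"
      using V False ne by (simp add: value_res[OF r' V(1,3,4,2)] \<phi> val)
    moreover have "\<theta>' W (\<phi> W (res F V W s)) = \<theta> V s"
      using V WU False res by (simp add: val value_res[OF r V(1,3,4,2)])
    ultimately show ?thesis
      using V WU False res by (intro value_inj[OF r' V(3) WU False])
        (simp_all add: \<phi> represents_res[OF r' V(1,3,4,2)])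
  qed
  ultimately show ?thesis
    using U by (intro oset_isomorphicI[of _ _ _ _ \<phi>]) (simp_all add: openin_sub)
qed

text \<open>Values are pulled back along the isomorphism. The sections of \<open>F\<close> and
  \<open>G\<close> may have different types, which is what allows the comparison with a smash
  sheaf.\<close>

lemma represents_transfer:
  assumes F: "oset_sheaf (on U) \<O> F" and U: "openin X U"
    and iso: "oset_isomorphic (on U) \<O> F G" and r: "represents U G c \<theta>"
  shows "\<exists>\<theta>'. represents U F c \<theta>'"
proof -
  interpret F: oset_sheaf "on U" \<O> F by fact
  from iso obtain \<phi> where \<phi>': "\<And>V. openin (on U) V \<Longrightarrow> bset_iso (sec \<O> V) (sec F V) (sec G V) (\<phi> V)"
    "\<And>V W s. \<lbrakk>openin (on U) V; openin (on U) W; W \<subseteq> V; s \<in> pts F V\<rbrakk>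
      \<Longrightarrow> \<phi> W (res F V W s) = res G V W (\<phi> V s)"
    by (rule oset_isomorphicE) blast
  have \<phi>: "bset_iso (sec \<O> V) (sec F V) (sec G V) (\<phi> V)" if "openin X V" "V \<subseteq> U" for V
    using \<phi>'(1) that U by (simp add: openin_sub)
  have \<phi>_res: "\<phi> W (res F V W s) = res G V W (\<phi> V s)"
    if "openin X V" "V \<subseteq> U" "openin X W" "W \<subseteq> V" "s \<in> pts F V" for V W s
    using \<phi>'(2)[of V W s] that U by (auto simp: openin_sub)
  have \<phi>_bij: "bij_betw (\<phi> V) (pts F V) (pts G V)" if "openin X V" "V \<subseteq> U" for V
    using \<phi>[OF that] by (simp add: bset_iso_def)
  have \<phi>_mem: "\<phi> V s \<in> pts G V" if "openin X V" "V \<subseteq> U" "s \<in> pts F V" for V s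
    using bij_betw_apply[OF \<phi>_bij[OF that(1,2)] that(3)] .
  have set: "binoid_set (sec \<O> V) (sec F V)" if "openin X V" "V \<subseteq> U" for V
    using that U by (intro F.binoid_set_sec) (simp add: openin_sub)
  have "represents U F c (\<lambda>V s. \<theta> V (\<phi> V s))"
  proof (rule representsI)
    show "\<exists>z. pts F {} = {z}" by (rule F.sections_empty)
    fix V assume V: "openin X V" "V \<subseteq> U"
    then interpret S: binoid_set "sec \<O> V" "sec F V" by (rule set)
    show "basept (sec F V) \<in> pts F V" by (rule S.basept_closed)
    show "act (sec F V) a s \<in> pts F V" if "a \<in> scalars V" "s \<in> pts F V" for a s
      using that by (rule S.act_closed)
  next
    fix V assume V: "openin X V" "V \<subseteq> U" "V \<noteq> {}"
    show "bij_betw (\<lambda>s. \<theta> V (\<phi> V s)) (pts F V) (cocycle_sections c V)"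
      using bij_betw_trans[OF \<phi>_bij[OF V(1,2)] represents_bij[OF r V]] by (simp add: comp_def)
    show "\<theta> V (\<phi> V (basept (sec F V))) = absorb K"
      using \<phi>[OF V(1,2)] value_basept[OF r V] by (simp add: bset_iso_def)
    show "\<theta> V (\<phi> V (act (sec F V) a s)) = ev V a \<otimes> \<theta> V (\<phi> V s)"
      if "a \<in> scalars V" "s \<in> pts F V" for a s
      using that \<phi>[OF V(1,2)] value_act[OF r V] \<phi>_mem[OF V(1,2)] by (simp add: bset_iso_def)
  next
    fix V W s assume V: "openin X V" "openin X W" "W \<subseteq> V" "V \<subseteq> U" "s \<in> pts F V"
    then show "res F V W s \<in> pts F W"
      using U by (intro F.res_closed) (auto simp: openin_sub)
    assume "W \<noteq> {}"
    with V show "\<theta> W (\<phi> W (res F V W s)) = \<theta> V (\<phi> V s)"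
      by (simp add: \<phi>_res value_res[OF r] \<phi>_mem)
  qed
  then show ?thesis by blast
qed

text \<open>Values separate sections over nonempty open sets, so every identity between sections
  becomes an identity in \<open>K\<close>. As for gluing, membership in
  \<open>cocycle_sections c V\<close> is a condition at each point of \<open>V\<close> separately
  and hence passes from the members of a cover to their union.\<close>

lemma represents_oset_sheaf:
  assumes r: "represents U F c \<theta>" and U: "openin X U"
  shows "oset_sheaf (on U) \<O> F"
proof -
  obtain z where z: "pts F {} = {z}" using represents_empty[OF r] by blast
  note rres = represents_res[OF r] and vres = value_res[OF r]
  have eqI: "s = t" if "openin X V" "V \<subseteq> U" "s \<in> pts F V" "t \<in> pts F V"
    "V \<noteq> {} \<Longrightarrow> \<theta> V s = \<theta> V t" for V s t
    using that value_inj[OF r that(1,2) _ that(3,4)] z by (cases "V = {}") auto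
  interpret sheaf "on U" "\<lambda>V. pts F V" "res F"
  proof
    fix V s assume "openin (on U) V" and s: "s \<in> pts F V"
    then have V: "openin X V" "V \<subseteq> U" using U by (simp_all add: openin_sub)
    show "res F V V s = s"
      using V s by (intro eqI[OF V]) (simp_all add: rres vres)
  next
    fix V W s assume "openin (on U) V" "openin (on U) W" "W \<subseteq> V" "s \<in> pts F V"
    then show "res F V W s \<in> pts F W" using U by (simp add: openin_sub rres)
  next
    fix V V' V'' s assume "openin (on U) V" "openin (on U) V'"
      "openin (on U) V''" and sub: "V'' \<subseteq> V'" "V' \<subseteq> V" and s: "s \<in> pts F V"
    then have V: "openin X V" "openin X V'" "openin X V''" "V \<subseteq> U" "V' \<subseteq> U" "V'' \<subseteq> U" "V'' \<subseteq> V"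
      using U by (auto simp: openin_sub)
    have s': "res F V V' s \<in> points (sec F V')" using V sub s by (simp add: rres)
    show "res F V' V'' (res F V V' s) = res F V V'' s"
    proof (rule eqI[OF V(3,6)])
      assume ne: "V'' \<noteq> {}"
      then have "V' \<noteq> {}" using sub by blast
      then show "\<theta> V'' (res F V' V'' (res F V V' s)) = \<theta> V'' (res F V V'' s)"
        using V sub s s' ne by (simp add: vres)
    qed (use V sub s s' in \<open>simp_all add: rres\<close>)
  next
    fix \<V> \<sigma>
    assume "\<And>V. V \<in> \<V> \<Longrightarrow> openin (on U) V" and \<sigma>: "\<And>V. V \<in> \<V> \<Longrightarrow> \<sigma> V \<in> pts F V"
      and agree: "\<And>V W. \<lbrakk>V \<in> \<V>; W \<in> \<V>\<rbrakk> \<Longrightarrow> res F V (V \<inter> W) (\<sigma> V) = res F W (V \<inter> W) (\<sigma> W)"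
    then have V: "openin X V" "V \<subseteq> U" if "V \<in> \<V>" for V using U that by (simp_all add: openin_sub)
    have UV: "openin X (\<Union>\<V>)" "\<Union>\<V> \<subseteq> U" using V by blast+
    show "\<exists>!t. t \<in> pts F (\<Union>\<V>) \<and> (\<forall>V\<in>\<V>. res F (\<Union>\<V>) V t = \<sigma> V)"
    proof (cases "\<Union>\<V> = {}")
      case True
      have "res F {} {} z = z" using rres[of "{}" "{}" z] z by simp
      moreover have "\<sigma> V = z" "V = {}" if "V \<in> \<V>" for V
      proof -
        show "V = {}" using True that by blast
        then show "\<sigma> V = z" using \<sigma>[OF that] z by simp
      qed
      ultimately show ?thesis unfolding True z by auto
    next
      case False
      then obtain V0 where V0: "V0 \<in> \<V>" "V0 \<noteq> {}" by blast
      define k where "k = \<theta> V0 (\<sigma> V0)"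
      \<comment> \<open>Two nonempty open sets always meet in \<eta>, so agreement on overlaps
        leaves one common value for the whole family.\<close>
      have k: "\<theta> V (\<sigma> V) = k" if "V \<in> \<V>" "V \<noteq> {}" for V
      proof -
        let ?W = "V \<inter> V0"
        have W: "openin X ?W" "?W \<subseteq> V" "?W \<subseteq> V0" using V that V0 by auto
        have "\<eta> \<in> ?W" using generic_mem V V0 that by blast
        then have ne: "?W \<noteq> {}" by blast
        have "\<theta> V (\<sigma> V) = \<theta> ?W (res F V ?W (\<sigma> V))"
          using V[OF that(1)] W ne \<sigma>[OF that(1)] by (simp add: vres)
        also have "\<dots> = \<theta> ?W (res F V0 ?W (\<sigma> V0))" using agree that V0 by simp
        also have "\<dots> = k" using V[OF V0(1)] W ne \<sigma>[OF V0(1)] by (simp add: vres k_def)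
        finally show ?thesis .
      qed
      have "k \<in> cocycle_sections c (\<Union>\<V>)"
      proof -
        have "inv (c x) \<otimes> k \<in> R x" if "V \<in> \<V>" "x \<in> V" for V x
        proof -
          have "V \<noteq> {}" using that by blast
          then have "k \<in> cocycle_sections c V"
            using value_mem(1)[OF r V[OF that(1)] _ \<sigma>[OF that(1)]] k[OF that(1)] by simp
          then show ?thesis using that by (simp add: cocycle_sections_def)
        qed
        moreover have "k \<in> carrier K"
          unfolding k_def by (rule value_mem(2)[OF r V[OF V0(1)] V0(2) \<sigma>[OF V0(1)]])
        ultimately show ?thesis by (auto simp: cocycle_sections_def)
      qed
      then obtain t where t: "t \<in> pts F (\<Union>\<V>)" "\<theta> (\<Union>\<V>) t = k"
        using value_surj[OF r UV False] by blast
      have "res F (\<Union>\<V>) V t = \<sigma> V" if "V \<in> \<V>" for V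
      proof (rule eqI[OF V[OF that]])
        show "res F (\<Union>\<V>) V t \<in> pts F V" using UV V that t by (intro rres) auto
        show "\<theta> V (res F (\<Union>\<V>) V t) = \<theta> V (\<sigma> V)" if "V \<noteq> {}"
          using vres[OF UV(1) V(1)[OF \<open>V \<in> \<V>\<close>] Union_upper[OF \<open>V \<in> \<V>\<close>] UV(2) that t(1)] t(2) k[OF \<open>V \<in> \<V>\<close> that]
          by simp
      qed (rule \<sigma>[OF that])
      moreover have "t' = t" if t': "t' \<in> pts F (\<Union>\<V>)" "res F (\<Union>\<V>) V0 t' = \<sigma> V0" for t'
      proof (rule eqI[OF UV t'(1) t(1)])
        show "\<theta> (\<Union>\<V>) t' = \<theta> (\<Union>\<V>) t"
          using vres[OF UV(1) V(1)[OF V0(1)] Union_upper[OF V0(1)] UV(2) V0(2) t'(1)] t'(2) t(2)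
          by (simp add: k_def)
      qed
      ultimately show ?thesis using t(1) V0(1) by blast
    qed
  qed
  show ?thesis
  proof (intro oset_sheaf.intro oset_sheaf_axioms.intro sheaf_axioms)
    fix V assume "openin (on U) V"
    then have V: "openin X V" "V \<subseteq> U" using U by (simp_all add: openin_sub)
    interpret O: binoid "sec \<O> V" using V(1) by (rule binoid_O)
    note racl = represents_act[OF r V] and rbase = represents_basept[OF r V]
    note evK = ev_mem(2)[OF V(1)]
    have ne: "\<exists>x. x \<in> V" if "V \<noteq> {}" using that by blast
    show "binoid_set (sec \<O> V) (sec F V)"
    proof (intro binoid_set.intro binoid_set_axioms.intro O.binoid_axioms)
      fix a s assume s: "s \<in> pts F V"
      show "act (sec F V) (absorb (sec \<O> V)) s = basept (sec F V)"
      proof (rule eqI[OF V])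
        assume "V \<noteq> {}"
        then show "\<theta> V (act (sec F V) (absorb (sec \<O> V)) s) = \<theta> V (basept (sec F V))"
          using V s value_mem(2)[OF r V _ s]
          by (simp add: value_act[OF r] value_basept[OF r] O.absorb_closed ev_absorb absorb_left)
      qed (use s racl rbase O.absorb_closed in simp_all)
      show "act (sec F V) \<one>\<^bsub>sec \<O> V\<^esub> s = s"
        by (rule eqI[OF V])
          (use V s value_mem(2)[OF r V _ s] racl in \<open>simp_all add: value_act[OF r] ev_one\<close>)
      assume a: "a \<in> scalars V"
      then show "act (sec F V) a s \<in> pts F V" using s by (rule racl)
      fix b assume b: "b \<in> scalars V"
      show "act (sec F V) (a \<otimes>\<^bsub>sec \<O> V\<^esub> b) s = act (sec F V) a (act (sec F V) b s)"
      proof (rule eqI[OF V])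
        assume "V \<noteq> {}"
        then obtain x where "x \<in> V" by blast
        then show "\<theta> V (act (sec F V) (a \<otimes>\<^bsub>sec \<O> V\<^esub> b) s) = \<theta> V (act (sec F V) a (act (sec F V) b s))"
          using V \<open>V \<noteq> {}\<close> s a b value_mem(2)[OF r V _ s] evK racl
          by (simp add: value_act[OF r] ev_mult m_assoc)
      qed (use s a b racl in simp_all)
    next
      show "basept (sec F V) \<in> pts F V" by (rule rbase)
      fix a assume a: "a \<in> scalars V"
      show "act (sec F V) a (basept (sec F V)) = basept (sec F V)"
      proof (rule eqI[OF V])
        assume "V \<noteq> {}"
        then obtain x where "x \<in> V" by blast
        then show "\<theta> V (act (sec F V) a (basept (sec F V))) = \<theta> V (basept (sec F V))"
          using V \<open>V \<noteq> {}\<close> a evK rbase by (simp add: value_act[OF r] value_basept[OF r] absorb_mult)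
      qed (use a racl rbase in simp_all)
    qed
  next
    fix V W assume "openin (on U) V" "openin (on U) W" and sub: "W \<subseteq> V"
    then have V: "openin X V" "V \<subseteq> U" "openin X W" "W \<subseteq> U" using U by (simp_all add: openin_sub)
    have ne: "V \<noteq> {}" if "W \<noteq> {}" using that sub by blast
    show "res F V W (basept (sec F V)) = basept (sec F W)"
      using V sub ne
      by (intro eqI[OF V(3,4)]) (simp_all add: rres vres represents_basept[OF r] value_basept[OF r])
    fix a s assume as: "a \<in> scalars V" "s \<in> pts F V"
    show "res F V W (act (sec F V) a s) = act (sec F W) (res \<O> V W a) (res F V W s)"
      using V sub ne as
      by (intro eqI[OF V(3,4)])
        (simp_all add: rres vres represents_act[OF r] value_act[OF r] O_res_closed ev_res)
  qed
qed


section \<open>Cocycles of invertible sheaves: existence and uniqueness\<close>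

lemma cocycles_Units: "c \<in> cocycles U \<Longrightarrow> x \<in> U \<Longrightarrow> c x \<in> Units K"
  by (auto simp: cocycles_def)

lemma D_D: "x \<in> topspace X \<Longrightarrow> y \<in> D x \<Longrightarrow> D y \<subseteq> D x"
  by (rule D_least[OF openin_D])

lemma D_nonempty: "x \<in> topspace X \<Longrightarrow> D x \<noteq> {}"
  using D_self by blast

lemma generic_D: "x \<in> topspace X \<Longrightarrow> \<eta> \<in> D x"
  by (intro generic_mem openin_D D_nonempty)

lemma D_generic: "D \<eta> = {\<eta>}"
  using D_least[OF openin_generic] D_self[OF generic_topspace] by blast

lemma subtopology_D: "D x \<subseteq> U \<Longrightarrow> subtopology (on U) (D x) = on (D x)"
  by (simp add: subtopology_subtopology Int_absorb1)

lemma represents_invertible: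
  assumes r: "represents U F c \<theta>" and U: "openin X U" and c: "c \<in> cocycles U"
  shows "invertible_oset (on U) \<O> F"
  unfolding invertible_oset_def
proof (intro conjI ballI)
  show "oset_sheaf (on U) \<O> F" using r U by (rule represents_oset_sheaf)
  fix x assume "x \<in> topspace (on U)"
  then have x: "x \<in> U" "x \<in> topspace X" by simp_all
  have DU: "D x \<subseteq> U" using D_least[OF U x(1)] .
  have Units: "c y \<in> Units K" if "y \<in> D x" for y using cocycles_Units[OF c] DU that by blast
  \<comment> \<open>On \<open>D x\<close> the cocycle is the constant \<open>c x\<close> up to units
    of the stalks, so multiplication by \<open>c x\<close> turns the values of \<O> into values for
    \<open>c\<close>.\<close>
  have "represents (D x) (regular_oset \<O>) c (\<lambda>V s. c x \<otimes> ev V s)"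
  proof (rule represents_twist[OF represents_regular openin_D[OF x(2)]])
    fix y assume y: "y \<in> D x"
    have "c x \<otimes> inv (c y) \<in> unit_germs y" using c x y by (auto simp: cocycles_def)
    moreover have "\<one> \<otimes> inv (c y) \<otimes> c x = c x \<otimes> inv (c y)"
      using Units[OF y] Units[OF D_self[OF x(2)]] by (simp add: m_comm)
    ultimately show "\<one> \<otimes> inv (c y) \<otimes> c x \<in> unit_germs y" by simp
  qed (use Units D_self[OF x(2)] in simp_all)
  then have "oset_isomorphic (on (D x)) \<O> F (regular_oset \<O>)"
    by (intro represents_isomorphic[OF represents_subset[OF r DU]] openin_D x(2))
  then show "\<exists>W. openin (on U) W \<and> x \<in> W \<and>
      oset_isomorphic (subtopology (on U) W) \<O> F (regular_oset \<O>)"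
    using openin_D[OF x(2)] D_self[OF x(2)] DU U
    by (intro exI[of _ "D x"]) (simp add: subtopology_D openin_sub)
qed

lemma one_mem_generic_sections: "c \<eta> \<in> Units K \<Longrightarrow> \<one> \<in> cocycle_sections c {\<eta>}"
  by (simp add: cocycle_sections_def R_generic)

text \<open>Over \<open>{\<eta>}\<close> the sheaf is free on the section \<open>e\<close> of value
  one, so both value maps are determined there by linearity, and restriction to
  \<open>{\<eta>}\<close> carries the comparison to all \<open>V\<close>. The two domains may
  differ, as only \<eta> has to be common; this is how trivializations on different least
  neighbourhoods are compared.\<close>

lemma represents_compare:
  assumes r: "represents U F c \<theta>" and r': "represents U' F d \<theta>'"
    and \<eta>: "\<eta> \<in> U" "\<eta> \<in> U'" and Units: "c \<eta> \<in> Units K" "d \<eta> \<in> Units K"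
  obtains \<gamma> where "\<gamma> \<in> Units K"
    and "\<And>V s. \<lbrakk>openin X V; V \<subseteq> U; V \<subseteq> U'; V \<noteq> {}; s \<in> pts F V\<rbrakk> \<Longrightarrow> \<theta>' V s = \<gamma> \<otimes> \<theta> V s"
proof -
  have sub: "{\<eta>} \<subseteq> U" "{\<eta>} \<subseteq> U'" using \<eta> by simp_all
  obtain e where e: "e \<in> pts F {\<eta>}" "\<theta> {\<eta>} e = \<one>"
    using value_surj[OF r openin_generic sub(1) _ one_mem_generic_sections[of c, OF Units(1)]] by blast
  obtain e' where e': "e' \<in> pts F {\<eta>}" "\<theta>' {\<eta>} e' = \<one>"
    using value_surj[OF r' openin_generic sub(2) _ one_mem_generic_sections[of d, OF Units(2)]] by blast
  define \<gamma> where "\<gamma> = \<theta>' {\<eta>} e"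
  have \<gamma>c: "\<gamma> \<in> carrier K" unfolding \<gamma>_def by (rule value_mem(2)[OF r' openin_generic sub(2) _ e(1)]) simp
  have *: "\<theta>' V s = \<gamma> \<otimes> \<theta> V s"
    if V: "openin X V" "V \<subseteq> U" "V \<subseteq> U'" "V \<noteq> {}" "s \<in> pts F V" for V s
  proof -
    have \<eta>V: "{\<eta>} \<subseteq> V" using generic_mem V by blast
    let ?s = "res F V {\<eta>} s"
    have s: "?s \<in> pts F {\<eta>}" "\<theta> {\<eta>} ?s = \<theta> V s" "\<theta>' {\<eta>} ?s = \<theta>' V s"
      using V \<eta>V openin_generic by (simp_all add: represents_res[OF r] value_res[OF r] value_res[OF r'])
    have k: "\<theta> V s \<in> carrier K" using value_mem(2)[OF r V(1,2,4,5)] .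
    obtain a where a: "a \<in> scalars {\<eta>}" "ev {\<eta>} a = \<theta> V s"
      using ev_surj[OF openin_generic, of "\<theta> V s"] k R_generic by auto
    have "?s = act (sec F {\<eta>}) a e"
      using e s a k sub openin_generic
      by (intro value_inj[OF r openin_generic sub(1)]) (simp_all add: value_act[OF r] represents_act[OF r])
    then have "\<theta>' V s = \<theta>' {\<eta>} (act (sec F {\<eta>}) a e)" using s(3) by simp
    also have "\<dots> = \<theta> V s \<otimes> \<gamma>"
      using e(1) a sub openin_generic by (simp add: value_act[OF r'] \<gamma>_def)
    finally show ?thesis using k \<gamma>c by (simp add: m_comm)
  qed
  \<comment> \<open>Since \<open>e'\<close> has value one under \<theta>', its value under \<theta>
    is the inverse of \<gamma>.\<close>
  have "\<theta> {\<eta>} e' \<in> carrier K" using value_mem(2)[OF r openin_generic sub(1) _ e'(1)] by simp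
  moreover have "\<gamma> \<otimes> \<theta> {\<eta>} e' = \<one>" using *[OF openin_generic sub _ e'(1)] e'(2) by simp
  ultimately have "\<gamma> \<in> Units K" using \<gamma>c unfolding Units_def by (auto simp: m_comm intro!: bexI[of _ "\<theta> {\<eta>} e'"])
  then show thesis using * by (rule that)
qed

text \<open>The section with value \<open>c x\<close> is the local generator; by the cocycle
  condition it is defined on all of \<open>D x\<close> and not only at \<open>x\<close>.\<close>

lemma cocycle_mem_sections:
  assumes c: "c \<in> cocycles U" and x: "x \<in> U" and U: "openin X U"
  shows "c x \<in> cocycle_sections c (D x)"
proof -
  have "inv (c y) \<otimes> c x \<in> R y" if y: "y \<in> D x" for y
  proof -
    have "c x \<in> Units K" "c y \<in> Units K"
      using cocycles_Units[OF c] x y D_least[OF U x] by auto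
    moreover have "c x \<otimes> inv (c y) \<in> R y" using c x y by (auto simp: cocycles_def unit_germs_def)
    ultimately show ?thesis by (simp add: m_comm)
  qed
  then show ?thesis using cocycles_Units[OF c x] by (simp add: cocycle_sections_def)
qed

text \<open>The two value maps differ by a constant \<gamma>. Evaluating both on the generator with
  \<theta>-value \<open>c x\<close> puts the quotient into \<open>R x\<close>, and evaluating both
  on the generator with \<theta>'-value \<open>d x\<close> does the same for its inverse. If
  \<open>U\<close> is empty any unit will do.\<close>

lemma represents_unique:
  assumes r: "represents U F c \<theta>" and r': "represents U F d \<theta>'" and U: "openin X U"
    and c: "c \<in> cocycles U" and d: "d \<in> cocycles U"
  shows "\<exists>\<gamma> \<in> Units K. \<forall>x \<in> U. c x \<otimes> inv (d x) \<otimes> \<gamma> \<in> unit_germs x"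
proof (cases "U = {}")
  case False
  then have "\<eta> \<in> U" using generic_mem U by blast
  with r r' obtain \<gamma> where \<gamma>: "\<gamma> \<in> Units K"
    and eq: "\<And>V s. \<lbrakk>openin X V; V \<subseteq> U; V \<noteq> {}; s \<in> pts F V\<rbrakk> \<Longrightarrow> \<theta>' V s = \<gamma> \<otimes> \<theta> V s"
    using represents_compare[OF r r'] cocycles_Units c d by metis
  have "c x \<otimes> inv (d x) \<otimes> \<gamma> \<in> unit_germs x" if x: "x \<in> U" for x
  proof -
    have xt: "x \<in> topspace X" using x U topspaceI by blast
    have DU: "D x \<subseteq> U" using D_least[OF U x] .
    note D = openin_D[OF xt] DU D_nonempty[OF xt]
    have u: "c x \<in> Units K" "d x \<in> Units K" using c d x cocycles_Units by auto
    obtain s where s: "s \<in> pts F (D x)" "\<theta> (D x) s = c x"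
      using value_surj[OF r D cocycle_mem_sections[OF c x U]] by blast
    obtain t where t: "t \<in> pts F (D x)" "\<theta>' (D x) t = d x"
      using value_surj[OF r' D cocycle_mem_sections[OF d x U]] by blast
    have "inv (d x) \<otimes> (\<gamma> \<otimes> c x) \<in> R x"
      using value_mem(1)[OF r' D s(1)] eq[OF D s(1)] s(2) D_self[OF xt] by (simp add: cocycle_sections_def)
    then have 1: "c x \<otimes> inv (d x) \<otimes> \<gamma> \<in> R x" using u \<gamma> by (simp add: m_ac)
    have \<theta>t: "\<theta> (D x) t \<in> carrier K" "inv (c x) \<otimes> \<theta> (D x) t \<in> R x"
      using value_mem[OF r D t(1)] D_self[OF xt] by (simp_all add: cocycle_sections_def)
    have "d x = \<gamma> \<otimes> \<theta> (D x) t" using eq[OF D t(1)] t(2) by simp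
    then have "\<theta> (D x) t = inv \<gamma> \<otimes> d x" using \<gamma> \<theta>t(1) by (simp add: Units_cancel)
    then have "inv (c x \<otimes> inv (d x) \<otimes> \<gamma>) \<in> R x"
      using \<theta>t(2) u \<gamma> by (simp add: inv_mult_Units m_ac)
    then show ?thesis using 1 u \<gamma> by (simp add: unit_germs_def)
  qed
  then show ?thesis using \<gamma> by blast
qed auto

text \<open>Every open set on which the sheaf is trivial around \<open>x\<close> contains
  \<open>D x\<close>, so there is a trivialization \<open>\<tau> x\<close> on \<open>D x\<close>,
  and \<open>c x\<close> is its ratio to \<open>\<tau> \<eta>\<close> at \<eta>. All values are read
  at \<eta>, so they are compatible with restriction by construction; gluing is needed to see that
  they determine a section and fill \<open>cocycle_sections c V\<close>.\<close>

lemma invertible_represents: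
  assumes inv: "invertible_oset (on U) \<O> F" and U: "openin X U"
  obtains c \<theta> where "c \<in> cocycles U" "represents U F c \<theta>"
proof -
  interpret F: oset_sheaf "on U" \<O> F using inv by (simp add: invertible_oset_def)
  have set: "binoid_set (sec \<O> V) (sec F V)" if "openin X V" "V \<subseteq> U" for V
    using that U by (intro F.binoid_set_sec) (simp add: openin_sub)
  have Fres: "res F V W s \<in> pts F W"
    if "openin X V" "openin X W" "W \<subseteq> V" "V \<subseteq> U" "s \<in> pts F V" for V W s
    using that U by (intro F.res_closed) (auto simp: openin_sub)
  have Fres2: "res F V' V'' (res F V V' s) = res F V V'' s"
    if "openin X V" "openin X V'" "openin X V''" "V'' \<subseteq> V'" "V' \<subseteq> V" "V \<subseteq> U" "s \<in> pts F V" for V V' V'' s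
    using that U by (intro F.res_res) (auto simp: openin_sub)
  have "\<exists>\<tau>. represents (D x) F (\<lambda>_. \<one>) \<tau>" if x: "x \<in> U" for x
  proof -
    have xt: "x \<in> topspace X" using x U topspaceI by blast
    have DU: "D x \<subseteq> U" using D_least[OF U x] .
    obtain W where W: "openin (on U) W" "x \<in> W"
      "oset_isomorphic (subtopology (on U) W) \<O> F (regular_oset \<O>)"
      using inv x xt by (auto simp: invertible_oset_def)
    have DW: "D x \<subseteq> W" using W U by (intro D_least) (simp_all add: openin_sub)
    have "openin (subtopology (on U) W) (D x)"
      using W(1) DW DU openin_D[OF xt] U by (simp add: openin_open_subtopology openin_sub)
    from oset_isomorphic_subtopology[OF this W(3)]
    have "oset_isomorphic (on (D x)) \<O> F (regular_oset \<O>)"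
      using DW DU by (simp add: subtopology_subtopology Int_absorb1 Int_assoc)
    moreover have "oset_sheaf (on (D x)) \<O> F"
      using F.oset_sheaf_subtopology[of "D x"] openin_D[OF xt] DU U by (simp add: openin_sub subtopology_D)
    ultimately show ?thesis using represents_transfer[OF _ openin_D[OF xt]] represents_regular by blast
  qed
  then obtain \<tau> where \<tau>: "\<And>x. x \<in> U \<Longrightarrow> represents (D x) F (\<lambda>_. \<one>) (\<tau> x)" by metis
  show thesis
  proof (cases "U = {}")
    case True
    \<comment> \<open>With \<open>U\<close> empty no condition on values remains, and the constant
      one is an arbitrary choice.\<close>
    have "represents U F (\<lambda>_. \<one>) (\<lambda>_ _. \<one>)"
    proof (rule representsI)
      show "\<exists>z. pts F {} = {z}" by (rule F.sections_empty)
      fix V assume V: "openin X V" "V \<subseteq> U"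
      then interpret S: binoid_set "sec \<O> V" "sec F V" by (rule set)
      show "basept (sec F V) \<in> pts F V" by (rule S.basept_closed)
      show "act (sec F V) a s \<in> pts F V" if "a \<in> scalars V" "s \<in> pts F V" for a s
        using that by (rule S.act_closed)
    qed (use True Fres in simp_all)
    then show thesis using True by (intro that[of "\<lambda>_. \<one>"]) (simp_all add: cocycles_def)
  next
    case False
    then have \<eta>: "\<eta> \<in> U" using generic_mem U by blast
    have top: "x \<in> topspace X" if "x \<in> U" for x using that U topspaceI by blast
    have DU: "D x \<subseteq> U" if "x \<in> U" for x using D_least[OF U that] .
    have "\<exists>\<gamma> \<in> Units K. \<forall>s \<in> pts F {\<eta>}. \<tau> \<eta> {\<eta>} s = \<gamma> \<otimes> \<tau> x {\<eta>} s" if x: "x \<in> U" for x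
    proof -
      have "\<eta> \<in> D x" "\<eta> \<in> D \<eta>" using generic_D top x \<eta> by auto
      then obtain \<gamma> where "\<gamma> \<in> Units K" "\<And>V s. \<lbrakk>openin X V; V \<subseteq> D x; V \<subseteq> D \<eta>; V \<noteq> {}; s \<in> pts F V\<rbrakk>
          \<Longrightarrow> \<tau> \<eta> V s = \<gamma> \<otimes> \<tau> x V s"
        using represents_compare[OF \<tau>[OF x] \<tau>[OF \<eta>]] by (metis Units_one_closed)
      then show ?thesis using openin_generic \<open>\<eta> \<in> D x\<close> D_generic by (intro bexI[of _ \<gamma>]) simp_all
    qed
    then obtain c where c: "\<And>x. x \<in> U \<Longrightarrow> c x \<in> Units K"
      and c\<tau>: "\<And>x s. \<lbrakk>x \<in> U; s \<in> pts F {\<eta>}\<rbrakk> \<Longrightarrow> \<tau> \<eta> {\<eta>} s = c x \<otimes> \<tau> x {\<eta>} s"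
      by metis
    define \<theta> where "\<theta> V s = \<tau> \<eta> {\<eta>} (res F V {\<eta>} s)" for V s
    have \<theta>: "\<theta> V s = c x \<otimes> \<tau> x V s"
      if x: "x \<in> U" and V: "openin X V" "V \<subseteq> D x" "V \<noteq> {}" "s \<in> pts F V" for x V s
    proof -
      have \<eta>V: "{\<eta>} \<subseteq> V" using generic_mem V by blast
      have "V \<subseteq> U" using V(2) DU[OF x] by blast
      then have "res F V {\<eta>} s \<in> pts F {\<eta>}" using V \<eta>V openin_generic by (intro Fres) auto
      then show ?thesis unfolding \<theta>_def using V \<eta>V openin_generic by (simp add: c\<tau>[OF x] value_res[OF \<tau>[OF x]])
    qed
    have germ: "\<tau> x V s \<in> R y" "\<tau> x V s \<in> carrier K"
      if x: "x \<in> U" and V: "openin X V" "V \<subseteq> D x" "y \<in> V" "s \<in> pts F V" for x y V s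
    proof -
      have "V \<noteq> {}" using V by blast
      then show "\<tau> x V s \<in> R y" "\<tau> x V s \<in> carrier K"
        using value_mem[OF \<tau>[OF x] V(1,2) _ V(4)] V(1,3) by (auto simp: cocycle_sections_one)
    qed
    \<comment> \<open>If \<open>s\<close> has value one under \<open>\<tau> x\<close>, the quotient
      is the value of \<open>s\<close> under \<open>\<tau> x'\<close>, hence lies in
      \<open>R y\<close>. The claim is symmetric in the two points, so that exchanging them yields
      the inverse.\<close>
    have cc: "c x \<otimes> inv (c x') \<in> R y" if x: "x \<in> U" "x' \<in> U" "y \<in> D x" "y \<in> D x'" for x x' y
    proof -
      have y: "y \<in> topspace X" "openin X (D y)" "D y \<subseteq> D x" "D y \<subseteq> D x'" "y \<in> D y"
        using x top topspaceI[OF openin_D] openin_D D_D D_self by blast+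
      have "\<one> \<in> cocycle_sections (\<lambda>_. \<one>) (D y)"
        using R_one topspaceI[OF y(2)] by (simp add: cocycle_sections_def)
      then obtain s where s: "s \<in> pts F (D y)" "\<tau> x (D y) s = \<one>"
        using value_surj[OF \<tau>[OF x(1)] y(2,3)] D_nonempty[OF y(1)] by blast
      have "c x = c x' \<otimes> \<tau> x' (D y) s"
        using \<theta>[OF x(1) y(2,3) D_nonempty[OF y(1)] s(1)] \<theta>[OF x(2) y(2,4) D_nonempty[OF y(1)] s(1)] s(2) c[OF x(1)]
        by simp
      moreover have t: "\<tau> x' (D y) s \<in> R y" "\<tau> x' (D y) s \<in> carrier K" using germ[OF x(2) y(2,4,5) s(1)] by auto
      ultimately have "c x \<otimes> inv (c x') = c x' \<otimes> (inv (c x') \<otimes> \<tau> x' (D y) s)"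
        using c x by (simp add: m_ac)
      then show ?thesis using t Units_cancel c x by simp
    qed
    have "c \<in> cocycles U"
      unfolding cocycles_def
    proof (intro CollectI conjI ballI Pi_I c)
      fix x y assume x: "x \<in> U" and y: "y \<in> D x"
      have y': "y \<in> U" "y \<in> D y" using y DU[OF x] D_self top by auto
      have "inv (c x \<otimes> inv (c y)) = c y \<otimes> inv (c x)" using c x y' by (simp add: inv_mult_Units m_comm)
      then show "c x \<otimes> inv (c y) \<in> unit_germs y"
        using cc[OF x y'(1) y y'(2)] cc[OF y'(1) x y'(2) y] c x y' by (simp add: unit_germs_def)
    qed
    moreover have "represents U F c \<theta>"
    proof (rule representsI)
      show "\<exists>z. pts F {} = {z}" by (rule F.sections_empty)
      fix V assume V: "openin X V" "V \<subseteq> U"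
      then interpret S: binoid_set "sec \<O> V" "sec F V" by (rule set)
      show "basept (sec F V) \<in> pts F V" by (rule S.basept_closed)
      show "act (sec F V) a s \<in> pts F V" if "a \<in> scalars V" "s \<in> pts F V" for a s
        using that by (rule S.act_closed)
      assume ne: "V \<noteq> {}"
      then have \<eta>V: "{\<eta>} \<subseteq> V" using generic_mem V by blast
      show "\<theta> V (basept (sec F V)) = absorb K"
        using F.res_basept[of V "{\<eta>}"] V U \<eta>V \<eta> openin_generic value_basept[OF \<tau>[OF \<eta>] openin_generic]
        by (simp add: \<theta>_def openin_sub D_generic)
      show "\<theta> V (act (sec F V) a s) = ev V a \<otimes> \<theta> V s"
        if "a \<in> scalars V" "s \<in> pts F V" for a s
        using F.res_act[of V "{\<eta>}" a s] that V U \<eta>V \<eta> openin_generic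
          value_act[OF \<tau>[OF \<eta>] openin_generic, of "res \<O> V {\<eta>} a" "res F V {\<eta>} s"]
        by (simp add: \<theta>_def openin_sub D_generic O_res_closed Fres ev_res)
      have \<theta>D: "\<theta> (D x) (res F V (D x) s) = \<theta> V s" if "x \<in> V" "s \<in> pts F V" for x s
        unfolding \<theta>_def using that V ne openin_generic generic_D[OF topspaceI[OF V(1) that(1)]]
          openin_D[OF topspaceI[OF V(1) that(1)]] D_least[OF V(1) that(1)]
        by (simp add: Fres2)
      have Dx: "x \<in> U" "x \<in> topspace X" "openin X (D x)" "D x \<noteq> {}" "D x \<subseteq> V" if "x \<in> V" for x
      proof -
        show "x \<in> U" using that V by blast
        then show xt: "x \<in> topspace X" by (rule top)
        show "openin X (D x)" "D x \<noteq> {}" by (simp_all add: xt openin_D D_nonempty)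
        show "D x \<subseteq> V" using V(1) that by (rule D_least)
      qed
      have inj: "s = t" if x: "x \<in> U" and W: "openin X W" "W \<subseteq> D x" "W \<noteq> {}"
        "s \<in> pts F W" "t \<in> pts F W" "\<theta> W s = \<theta> W t" for x W s t
      proof -
        obtain y where "y \<in> W" using W by blast
        then have "\<tau> x W s = \<tau> x W t"
          using W \<theta>[OF x W(1,2,3)] c[OF x] germ(2)[OF x W(1,2)] by simp
        then show ?thesis by (rule value_inj[OF \<tau>[OF x] W(1-5)])
      qed
      have UD: "\<Union> (D ` V) = V"
      proof
        show "\<Union> (D ` V) \<subseteq> V" using Dx(5) by (rule UN_least)
        show "V \<subseteq> \<Union> (D ` V)" using D_self[OF Dx(2)] by auto
      qed
      have DV: "openin X W" "W \<subseteq> V" "W \<subseteq> U" if "W \<in> D ` V" for W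
        using that Dx V(2) by blast+
      show "bij_betw (\<theta> V) (pts F V) (cocycle_sections c V)"
        unfolding bij_betw_def
      proof
        show "inj_on (\<theta> V) (pts F V)"
        proof (rule inj_onI)
          fix s t assume s: "s \<in> pts F V" and t: "t \<in> pts F V" and eq: "\<theta> V s = \<theta> V t"
          have same: "res F V W s = res F V W t" if W: "W \<in> D ` V" for W
          proof -
            obtain x where x: "x \<in> V" "W = D x" using W by blast
            show ?thesis unfolding x(2)
              by (rule inj[OF Dx(1,3)[OF x(1)] order_refl Dx(4)[OF x(1)]])
                (use x Dx[OF x(1)] s t eq V in \<open>simp_all add: Fres \<theta>D\<close>)
          qed
          \<comment> \<open>Gluing is used for its uniqueness here: \<open>s\<close> and
            \<open>t\<close> have the same restrictions to the sets \<open>D x\<close>.\<close>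
          have "\<exists>!r. r \<in> pts F (\<Union>(D ` V)) \<and> (\<forall>W \<in> D ` V. res F (\<Union>(D ` V)) W r = res F V W s)"
          proof (rule F.glue)
            fix W assume "W \<in> D ` V"
            then show "openin (on U) W" "res F V W s \<in> pts F W"
              using U V s DV by (simp_all add: openin_sub Fres)
          next
            fix W W' assume "W \<in> D ` V" "W' \<in> D ` V"
            then have "openin X W" "openin X W'" "W \<subseteq> V" "W' \<subseteq> V" by (simp_all only: DV)
            moreover from this have "openin X (W \<inter> W')" by blast
            ultimately show "res F W (W \<inter> W') (res F V W s) = res F W' (W \<inter> W') (res F V W' s)"
              using V s Fres2[OF V(1), of W "W \<inter> W'"] Fres2[OF V(1), of W' "W \<inter> W'"] by simp
          qed
          then obtain r where uniq: "\<And>r'. r' \<in> pts F V \<Longrightarrow> \<forall>W \<in> D ` V. res F V W r' = res F V W s \<Longrightarrow> r' = r"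
            unfolding UD by (elim ex1E) blast
          have "s = r" using s by (rule uniq) simp
          moreover have "t = r" using t by (rule uniq) (simp add: same)
          ultimately show "s = t" by simp
        qed
        have "\<theta> V s \<in> cocycle_sections c V" if s: "s \<in> pts F V" for s
        proof -
          have g: "inv (c x) \<otimes> \<theta> V s \<in> R x \<and> \<theta> V s \<in> carrier K" if x: "x \<in> V" for x
          proof -
            let ?s = "res F V (D x) s"
            have s': "?s \<in> pts F (D x)" using V s Dx[OF x] by (simp add: Fres)
            have "\<theta> V s = c x \<otimes> \<tau> x (D x) ?s"
              using \<theta>[OF Dx(1,3)[OF x] order_refl Dx(4)[OF x] s'] \<theta>D[OF x s] by simp
            then show ?thesis
              using germ[OF Dx(1,3)[OF x] order_refl D_self[OF Dx(2)[OF x]] s'] c[OF Dx(1)[OF x]]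
              by (simp add: Units_cancel)
          qed
          moreover have "\<exists>x. x \<in> V" using ne by blast
          ultimately show ?thesis by (auto simp: cocycle_sections_def)
        qed
        moreover have "k \<in> \<theta> V ` pts F V" if k: "k \<in> cocycle_sections c V" for k
        proof -
          have ex: "\<exists>s \<in> pts F (D x). \<theta> (D x) s = k" if x: "x \<in> V" for x
          proof -
            have "inv (c x) \<otimes> k \<in> R y" if "y \<in> D x" for y
              using k x R_mono[OF Dx(2)[OF x] that] by (auto simp: cocycle_sections_def)
            then have "inv (c x) \<otimes> k \<in> cocycle_sections (\<lambda>_. \<one>) (D x)"
              using cocycle_sections_one[OF Dx(4,3)[OF x]] by simp
            then obtain s where "s \<in> pts F (D x)" "\<tau> x (D x) s = inv (c x) \<otimes> k"
              using value_surj[OF \<tau>[OF Dx(1)[OF x]] Dx(3)[OF x] order_refl Dx(4)[OF x]] by blast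
            then show ?thesis
              using \<theta>[OF Dx(1,3)[OF x] order_refl Dx(4)[OF x]] c[OF Dx(1)[OF x]] k
              by (intro bexI[of _ s]) (simp_all add: Units_cancel cocycle_sections_def)
          qed
          \<comment> \<open>The family is indexed by open sets, as \<open>glue\<close> requires.
            Each member has value \<open>k\<close>, and by injectivity of values over subsets of
            some \<open>D x\<close> this makes the members agree on overlaps.\<close>
          define \<sigma> where "\<sigma> W = (SOME s. s \<in> pts F W \<and> \<theta> W s = k)" for W
          have \<sigma>: "\<sigma> (D x) \<in> pts F (D x)" "\<theta> (D x) (\<sigma> (D x)) = k" if x: "x \<in> V" for x
            using someI_ex[of "\<lambda>s. s \<in> pts F (D x) \<and> \<theta> (D x) s = k"] ex[OF x]
            by (auto simp: \<sigma>_def)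
          have "\<exists>!t. t \<in> pts F (\<Union>(D ` V)) \<and> (\<forall>W \<in> D ` V. res F (\<Union>(D ` V)) W t = \<sigma> W)"
          proof (rule F.glue)
            fix W assume "W \<in> D ` V"
            then obtain x where x: "x \<in> V" "W = D x" by blast
            then show "openin (on U) W" "\<sigma> W \<in> pts F W"
              using U \<sigma>(1)[OF x(1)] DV by (simp_all add: openin_sub)
          next
            fix W W' assume "W \<in> D ` V" "W' \<in> D ` V"
            then obtain x y where xy: "x \<in> V" "W = D x" "y \<in> V" "W' = D y" by blast
            let ?W = "D x \<inter> D y"
            have W: "openin X ?W" "\<eta> \<in> ?W"
              using xy Dx generic_D by (auto intro: openin_Int)
            have \<theta>res: "\<theta> ?W (res F (D z) ?W (\<sigma> (D z))) = k" "res F (D z) ?W (\<sigma> (D z)) \<in> points (sec F ?W)"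
              if z: "z \<in> V" "?W \<subseteq> D z" for z
            proof -
              have DzU: "D z \<subseteq> U" using Dx[OF z(1)] V by blast
              have "res F ?W {\<eta>} (res F (D z) ?W (\<sigma> (D z))) = res F (D z) {\<eta>} (\<sigma> (D z))"
                using Dx[OF z(1)] W z \<sigma>[OF z(1)] openin_generic DzU by (intro Fres2) auto
              then show "\<theta> ?W (res F (D z) ?W (\<sigma> (D z))) = k" using \<sigma>(2)[OF z(1)] by (simp add: \<theta>_def)
              show "res F (D z) ?W (\<sigma> (D z)) \<in> points (sec F ?W)"
                using Dx[OF z(1)] W z \<sigma>[OF z(1)] DzU by (intro Fres) auto
            qed
            show "res F W (W \<inter> W') (\<sigma> W) = res F W' (W \<inter> W') (\<sigma> W')"
              unfolding xy
            proof (rule inj[OF Dx(1)[OF xy(1)] W(1)])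
              show "?W \<noteq> {}" using W(2) by blast
            qed (use \<theta>res[OF xy(1)] \<theta>res[OF xy(3)] in simp_all)
          qed
          then obtain t where t: "t \<in> pts F V" "\<forall>W \<in> D ` V. res F V W t = \<sigma> W"
            unfolding UD by (elim ex1E conjE)
          obtain x where x: "x \<in> V" using ne by blast
          have "\<theta> V t = k" using \<theta>D[OF x t(1)] t(2) \<sigma>(2)[OF x] x by simp
          then show ?thesis using t(1) by blast
        qed
        ultimately show "\<theta> V ` pts F V = cocycle_sections c V" by blast
      qed
    next
      fix V W s assume V: "openin X V" "openin X W" "W \<subseteq> V" "V \<subseteq> U" "s \<in> pts F V"
      then show "res F V W s \<in> pts F W" by (rule Fres)
      assume "W \<noteq> {}"
      then have "{\<eta>} \<subseteq> W" using generic_mem V by blast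
      then show "\<theta> W (res F V W s) = \<theta> V s"
        using V openin_generic unfolding \<theta>_def by (simp add: Fres2)
    qed
    ultimately show thesis by (rule that)
  qed
qed

text \<open>
  The sheaf with cocycle \<open>c\<close> is realized inside the sections of \<open>\<O>\<close> over the generic point, which are
  a copy of \<open>K\<close>.
\<close>

lemma represents_exists:
  assumes U: "openin X U" and c: "c \<in> cocycles U"
  shows "\<exists>(F :: ('x, 'r, ('r, 'r) bset) presheaf) \<theta>. represents U F c \<theta>"
proof -
  define \<epsilon> where "\<epsilon> = inv_into (scalars {\<eta>}) (ev {\<eta>})"
  have "bij_betw (ev {\<eta>}) (scalars {\<eta>}) (carrier K)"
    using ev_bij[OF openin_generic] R_generic by simp
  then have \<epsilon>: "ev {\<eta>} (\<epsilon> k) = k" if "k \<in> carrier K" for k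
    using that by (simp add: \<epsilon>_def bij_betw_inv_into_right)
  \<comment> \<open>Over the empty set any one-point set would serve;
    \<open>\<epsilon> \<one>\<close> is an arbitrary choice.\<close>
  define F :: "('x, 'r, ('r, 'r) bset) presheaf" where
    "F = \<lparr> sec = (\<lambda>V.
      \<lparr> points = (if V = {} then {\<epsilon> \<one>} else \<epsilon> ` cocycle_sections c V),
        basept = (if V = {} then \<epsilon> \<one> else \<epsilon> (absorb K)),
        act = (\<lambda>a s. if V = {} then \<epsilon> \<one> else \<epsilon> (ev V a \<otimes> ev {\<eta>} s)) \<rparr>),
      res = (\<lambda>V W s. if W = {} then \<epsilon> \<one> else s) \<rparr>"
  have carr: "k \<in> carrier K" if "k \<in> cocycle_sections c V" for k V
    using that by (simp add: cocycle_sections_def)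
  have "represents U F c (\<lambda>V. ev {\<eta>})"
  proof (rule representsI)
    show "\<exists>z. pts F {} = {z}" by (simp add: F_def)
    fix V assume V: "openin X V" "V \<subseteq> U"
    have "absorb K \<in> cocycle_sections c V"
    proof -
      have "inv (c x) \<otimes> absorb K \<in> R x" if "x \<in> V" for x
        using absorb_R[OF topspaceI[OF V(1) that]] cocycles_Units[OF c, of x] V that
        by (auto simp: absorb_mult)
      then show ?thesis by (simp add: cocycle_sections_def absorb_closed)
    qed
    then show "basept (sec F V) \<in> pts F V" by (simp add: F_def)
    fix a s assume a: "a \<in> scalars V" and s: "s \<in> pts F V"
    show "act (sec F V) a s \<in> pts F V"
    proof (cases "V = {}")
      case False
      then obtain k where k: "k \<in> cocycle_sections c V" "s = \<epsilon> k" using s by (auto simp: F_def)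
      obtain x0 where "x0 \<in> V" using False by blast
      then have evc: "ev V a \<in> carrier K" using ev_mem[OF V(1) a] by blast
      have "inv (c x) \<otimes> (ev V a \<otimes> k) \<in> R x" if x: "x \<in> V" for x
      proof -
        have "inv (c x) \<otimes> (ev V a \<otimes> k) = ev V a \<otimes> (inv (c x) \<otimes> k)"
          using cocycles_Units[OF c, of x] x V evc carr[OF k(1)] by (intro m_lcomm) auto
        then show ?thesis
          using R_mult[OF topspaceI[OF V(1) x] ev_mem(1)[OF V(1) a x]] k x by (simp add: cocycle_sections_def)
      qed
      then have "ev V a \<otimes> k \<in> cocycle_sections c V"
        using evc carr[OF k(1)] by (simp add: cocycle_sections_def)
      then show ?thesis using False k carr[OF k(1)] by (simp add: F_def \<epsilon>)
    qed (simp add: F_def)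
  next
    fix V W s assume V: "openin X V" "openin X W" "W \<subseteq> V" "V \<subseteq> U" "s \<in> pts F V"
    have "cocycle_sections c V \<subseteq> cocycle_sections c W" using V(3) by (auto simp: cocycle_sections_def)
    then show "res F V W s \<in> pts F W"
      using V(3,5) by (cases "W = {}"; cases "V = {}") (auto simp: F_def)
  next
    fix V assume V: "openin X V" "V \<subseteq> U" "V \<noteq> {}"
    show "bij_betw (ev {\<eta>}) (pts F V) (cocycle_sections c V)"
      using V(3) carr by (intro bij_betwI[where g = \<epsilon>]) (auto simp: F_def \<epsilon>)
    show "ev {\<eta>} (basept (sec F V)) = absorb K" using V(3) absorb_closed by (simp add: F_def \<epsilon>)
    fix a s assume a: "a \<in> scalars V" and s: "s \<in> pts F V"
    obtain x where "x \<in> V" using V(3) by blast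
    then have "ev V a \<in> carrier K" using ev_mem(2)[OF V(1) a] by blast
    then show "ev {\<eta>} (act (sec F V) a s) = ev V a \<otimes> ev {\<eta>} s"
      using s V(3) carr by (auto simp: F_def \<epsilon>)
  next
    fix V W :: "'x set" and s assume "W \<noteq> {}"
    then show "ev {\<eta>} (res F V W s) = ev {\<eta>} s" by (simp add: F_def)
  qed
  then show ?thesis by blast
qed

end


section \<open>Smash products\<close>

text \<open>Functoriality of the smash product along a change of scalars \<rho>. With \<rho> the
  identity it yields the action on a smash product, with \<rho> a restriction map of \<O> the
  restriction of its sections.\<close>

lemma smash_rel_map:
  assumes "(x, y) \<in> smash_rel M S T"
    and base: "f (basept S) = basept S'" "g (basept T) = basept T'"
    and closed: "\<And>a. a \<in> carrier M \<Longrightarrow> \<rho> a \<in> carrier M'"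
      "\<And>s. s \<in> points S \<Longrightarrow> f s \<in> points S'" "\<And>t. t \<in> points T \<Longrightarrow> g t \<in> points T'"
    and act: "\<And>a s. a \<in> carrier M \<Longrightarrow> s \<in> points S \<Longrightarrow> f (act S a s) = act S' (\<rho> a) (f s)"
      "\<And>a t. a \<in> carrier M \<Longrightarrow> t \<in> points T \<Longrightarrow> g (act T a t) = act T' (\<rho> a) (g t)"
  shows "((f (fst x), g (snd x)), (f (fst y), g (snd y))) \<in> smash_rel M' S' T'"
  using assms(1)
proof induction
  case smash_trans
  then show ?case by (blast intro: smash_rel.smash_trans)
qed (auto simp: base act intro: closed smash_rel.intros)

text \<open>The universal property: a function that respects collapsing and balancing is constant on
  classes. It serves to define the value of a class in \<open>K\<close>.\<close>

lemma smash_rel_invariant: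
  assumes "(x, y) \<in> smash_rel M S T"
    and "\<And>t. t \<in> points T \<Longrightarrow> h (basept S, t) = h (basept S, basept T)"
    and "\<And>s. s \<in> points S \<Longrightarrow> h (s, basept T) = h (basept S, basept T)"
    and "\<And>a s t. \<lbrakk>a \<in> carrier M; s \<in> points S; t \<in> points T\<rbrakk> \<Longrightarrow> h (act S a s, t) = h (s, act T a t)"
  shows "h x = h y"
  using assms(1) by induction (simp_all add: assms(2-4))

locale binoid_set_pair = S: binoid_set M S + T: binoid_set M T for M (structure) and S T
begin

lemma smash_rel_equiv: "equiv (points S \<times> points T) (smash_rel M S T)"
proof (rule equivI)
  have "x \<in> points S \<times> points T \<and> y \<in> points S \<times> points T" if "(x, y) \<in> smash_rel M S T" for x y
    using that
    by induction (simp_all add: S.basept_closed T.basept_closed S.act_closed T.act_closed)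
  then show "smash_rel M S T \<subseteq> (points S \<times> points T) \<times> (points S \<times> points T)" by auto
  show "refl_on (points S \<times> points T) (smash_rel M S T)"
    by (auto intro!: refl_onI smash_rel.smash_refl)
  show "sym (smash_rel M S T)" by (auto intro: symI smash_rel.smash_sym)
  show "trans (smash_rel M S T)" by (auto intro: transI smash_rel.smash_trans)
qed

lemma smash_class_points:
  "\<lbrakk>s \<in> points S; t \<in> points T\<rbrakk> \<Longrightarrow> smash_rel M S T `` {(s, t)} \<in> points (smash M S T)"
  by (simp add: smash_def quotientI)

lemma smash_points_cases:
  assumes "C \<in> points (smash M S T)"
  obtains s t where "s \<in> points S" "t \<in> points T" "C = smash_rel M S T `` {(s, t)}"
  using assms by (auto simp: smash_def elim!: quotientE)

lemma smash_class_eqI: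
  "(x, y) \<in> smash_rel M S T \<Longrightarrow> smash_rel M S T `` {x} = smash_rel M S T `` {y}"
  by (rule equiv_class_eq[OF smash_rel_equiv])

text \<open>Action and restriction are defined by unions over all representatives of a class. When
  the relation is respected, all members of such a union are the same class, and it collapses to the
  result for one representative.\<close>

lemma smash_class_map:
  assumes "\<And>x y. (x, y) \<in> smash_rel M S T \<Longrightarrow>
      ((f (fst x), g (snd x)), (f (fst y), g (snd y))) \<in> smash_rel M' S' T'"
    and T': "binoid_set_pair M' S' T'" and s: "s \<in> points S" "t \<in> points T"
  shows "(\<Union>(s, t) \<in> smash_rel M S T `` {(s, t)}. smash_rel M' S' T' `` {(f s, g t)}) =
    smash_rel M' S' T' `` {(f s, g t)}"
proof -
  let ?h = "\<lambda>x. smash_rel M' S' T' `` {(f (fst x), g (snd x))}"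
  have "?h respects smash_rel M S T"
    using assms(1) by (intro congruentI binoid_set_pair.smash_class_eqI[OF T'])
  from UN_equiv_class[OF smash_rel_equiv this, of "(s, t)"] show ?thesis
    using s by (simp add: case_prod_unfold)
qed

lemma smash_act_class:
  assumes "a \<in> carrier M" "s \<in> points S" "t \<in> points T"
  shows "act (smash M S T) a (smash_rel M S T `` {(s, t)}) = smash_rel M S T `` {(act S a s, t)}"
proof -
  have "((act S a (fst x), id (snd x)), (act S a (fst y), id (snd y))) \<in> smash_rel M S T"
    if "(x, y) \<in> smash_rel M S T" for x y
  proof (rule smash_rel_map[OF that, where \<rho> = id])
    fix b s assume b: "b \<in> carrier M" "s \<in> points S"
    \<comment> \<open>Acting by \<open>a\<close> is a linear map because the binoid is
      commutative.\<close>
    then have "act S (a \<otimes> b) s = act S (b \<otimes> a) s" using assms(1) by (simp add: S.m_comm)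
    then show "act S a (act S b s) = act S (id b) (act S a s)" using assms(1) b by (simp add: S.act_mult)
  qed (use assms(1) in \<open>simp_all add: S.act_basept S.act_closed\<close>)
  from smash_class_map[where f = "act S a" and g = id, OF this binoid_set_pair_axioms assms(2,3)] show ?thesis
    by (simp add: smash_def)
qed

end

section \<open>The smash product of two sheaves with given cocycles\<close>

locale represented_pair = generic_binoid_space +
  fixes U F G c d \<theta> \<theta>'
  assumes U: "openin X U" and c: "c \<in> cocycles U" and d: "d \<in> cocycles U"
    and F: "represents U F c \<theta>" and G: "represents U G d \<theta>'"
begin

abbreviation "P \<equiv> smash_presheaf \<O> F G"
abbreviation "pgerm \<equiv> germ (on U) P"
abbreviation "cls V s t \<equiv> smash_rel (sec \<O> V) (sec F V) (sec G V) `` {(s, t)}"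

text \<open>For nonempty \<open>V\<close> the product of values is the same on all representatives
  of a class, so \<open>the_elem\<close> returns it without any choice.\<close>

definition pvalue where
  "pvalue V C = the_elem ((\<lambda>(s, t). \<theta> V s \<otimes> \<theta>' V t) ` C)"

lemma sec_P: "sec P V = smash (sec \<O> V) (sec F V) (sec G V)"
  by (simp add: smash_presheaf_def)

lemma pair:
  assumes "openin X V" "V \<subseteq> U"
  shows "binoid_set_pair (sec \<O> V) (sec F V) (sec G V)"
proof -
  interpret F: oset_sheaf "on U" \<O> F using F U by (rule represents_oset_sheaf)
  interpret G: oset_sheaf "on U" \<O> G using G U by (rule represents_oset_sheaf)
  have "openin (on U) V" using assms U by (simp add: openin_sub)
  then show ?thesis by (intro binoid_set_pair.intro F.binoid_set_sec G.binoid_set_sec)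
qed

lemma cls_mem:
  "\<lbrakk>openin X V; V \<subseteq> U; s \<in> pts F V; t \<in> pts G V\<rbrakk> \<Longrightarrow> cls V s t \<in> pts P V"
  unfolding sec_P by (rule binoid_set_pair.smash_class_points[OF pair])

lemma presheaf_cases:
  assumes "openin X V" "V \<subseteq> U" "C \<in> pts P V"
  obtains s t where "s \<in> pts F V" "t \<in> pts G V" "C = cls V s t"
  using assms(3) unfolding sec_P by (rule binoid_set_pair.smash_points_cases[OF pair[OF assms(1,2)]])

text \<open>The product is invariant under the generating relations: collapsing to base points
  matches absorption in \<open>K\<close>, and balancing matches commutativity and associativity of
  \<open>K\<close>.\<close>

lemma pvalue_cls:
  assumes V: "openin X V" "V \<subseteq> U" "V \<noteq> {}" and st: "s \<in> pts F V" "t \<in> pts G V"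
  shows "pvalue V (cls V s t) = \<theta> V s \<otimes> \<theta>' V t"
proof -
  interpret binoid_set_pair "sec \<O> V" "sec F V" "sec G V" using V by (intro pair)
  obtain x0 where x0: "x0 \<in> V" using V by blast
  let ?h = "\<lambda>(s, t). \<theta> V s \<otimes> \<theta>' V t"
  have "?h x = ?h y" if "(x, y) \<in> smash_rel (sec \<O> V) (sec F V) (sec G V)" for x y
  proof (rule smash_rel_invariant[OF that])
    fix a s t assume "a \<in> scalars V" "s \<in> pts F V" "t \<in> pts G V"
    then show "?h (act (sec F V) a s, t) = ?h (s, act (sec G V) a t)"
      using V ev_mem(2)[OF V(1) _ x0] value_mem(2)[OF F V] value_mem(2)[OF G V]
      by (simp add: value_act[OF F] value_act[OF G] m_ac)
  qed (use V value_mem(2)[OF F V] value_mem(2)[OF G V] in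
      \<open>simp_all add: value_basept[OF F] value_basept[OF G] absorb_left absorb_mult absorb_closed\<close>)
  then have *: "?h y = ?h (s, t)" if "y \<in> cls V s t" for y
    using that smash_rel.smash_sym by (metis Image_singleton_iff)
  have "(s, t) \<in> cls V s t" using st by (simp add: smash_rel.smash_refl)
  then have "cls V s t \<noteq> {}" by blast
  from the_elem_image_unique[OF this, of ?h "\<theta> V s \<otimes> \<theta>' V t"] *
  show ?thesis unfolding pvalue_def by simp
qed

lemma presheaf_act:
  assumes V: "openin X V" "V \<subseteq> U" and a: "a \<in> scalars V" and C: "C \<in> pts P V"
  shows "act (sec P V) a C \<in> pts P V"
    and "V \<noteq> {} \<Longrightarrow> pvalue V (act (sec P V) a C) = ev V a \<otimes> pvalue V C"
proof -
  interpret binoid_set_pair "sec \<O> V" "sec F V" "sec G V" using V by (rule pair)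
  obtain s t where st: "s \<in> pts F V" "t \<in> pts G V" "C = cls V s t"
    using V C by (rule presheaf_cases)
  have eq: "act (sec P V) a C = cls V (act (sec F V) a s) t"
    unfolding sec_P st(3) using a st(1,2) by (rule smash_act_class)
  have s': "act (sec F V) a s \<in> pts F V" using a st by (intro S.act_closed)
  show "act (sec P V) a C \<in> pts P V" unfolding eq using V s' st(2) by (rule cls_mem)
  assume ne: "V \<noteq> {}"
  then obtain x where "x \<in> V" by blast
  then have "ev V a \<in> carrier K" using V a by (intro ev_mem)
  then show "pvalue V (act (sec P V) a C) = ev V a \<otimes> pvalue V C"
    unfolding eq unfolding st(3) using V ne a st(1,2) s' value_mem(2)[OF F V ne] value_mem(2)[OF G V ne]
    by (simp add: pvalue_cls value_act[OF F] m_assoc)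
qed

lemma presheaf_res:
  assumes V: "openin X V" "openin X W" "W \<subseteq> V" "V \<subseteq> U" and C: "C \<in> pts P V"
  shows "res P V W C \<in> pts P W"
    and "W \<noteq> {} \<Longrightarrow> pvalue W (res P V W C) = pvalue V C"
proof -
  have WU: "W \<subseteq> U" using V by blast
  interpret F: oset_sheaf "on U" \<O> F using F U by (rule represents_oset_sheaf)
  interpret G: oset_sheaf "on U" \<O> G using G U by (rule represents_oset_sheaf)
  have sub: "openin (on U) V" "openin (on U) W" using V WU U by (simp_all add: openin_sub)
  interpret pV: binoid_set_pair "sec \<O> V" "sec F V" "sec G V" using V by (intro pair)
  obtain s t where st: "s \<in> pts F V" "t \<in> pts G V" "C = cls V s t"
    using V(1,4) C by (rule presheaf_cases)
  have st': "res F V W s \<in> pts F W" "res G V W t \<in> pts G W"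
    using st V by (simp_all add: represents_res[OF F] represents_res[OF G])
  have "((res F V W (fst x), res G V W (snd x)), (res F V W (fst y), res G V W (snd y)))
      \<in> smash_rel (sec \<O> W) (sec F W) (sec G W)"
    if "(x, y) \<in> smash_rel (sec \<O> V) (sec F V) (sec G V)" for x y
    by (rule smash_rel_map[OF that, where \<rho> = "res \<O> V W"])
      (use sub V(3) in \<open>simp_all add: F.res_basept G.res_basept F.res_act G.res_act F.res_closed G.res_closed
        O_res_closed[OF V(1-3)]\<close>)
  from pV.smash_class_map[where f = "res F V W" and g = "res G V W", OF this pair[OF V(2) WU] st(1,2)]
  have eq: "res P V W C = cls W (res F V W s) (res G V W t)"
    by (simp add: smash_presheaf_def st(3))
  show "res P V W C \<in> pts P W" unfolding eq using V(2) WU st' by (rule cls_mem)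
  assume ne: "W \<noteq> {}"
  then have "V \<noteq> {}" using V(3) by blast
  then show "pvalue W (res P V W C) = pvalue V C"
    unfolding eq unfolding st(3) using V WU ne st st'
    by (simp add: pvalue_cls value_res[OF F] value_res[OF G])
qed

lemma presheaf_basept:
  assumes V: "openin X V" "V \<subseteq> U"
  shows "basept (sec P V) \<in> pts P V"
    and "V \<noteq> {} \<Longrightarrow> pvalue V (basept (sec P V)) = absorb K"
proof -
  have eq: "basept (sec P V) = cls V (basept (sec F V)) (basept (sec G V))"
    by (simp add: smash_presheaf_def smash_def)
  show "basept (sec P V) \<in> pts P V"
    unfolding eq using V by (intro cls_mem represents_basept[OF F] represents_basept[OF G])
  show "pvalue V (basept (sec P V)) = absorb K" if "V \<noteq> {}"
    unfolding eq using V that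
    by (simp add: pvalue_cls represents_basept[OF F] represents_basept[OF G]
        value_basept[OF F] value_basept[OF G] absorb_mult absorb_closed)
qed

lemma point_facts:
  assumes "x \<in> U"
  shows "x \<in> topspace X" "openin X (D x)" "D x \<subseteq> U" "D x \<noteq> {}" "x \<in> D x" "\<eta> \<in> D x"
proof -
  show x: "x \<in> topspace X" using topspaceI[OF U assms] .
  show "openin X (D x)" "D x \<subseteq> U" "D x \<noteq> {}" "x \<in> D x" "\<eta> \<in> D x"
    using openin_D[OF x] D_least[OF U assms] D_nonempty[OF x] D_self[OF x] generic_D[OF x] by auto
qed

lemma Units_cd: "x \<in> U \<Longrightarrow> c x \<in> Units K" "x \<in> U \<Longrightarrow> d x \<in> Units K"
  using cocycles_Units c d by auto

lemma pvalue_germ: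
  assumes V: "openin X V" "V \<subseteq> U" "x \<in> V" and C: "C \<in> pts P V"
  shows "pvalue V C \<in> carrier K" "inv (c x \<otimes> d x) \<otimes> pvalue V C \<in> R x"
proof -
  have ne: "V \<noteq> {}" using V by blast
  obtain s t where st: "s \<in> pts F V" "t \<in> pts G V" "C = cls V s t"
    using V(1,2) C by (rule presheaf_cases)
  have x: "x \<in> U" "x \<in> topspace X" using V topspaceI by auto
  have s: "\<theta> V s \<in> carrier K" "inv (c x) \<otimes> \<theta> V s \<in> R x"
    using value_mem[OF F V(1,2) ne st(1)] V(3) by (simp_all add: cocycle_sections_def)
  have t: "\<theta>' V t \<in> carrier K" "inv (d x) \<otimes> \<theta>' V t \<in> R x"
    using value_mem[OF G V(1,2) ne st(2)] V(3) by (simp_all add: cocycle_sections_def)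
  have eq: "pvalue V C = \<theta> V s \<otimes> \<theta>' V t" using V ne st by (simp add: pvalue_cls)
  show "pvalue V C \<in> carrier K" using eq s t by simp
  have "inv (c x \<otimes> d x) \<otimes> pvalue V C = (inv (c x) \<otimes> \<theta> V s) \<otimes> (inv (d x) \<otimes> \<theta>' V t)"
    unfolding eq using s t Units_cd[OF x(1)] by (simp add: inv_mult_Units m_ac)
  then show "inv (c x \<otimes> d x) \<otimes> pvalue V C \<in> R x" using R_mult[OF x(2) s(2) t(2)] by simp
qed

lemma generator:
  assumes "x \<in> U"
  obtains h where "h \<in> pts G (D x)" "\<theta>' (D x) h = d x"
  using value_surj[OF G point_facts(2,3,4)[OF assms] cocycle_mem_sections[OF d assms U]] .

text \<open>Over \<open>D x\<close> the sheaf \<open>G\<close> is free on a generator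
  \<open>h\<close>, so balancing moves every coefficient to the left and each class has the form
  \<open>cls (D x) p h\<close>. Its value then determines \<open>p\<close>. Over a general open set
  such a generator need not exist, hence the restriction to \<open>D x\<close>.\<close>

lemma pvalue_inj:
  assumes x: "x \<in> U" and C: "C \<in> pts P (D x)" "C' \<in> pts P (D x)"
    and eq: "pvalue (D x) C = pvalue (D x) C'"
  shows "C = C'"
proof -
  note D = point_facts(2,3,4)[OF x]
  interpret binoid_set_pair "sec \<O> (D x)" "sec F (D x)" "sec G (D x)" using D by (intro pair)
  obtain h where h: "h \<in> pts G (D x)" "\<theta>' (D x) h = d x" using x by (rule generator)
  have *: "\<exists>p \<in> pts F (D x). B = cls (D x) p h \<and> pvalue (D x) B = d x \<otimes> \<theta> (D x) p"
    if B: "B \<in> pts P (D x)" for B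
  proof -
    obtain s t where st: "s \<in> pts F (D x)" "t \<in> pts G (D x)" "B = cls (D x) s t"
      using D(1,2) B by (rule presheaf_cases)
    have t: "\<theta>' (D x) t \<in> carrier K" "inv (d x) \<otimes> \<theta>' (D x) t \<in> R x"
      using value_mem[OF G D st(2)] point_facts(5)[OF x] by (simp_all add: cocycle_sections_def)
    obtain b where b: "b \<in> scalars (D x)" "ev (D x) b = inv (d x) \<otimes> \<theta>' (D x) t"
      using ev_surj[OF D(1,3), of "inv (d x) \<otimes> \<theta>' (D x) t"] t(2) R_mono[OF point_facts(1)[OF x]] by blast
    have "t = act (sec G (D x)) b h"
      using D b h st(2) t Units_cd[OF x]
      by (intro value_inj[OF G D]) (simp_all add: value_act[OF G] represents_act[OF G] m_comm[of _ "d x"] Units_cancel)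
    then have "B = cls (D x) (act (sec F (D x)) b s) h"
      unfolding st(3) using b h st by (simp add: smash_class_eqI[OF smash_rel.smash_balanced])
    moreover have "act (sec F (D x)) b s \<in> pts F (D x)" using b st by (simp add: S.act_closed)
    moreover from this have "pvalue (D x) (cls (D x) (act (sec F (D x)) b s) h) = \<theta> (D x) (act (sec F (D x)) b s) \<otimes> d x"
      using pvalue_cls[OF D _ h(1)] h(2) by simp
    ultimately show ?thesis
      using value_mem(2)[OF F D] Units_cd[OF x]
      by (intro bexI[of _ "act (sec F (D x)) b s"]) (simp_all add: m_comm)
  qed
  obtain p where p: "p \<in> pts F (D x)" "C = cls (D x) p h" "pvalue (D x) C = d x \<otimes> \<theta> (D x) p"
    using *[OF C(1)] by blast
  obtain q where q: "q \<in> pts F (D x)" "C' = cls (D x) q h" "pvalue (D x) C' = d x \<otimes> \<theta> (D x) q"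
    using *[OF C(2)] by blast
  have "\<theta> (D x) p = \<theta> (D x) q"
    using eq p q Units_cd[OF x] value_mem(2)[OF F D] by simp
  then have "p = q" by (rule value_inj[OF F D p(1) q(1)])
  then show ?thesis using p q by simp
qed

text \<open>The class of \<open>s\<close> and the generator \<open>h\<close> has value
  \<open>k\<close> when \<open>s\<close> has value \<open>inv (d x) \<otimes> k\<close>. The
  condition at \<open>x\<close> alone makes this a section over \<open>D x\<close>, because
  \<open>c x\<close> and \<open>c y\<close> differ by a unit of \<open>R y\<close> for
  \<open>y\<close> in \<open>D x\<close>.\<close>

lemma pvalue_surj:
  assumes x: "x \<in> U" and k: "k \<in> carrier K" "inv (c x \<otimes> d x) \<otimes> k \<in> R x"
  shows "\<exists>C \<in> pts P (D x). pvalue (D x) C = k"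
proof -
  note D = point_facts(2,3,4)[OF x]
  obtain h where h: "h \<in> pts G (D x)" "\<theta>' (D x) h = d x" using x by (rule generator)
  have u: "c x \<in> Units K" "d x \<in> Units K" using Units_cd x by auto
  have "inv (d x) \<otimes> k \<in> cocycle_sections c (D x)"
  proof -
    have "inv (c y) \<otimes> (inv (d x) \<otimes> k) \<in> R y" if y: "y \<in> D x" for y
    proof -
      have yU: "y \<in> U" "y \<in> topspace X" using y D topspaceI by auto
      have uy: "c y \<in> Units K" using Units_cd yU by auto
      have "c x \<otimes> inv (c y) \<in> R y" using c x y by (auto simp: cocycles_def unit_germs_def)
      moreover have "inv (c x \<otimes> d x) \<otimes> k \<in> R y" using k(2) R_mono[OF point_facts(1)[OF x] y] by blast
      ultimately have "(c x \<otimes> inv (c y)) \<otimes> (inv (c x \<otimes> d x) \<otimes> k) \<in> R y" using R_mult[OF yU(2)] by blast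
      moreover have "(c x \<otimes> inv (c y)) \<otimes> (inv (c x \<otimes> d x) \<otimes> k) =
          c x \<otimes> (inv (c x) \<otimes> (inv (c y) \<otimes> (inv (d x) \<otimes> k)))"
        using u uy k(1) by (simp add: inv_mult_Units m_ac)
      ultimately show ?thesis using u uy k(1) by (simp add: Units_cancel)
    qed
    then show ?thesis using k(1) u by (simp add: cocycle_sections_def)
  qed
  then obtain s where s: "s \<in> pts F (D x)" "\<theta> (D x) s = inv (d x) \<otimes> k"
    using value_surj[OF F D] by blast
  have "pvalue (D x) (cls (D x) s h) = d x \<otimes> (inv (d x) \<otimes> k)"
    using pvalue_cls[OF D s(1) h(1)] s h u k(1) by (simp add: m_comm)
  then show ?thesis using cls_mem[OF D(1,2) s(1) h(1)] u k(1) by (auto simp: Units_cancel)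
qed

text \<open>Two presheaf sections near \<open>x\<close> can both be restricted to
  \<open>D x\<close>, where the value determines the section. So a germ consists of all presheaf
  sections around \<open>x\<close> with a given value.\<close>

lemma germ_P:
  assumes V: "openin X V" "V \<subseteq> U" "x \<in> V" and C: "C \<in> pts P V"
  shows "pgerm x V C = {(V', C'). openin X V' \<and> V' \<subseteq> U \<and> x \<in> V' \<and>
    C' \<in> points (sec P V') \<and> pvalue V' C' = pvalue V C}"
proof (intro subset_antisym subsetI; clarify)
  fix V' C' assume "(V', C') \<in> pgerm x V C"
  then obtain W where W: "openin X V'" "V' \<subseteq> U" "x \<in> V'" "C' \<in> points (sec P V')"
    "openin X W" "x \<in> W" "W \<subseteq> V" "W \<subseteq> V'" "res P V W C = res P V' W C'"
    using U by (auto simp: germ_def openin_sub)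
  have ne: "W \<noteq> {}" using W by blast
  have "pvalue V' C' = pvalue V C"
    using presheaf_res(2)[OF V(1) W(5,7) V(2) C ne] presheaf_res(2)[OF W(1,5,8,2,4) ne] W(9) by simp
  then show "openin X V' \<and> V' \<subseteq> U \<and> x \<in> V' \<and>
    C' \<in> points (sec P V') \<and> pvalue V' C' = pvalue V C" using W by simp
next
  fix V' C' assume W: "openin X V'" "V' \<subseteq> U" "x \<in> V'" "C' \<in> points (sec P V')"
    and eq: "pvalue V' C' = pvalue V C"
  have x: "x \<in> U" using V by blast
  note D = point_facts(2-5)[OF x]
  have sub: "D x \<subseteq> V" "D x \<subseteq> V'" using D_least V W by auto
  note rV = presheaf_res[OF V(1) D(1) sub(1) V(2) C] and rW = presheaf_res[OF W(1) D(1) sub(2) W(2,4)]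
  have "res P V (D x) C = res P V' (D x) C'"
    using rV(1) rW(1) rV(2)[OF D(3)] rW(2)[OF D(3)] eq by (intro pvalue_inj[OF x]) simp_all
  then show "(V', C') \<in> pgerm x V C"
    unfolding germ_def using W D sub U by (auto simp: openin_sub)
qed

definition germ_value where
  "germ_value g = the_elem ((\<lambda>(V, C). pvalue V C) ` g)"

lemma germ_mem:
  assumes "openin X V" "V \<subseteq> U" "x \<in> V" "C \<in> pts P V"
  shows "(V, C) \<in> pgerm x V C"
  using assms by (simp add: germ_P)

lemma germ_value_germ:
  assumes V: "openin X V" "V \<subseteq> U" "x \<in> V" and C: "C \<in> pts P V"
  shows "germ_value (pgerm x V C) = pvalue V C"
  unfolding germ_value_def
proof (rule the_elem_image_unique)
  show "pgerm x V C \<noteq> {}" using germ_mem[OF assms] by blast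
  fix g assume "g \<in> pgerm x V C"
  then show "(case g of (V, C) \<Rightarrow> pvalue V C) = pvalue V C"
    by (auto simp: germ_P[OF assms])
qed

lemma germ_eqI:
  assumes "openin X V" "V \<subseteq> U" "x \<in> V" "C \<in> pts P V"
    and "openin X V'" "V' \<subseteq> U" "x \<in> V'" "C' \<in> points (sec P V')"
    and "pvalue V C = pvalue V' C'"
  shows "pgerm x V C = pgerm x V' C'"
  using assms by (simp add: germ_P)

abbreviation "Q \<equiv> smash_sheaf (on U) \<O> F G"

text \<open>A neighbourhood of \<open>x\<close> on which a section comes from the presheaf can
  always be shrunk to \<open>D x\<close>, so no choice of neighbourhood remains.\<close>

lemma smash_sheaf_points_iff:
  assumes V: "openin X V" "V \<subseteq> U"
  shows "\<sigma> \<in> pts Q V \<longleftrightarrow> \<sigma> \<in> extensional V \<and>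
    (\<forall>x \<in> V. \<exists>C \<in> pts P (D x). \<forall>y \<in> D x. \<sigma> y = pgerm y (D x) C)"
    (is "_ \<longleftrightarrow> ?rhs")
proof
  assume \<sigma>: "\<sigma> \<in> pts Q V"
  have "\<exists>C \<in> pts P (D x). \<forall>y \<in> D x. \<sigma> y = pgerm y (D x) C" if x: "x \<in> V" for x
  proof -
    have "\<exists>W. openin (on U) W \<and> x \<in> W \<and> W \<subseteq> V \<and>
        (\<exists>s \<in> pts P W. \<forall>y \<in> W. \<sigma> y = pgerm y W s)"
      using \<sigma> x by (simp add: smash_sheaf_def sheafify_def)
    then obtain W C where W: "openin X W" "x \<in> W" "W \<subseteq> V" and C: "C \<in> pts P W"
      "\<And>y. y \<in> W \<Longrightarrow> \<sigma> y = pgerm y W C"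
      using U by (auto simp: openin_sub)
    have xU: "x \<in> U" and WU: "W \<subseteq> U" using x V W by auto
    note D = point_facts(2-4)[OF xU]
    have DW: "D x \<subseteq> W" using D_least W by blast
    note r = presheaf_res[OF W(1) D(1) DW WU C(1)]
    have "\<sigma> y = pgerm y (D x) (res P W (D x) C)" if "y \<in> D x" for y
    proof -
      have y: "y \<in> W" using that DW by blast
      have "pgerm y W C = pgerm y (D x) (res P W (D x) C)"
        using W(1) WU y C(1) D(1,2) that r(1) r(2)[OF D(3)] by (intro germ_eqI) simp_all
      then show ?thesis using C(2)[OF y] by simp
    qed
    then show ?thesis using r(1) by blast
  qed
  moreover have "\<sigma> \<in> extensional V" using \<sigma> by (simp add: smash_sheaf_def sheafify_def PiE_def)
  ultimately show ?rhs by blast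
next
  assume \<sigma>: ?rhs
  have "\<sigma> x \<in> stalk (on U) P x \<and> (\<exists>W. openin (on U) W \<and> x \<in> W \<and> W \<subseteq> V \<and>
        (\<exists>s \<in> pts P W. \<forall>y \<in> W. \<sigma> y = pgerm y W s))" if x: "x \<in> V" for x
  proof -
    have xU: "x \<in> U" using x V by blast
    note D = point_facts(2-5)[OF xU]
    obtain C where C: "C \<in> pts P (D x)" "\<forall>y \<in> D x. \<sigma> y = pgerm y (D x) C"
      using \<sigma> x by blast
    have o: "openin (on U) (D x)" using D U by (simp add: openin_sub)
    have "\<sigma> x \<in> stalk (on U) P x"
      unfolding stalk_def using C D o by blast
    then show ?thesis using o C D D_least[OF V(1) x] by blast
  qed
  then show "\<sigma> \<in> pts Q V"
    using \<sigma> by (simp add: smash_sheaf_def sheafify_def PiE_def Pi_def)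
qed

text \<open>The action on the sheafification is a union over all representatives of the germ whose
  domain lies in \<open>V\<close>. They have the same value, hence so do their multiples by
  \<open>a\<close>, and all members of the union are the same germ.\<close>

lemma smash_sheaf_act_germ:
  assumes V: "openin X V" "V \<subseteq> U" and W: "openin X W" "W \<subseteq> V" "y \<in> W" and C: "C \<in> pts P W"
    and \<sigma>: "\<sigma> y = pgerm y W C" and a: "a \<in> scalars V"
  shows "act (sec Q V) a \<sigma> y = pgerm y W (act (sec P W) (res \<O> V W a) C)"
proof -
  let ?I = "{(W', C') \<in> \<sigma> y. W' \<subseteq> V}"
  let ?h = "\<lambda>(W', C'). pgerm y W' (act (sec P W') (res \<O> V W' a) C')"
  have WU: "W \<subseteq> U" "y \<in> V" using W V by auto
  have "?h (W', C') = ?h (W, C)" if "(W', C') \<in> ?I" for W' C'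
  proof -
    have W': "openin X W'" "W' \<subseteq> U" "y \<in> W'" "C' \<in> points (sec P W')" "W' \<subseteq> V"
      "pvalue W' C' = pvalue W C"
      using that by (auto simp: \<sigma> germ_P[OF W(1) WU(1) W(3) C])
    have ne: "W \<noteq> {}" "W' \<noteq> {}" using W W' by auto
    have r: "res \<O> V W a \<in> scalars W" "res \<O> V W' a \<in> carrier (sec \<O> W')"
      using V W W' a by (simp_all add: O_res_closed)
    show ?thesis
      using W WU W' C ne r V a by (simp add: presheaf_act ev_res germ_eqI)
  qed
  then have "(\<Union>x \<in> ?I. ?h x) = (\<Union>x \<in> ?I. ?h (W, C))" by (intro SUP_cong) auto
  moreover have "?I \<noteq> {}" using germ_mem[OF W(1) WU(1) W(3) C] \<sigma> W(2) by auto
  ultimately have "(\<Union>x \<in> ?I. ?h x) = ?h (W, C)" by (simp only: UN_constant if_False)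
  then show ?thesis using WU(2) by (simp add: smash_sheaf_def sheafify_def)
qed

text \<open>The value of a section is the value of its germ at \<eta>. The presheaf has the right
  values on each \<open>D x\<close>; sheafification supplies the sections over larger
  \<open>V\<close> that are given by different presheaf sections of the same value.\<close>

lemma represents_smash_sheaf: "represents U Q (\<lambda>x. c x \<otimes> d x) (\<lambda>V \<sigma>. germ_value (\<sigma> \<eta>))"
proof (rule representsI)
  show "\<exists>z. pts Q {} = {z}"
    by (simp add: smash_sheaf_def sheafify_def)
next
  fix V assume V: "openin X V" "V \<subseteq> U"
  have Q_basept: "basept (sec Q V) = (\<lambda>x \<in> V. pgerm x V (basept (sec P V)))"
    by (simp add: smash_sheaf_def sheafify_def)
  have Dx: "D x \<subseteq> V" "x \<in> U" if "x \<in> V" for x using D_least V that by auto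
  show "basept (sec Q V) \<in> pts Q V"
    unfolding smash_sheaf_points_iff[OF V]
  proof (intro conjI ballI)
    show "basept (sec Q V) \<in> extensional V" unfolding Q_basept by simp
    fix x assume x: "x \<in> V"
    note D = point_facts(2-5)[OF Dx(2)[OF x]]
    have "basept (sec Q V) y = pgerm y (D x) (basept (sec P (D x)))" if "y \<in> D x" for y
    proof -
      have "y \<in> V" using Dx[OF x] that by blast
      moreover have "V \<noteq> {}" using x by blast
      ultimately show ?thesis using V D that
        by (simp add: Q_basept presheaf_basept germ_eqI[of V y _ "D x"])
    qed
    then show "\<exists>C \<in> pts P (D x). \<forall>y \<in> D x. basept (sec Q V) y = pgerm y (D x) C"
      using presheaf_basept(1)[OF D(1,2)] by blast
  qed
  fix a \<sigma> assume a: "a \<in> scalars V" and \<sigma>: "\<sigma> \<in> pts Q V"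
  show "act (sec Q V) a \<sigma> \<in> pts Q V"
    unfolding smash_sheaf_points_iff[OF V]
  proof (intro conjI ballI)
    show "act (sec Q V) a \<sigma> \<in> extensional V" by (simp add: smash_sheaf_def sheafify_def)
    fix x assume x: "x \<in> V"
    note D = point_facts(2-5)[OF Dx(2)[OF x]]
    obtain C where C: "C \<in> pts P (D x)" "\<forall>y \<in> D x. \<sigma> y = pgerm y (D x) C"
      using \<sigma> x unfolding smash_sheaf_points_iff[OF V] by blast
    have "act (sec Q V) a \<sigma> y = pgerm y (D x) (act (sec P (D x)) (res \<O> V (D x) a) C)"
      if "y \<in> D x" for y
      using C that by (intro smash_sheaf_act_germ[OF V D(1) Dx(1)[OF x] that C(1) _ a]) simp
    moreover have "act (sec P (D x)) (res \<O> V (D x) a) C \<in> pts P (D x)"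
      using V D Dx[OF x] a C(1) by (intro presheaf_act O_res_closed)
    ultimately show "\<exists>C \<in> pts P (D x). \<forall>y \<in> D x.
        act (sec Q V) a \<sigma> y = pgerm y (D x) C" by blast
  qed
next
  fix V W \<sigma> assume V: "openin X V" "openin X W" "W \<subseteq> V" "V \<subseteq> U" and \<sigma>: "\<sigma> \<in> pts Q V"
  have WU: "W \<subseteq> U" using V by blast
  have eq: "res Q V W \<sigma> = restrict \<sigma> W" by (simp add: smash_sheaf_def sheafify_def)
  show "res Q V W \<sigma> \<in> pts Q W"
    unfolding eq smash_sheaf_points_iff[OF V(2) WU]
  proof (intro conjI ballI)
    fix x assume x: "x \<in> W"
    then obtain C where C: "C \<in> pts P (D x)" "\<forall>y \<in> D x. \<sigma> y = pgerm y (D x) C"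
      using \<sigma> V(3) unfolding smash_sheaf_points_iff[OF V(1,4)] by blast
    have "D x \<subseteq> W" using D_least V x by blast
    then show "\<exists>C \<in> pts P (D x). \<forall>y \<in> D x. restrict \<sigma> W y = pgerm y (D x) C"
      using C by (intro bexI[of _ C]) auto
  qed simp
  assume "W \<noteq> {}"
  then have "\<eta> \<in> W" using generic_mem V by blast
  then show "germ_value (res Q V W \<sigma> \<eta>) = germ_value (\<sigma> \<eta>)" by (simp add: eq)
next
  fix V assume V: "openin X V" "V \<subseteq> U" "V \<noteq> {}"
  have \<eta>: "\<eta> \<in> V" using generic_mem V by blast
  have Dx: "D x \<subseteq> V" "x \<in> U" if "x \<in> V" for x using D_least V that by auto
  have loc: "\<exists>C \<in> pts P (D x). (\<forall>y \<in> D x. \<sigma> y = pgerm y (D x) C) \<and>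
      pvalue (D x) C = germ_value (\<sigma> \<eta>)"
    if \<sigma>: "\<sigma> \<in> pts Q V" and x: "x \<in> V" for \<sigma> x
  proof -
    note D = point_facts(2-6)[OF Dx(2)[OF x]]
    obtain C where C: "C \<in> pts P (D x)" "\<forall>y \<in> D x. \<sigma> y = pgerm y (D x) C"
      using \<sigma> x unfolding smash_sheaf_points_iff[OF V(1,2)] by blast
    then have "germ_value (\<sigma> \<eta>) = pvalue (D x) C" using D by (simp add: germ_value_germ)
    then show ?thesis using C by (intro bexI[of _ C]) simp_all
  qed
  show "germ_value (basept (sec Q V) \<eta>) = absorb K"
    using V \<eta> presheaf_basept[OF V(1,2)] by (simp add: smash_sheaf_def sheafify_def germ_value_germ)
  show "germ_value (act (sec Q V) a \<sigma> \<eta>) = ev V a \<otimes> germ_value (\<sigma> \<eta>)"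
    if a: "a \<in> scalars V" and \<sigma>: "\<sigma> \<in> pts Q V" for a \<sigma>
  proof -
    note D = point_facts(2-6)[OF Dx(2)[OF \<eta>]]
    obtain C where C: "C \<in> pts P (D \<eta>)" "\<forall>y \<in> D \<eta>. \<sigma> y = pgerm y (D \<eta>) C"
      "pvalue (D \<eta>) C = germ_value (\<sigma> \<eta>)"
      using loc[OF \<sigma> \<eta>] by blast
    have "act (sec Q V) a \<sigma> \<eta> = pgerm \<eta> (D \<eta>) (act (sec P (D \<eta>)) (res \<O> V (D \<eta>) a) C)"
      using C D by (intro smash_sheaf_act_germ[OF V(1,2) D(1) Dx(1)[OF \<eta>] _ C(1) _ a]) simp_all
    moreover have ra: "res \<O> V (D \<eta>) a \<in> scalars (D \<eta>)"
      using V D Dx[OF \<eta>] a by (intro O_res_closed)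
    ultimately show ?thesis
      using V D Dx[OF \<eta>] a C(1,3) presheaf_act[OF D(1,2) ra C(1)]
      by (simp add: germ_value_germ ev_res)
  qed
  show "bij_betw (\<lambda>\<sigma>. germ_value (\<sigma> \<eta>)) (pts Q V) (cocycle_sections (\<lambda>x. c x \<otimes> d x) V)"
    unfolding bij_betw_def
  proof
    show "inj_on (\<lambda>\<sigma>. germ_value (\<sigma> \<eta>)) (pts Q V)"
    proof (rule inj_onI)
      fix \<sigma> \<tau> assume \<sigma>: "\<sigma> \<in> pts Q V" and \<tau>: "\<tau> \<in> pts Q V"
        and eq: "germ_value (\<sigma> \<eta>) = germ_value (\<tau> \<eta>)"
      have "\<sigma> \<in> extensional V" "\<tau> \<in> extensional V"
        using \<sigma> \<tau> unfolding smash_sheaf_points_iff[OF V(1,2)] by auto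
      moreover have "\<sigma> x = \<tau> x" if x: "x \<in> V" for x
      proof -
        note D = point_facts(2-6)[OF Dx(2)[OF x]]
        obtain A where A: "A \<in> pts P (D x)" "\<forall>y \<in> D x. \<sigma> y = pgerm y (D x) A"
          "pvalue (D x) A = germ_value (\<sigma> \<eta>)" using loc[OF \<sigma> x] by blast
        obtain B where B: "B \<in> pts P (D x)" "\<forall>y \<in> D x. \<tau> y = pgerm y (D x) B"
          "pvalue (D x) B = germ_value (\<tau> \<eta>)" using loc[OF \<tau> x] by blast
        have "A = B" using A(3) B(3) eq by (intro pvalue_inj[OF Dx(2)[OF x] A(1) B(1)]) simp
        then show ?thesis using A(2) B(2) D by simp
      qed
      ultimately show "\<sigma> = \<tau>" by (rule extensionalityI)
    qed
    have "germ_value (\<sigma> \<eta>) \<in> cocycle_sections (\<lambda>x. c x \<otimes> d x) V" if \<sigma>: "\<sigma> \<in> pts Q V" for \<sigma>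
    proof -
      have "germ_value (\<sigma> \<eta>) \<in> carrier K \<and> inv (c x \<otimes> d x) \<otimes> germ_value (\<sigma> \<eta>) \<in> R x" if x: "x \<in> V" for x
      proof -
        note D = point_facts(2-6)[OF Dx(2)[OF x]]
        obtain C where C: "C \<in> pts P (D x)" "pvalue (D x) C = germ_value (\<sigma> \<eta>)"
          using loc[OF \<sigma> x] by blast
        show ?thesis using pvalue_germ[OF D(1,2,4) C(1)] C(2) by simp
      qed
      then show ?thesis using \<eta> by (auto simp: cocycle_sections_def)
    qed
    moreover have "k \<in> (\<lambda>\<sigma>. germ_value (\<sigma> \<eta>)) ` pts Q V"
      if k: "k \<in> cocycle_sections (\<lambda>x. c x \<otimes> d x) V" for k
    proof -
      have "\<exists>C. C \<in> pts P (D x) \<and> pvalue (D x) C = k" if "x \<in> V" for x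
        using pvalue_surj[OF Dx(2)[OF that]] k that by (auto simp: cocycle_sections_def)
      then obtain C where C: "\<And>x. x \<in> V \<Longrightarrow> C x \<in> pts P (D x)"
        "\<And>x. x \<in> V \<Longrightarrow> pvalue (D x) (C x) = k" by metis
      \<comment> \<open>The presheaf sections on the various \<open>D x\<close> all have value
        \<open>k\<close>, so at a common point they define the same germ.\<close>
      define \<sigma> where "\<sigma> = (\<lambda>x \<in> V. pgerm x (D x) (C x))"
      have "\<sigma> \<in> pts Q V"
        unfolding smash_sheaf_points_iff[OF V(1,2)]
      proof (intro conjI ballI bexI)
        show "\<sigma> \<in> extensional V" by (simp add: \<sigma>_def)
        fix x y assume x: "x \<in> V" and y: "y \<in> D x"
        note D = point_facts(2-6)[OF Dx(2)[OF x]]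
        have yV: "y \<in> V" using Dx[OF x] y by blast
        show "\<sigma> y = pgerm y (D x) (C x)"
          using germ_eqI[OF point_facts(2,3,5)[OF Dx(2)[OF yV]] C(1)[OF yV] D(1,2) y C(1)[OF x]] yV C(2) x
          by (simp add: \<sigma>_def)
      qed (rule C(1))
      moreover have "germ_value (\<sigma> \<eta>) = k"
        using germ_value_germ[OF point_facts(2,3,5)[OF Dx(2)[OF \<eta>]] C(1)[OF \<eta>]] C(2)[OF \<eta>] \<eta>
        by (simp add: \<sigma>_def)
      ultimately show ?thesis by blast
    qed
    ultimately show "(\<lambda>\<sigma>. germ_value (\<sigma> \<eta>)) ` pts Q V = cocycle_sections (\<lambda>x. c x \<otimes> d x) V" by blast
  qed
qed

end


section \<open>The Picard group as a group of cocycle classes\<close>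

context generic_binoid_space
begin

lemma cocycles_subset: "U' \<subseteq> U \<Longrightarrow> cocycles U \<subseteq> cocycles U'"
  by (auto simp: cocycles_def)

lemma
  assumes U: "openin X U"
  shows cocycles_one: "(\<lambda>_. \<one>) \<in> cocycles U"
    and cocycles_mult: "\<lbrakk>c \<in> cocycles U; d \<in> cocycles U\<rbrakk> \<Longrightarrow> (\<lambda>x. c x \<otimes> d x) \<in> cocycles U"
    and cocycles_inv: "c \<in> cocycles U \<Longrightarrow> (\<lambda>x. inv (c x)) \<in> cocycles U"
proof -
  have D: "y \<in> U" "y \<in> topspace X" if "x \<in> U" "y \<in> D x" for x y
    using D_least[OF U that(1)] that(2) topspaceI[OF U] by blast+
  show "(\<lambda>_. \<one>) \<in> cocycles U"
    using D by (auto simp: cocycles_def unit_germs_one)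
  show "(\<lambda>x. c x \<otimes> d x) \<in> cocycles U" if c: "c \<in> cocycles U" and d: "d \<in> cocycles U"
    unfolding cocycles_def
  proof (intro CollectI conjI ballI Pi_I)
    fix x y assume x: "x \<in> U" and y: "y \<in> D x"
    note Units = cocycles_Units[OF c x] cocycles_Units[OF d x]
      cocycles_Units[OF c D(1)[OF x y]] cocycles_Units[OF d D(1)[OF x y]]
    have "(c x \<otimes> d x) \<otimes> inv (c y \<otimes> d y) = (c x \<otimes> inv (c y)) \<otimes> (d x \<otimes> inv (d y))"
      using Units by (simp add: inv_mult_Units m_ac)
    also have "\<dots> \<in> unit_germs y"
      by (rule unit_germs_mult[OF D(2)[OF x y]]) (use c d x y in \<open>simp_all add: cocycles_def\<close>)
    finally show "(c x \<otimes> d x) \<otimes> inv (c y \<otimes> d y) \<in> unit_germs y" .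
  qed (use cocycles_Units[OF c] cocycles_Units[OF d] in simp)
  show "(\<lambda>x. inv (c x)) \<in> cocycles U" if c: "c \<in> cocycles U"
    unfolding cocycles_def
  proof (intro CollectI conjI ballI Pi_I)
    fix x y assume x: "x \<in> U" and y: "y \<in> D x"
    have "c x \<otimes> inv (c y) \<in> unit_germs y" using c x y by (auto simp: cocycles_def)
    from unit_germs_inv[OF this] show "inv (c x) \<otimes> inv (inv (c y)) \<in> unit_germs y"
      using cocycles_Units[OF c x] cocycles_Units[OF c D(1)[OF x y]] by (simp add: inv_mult_Units)
  qed (use cocycles_Units[OF c] in simp)
qed

abbreviation "pic U \<equiv> picard (on U) \<O>"

text \<open>For a cocycle on an open \<open>U\<close> this is a full isomorphism class, since
  sheaves with the same cocycle are isomorphic. Naming it by \<open>c\<close> avoids the choice of a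
  sheaf in it.\<close>

definition picard_class :: "'x set \<Rightarrow> ('x \<Rightarrow> 'a) \<Rightarrow> ('x, 'r, ('r, 'r) bset) presheaf set" where
  "picard_class U c = {F. invertible_oset (on U) \<O> F \<and> (\<exists>\<theta>. represents U F c \<theta>)}"

lemma picard_class_nonempty:
  assumes "openin X U" "c \<in> cocycles U"
  obtains F \<theta> where "F \<in> picard_class U c" "represents U F c \<theta>"
  using represents_exists[OF assms] represents_invertible assms unfolding picard_class_def by blast

lemma picard_class_mono:
  assumes U: "openin X U" and c: "c \<in> cocycles U" and d: "d \<in> cocycles U"
    and \<gamma>: "\<gamma> \<in> Units K" "\<And>x. x \<in> U \<Longrightarrow> c x \<otimes> inv (d x) \<otimes> \<gamma> \<in> unit_germs x"
  shows "picard_class U c \<subseteq> picard_class U d"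
proof -
  have "\<exists>\<theta>'. represents U F d \<theta>'" if "represents U F c \<theta>" for F :: "('x, 'r, ('r, 'r) bset) presheaf" and \<theta>
    using represents_twist[OF that U _ _ \<gamma>] cocycles_Units[OF c] cocycles_Units[OF d] by blast
  then show ?thesis unfolding picard_class_def by blast
qed

text \<open>This is linear equivalence of divisors, \<gamma> being the principal part. From left to
  right a sheaf in the common class has both cocycles and uniqueness applies; from right to left
  \<gamma> gives one inclusion and its inverse the other.\<close>

lemma picard_class_eq_iff:
  assumes U: "openin X U" and c: "c \<in> cocycles U" and d: "d \<in> cocycles U"
  shows "picard_class U c = picard_class U d \<longleftrightarrow>
    (\<exists>\<gamma> \<in> Units K. \<forall>x \<in> U. c x \<otimes> inv (d x) \<otimes> \<gamma> \<in> unit_germs x)"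
proof
  assume eq: "picard_class U c = picard_class U d"
  obtain F \<theta> where F: "F \<in> picard_class U c" "represents U F c \<theta>" using U c by (rule picard_class_nonempty)
  then obtain \<theta>' where "represents U F d \<theta>'" using eq by (auto simp: picard_class_def)
  then show "\<exists>\<gamma> \<in> Units K. \<forall>x \<in> U. c x \<otimes> inv (d x) \<otimes> \<gamma> \<in> unit_germs x"
    by (rule represents_unique[OF F(2) _ U c d])
next
  assume "\<exists>\<gamma> \<in> Units K. \<forall>x \<in> U. c x \<otimes> inv (d x) \<otimes> \<gamma> \<in> unit_germs x"
  then obtain \<gamma> where \<gamma>: "\<gamma> \<in> Units K" "\<And>x. x \<in> U \<Longrightarrow> c x \<otimes> inv (d x) \<otimes> \<gamma> \<in> unit_germs x" by blast
  have "d x \<otimes> inv (c x) \<otimes> inv \<gamma> \<in> unit_germs x" if x: "x \<in> U" for x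
  proof -
    have "inv (c x \<otimes> inv (d x) \<otimes> \<gamma>) = d x \<otimes> inv (c x) \<otimes> inv \<gamma>"
      using cocycles_Units[OF c x] cocycles_Units[OF d x] \<gamma>(1) by (simp add: inv_mult_Units m_ac)
    then show ?thesis using unit_germs_inv[OF \<gamma>(2)[OF x]] by simp
  qed
  then show "picard_class U c = picard_class U d"
    using picard_class_mono[OF U c d \<gamma>] picard_class_mono[OF U d c Units_inv_Units[OF \<gamma>(1)]] by blast
qed

lemma picard_class_cong:
  assumes U: "openin X U" and c: "c \<in> cocycles U" and d: "d \<in> cocycles U"
    and eq: "\<And>x. x \<in> U \<Longrightarrow> c x = d x"
  shows "picard_class U c = picard_class U d"
  unfolding picard_class_eq_iff[OF U c d]
  by (intro bexI[of _ \<one>] ballI)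
    (simp_all add: eq cocycles_Units[OF d] unit_germs_one[OF topspaceI[OF U]])

lemma invertible_iso_rel_picard_class:
  assumes U: "openin X U" and F: "F \<in> picard_class U c"
  shows "invertible_iso_rel (on U) \<O> `` {F} = picard_class U c"
proof -
  obtain \<theta> where inv: "invertible_oset (on U) \<O> F" and r: "represents U F c \<theta>"
    using F by (auto simp: picard_class_def)
  have "oset_isomorphic (on U) \<O> F G \<longleftrightarrow> (\<exists>\<theta>'. represents U G c \<theta>')"
    if G: "invertible_oset (on U) \<O> G" for G :: "('x, 'r, ('r, 'r) bset) presheaf"
  proof
    assume "oset_isomorphic (on U) \<O> F G"
    then have "oset_isomorphic (on U) \<O> G F"
      using inv by (intro oset_isomorphic_sym[of _ _ F G]) (simp_all add: invertible_oset_def)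
    then show "\<exists>\<theta>'. represents U G c \<theta>'"
      using G by (intro represents_transfer[OF _ U _ r]) (simp_all add: invertible_oset_def)
  next
    assume "\<exists>\<theta>'. represents U G c \<theta>'"
    then show "oset_isomorphic (on U) \<O> F G"
      using represents_isomorphic[OF r _ U] by blast
  qed
  then show ?thesis using inv by (auto simp: invertible_iso_rel_def picard_class_def)
qed

lemma carrier_picard:
  assumes U: "openin X U"
  shows "carrier (pic U) = picard_class U ` cocycles U"
proof (intro subset_antisym subsetI)
  fix A assume "A \<in> carrier (pic U)"
  then obtain F where F: "invertible_oset (on U) \<O> F"
    "A = invertible_iso_rel (on U) \<O> `` {F}"
    by (auto simp: picard_def elim!: quotientE)
  obtain c \<theta> where c: "c \<in> cocycles U" "represents U F c \<theta>"
    using F(1) U by (rule invertible_represents)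
  then have "F \<in> picard_class U c" using F by (auto simp: picard_class_def)
  then show "A \<in> picard_class U ` cocycles U"
    using invertible_iso_rel_picard_class[OF U] F(2) c(1) by blast
next
  fix A assume "A \<in> picard_class U ` cocycles U"
  then obtain c where c: "c \<in> cocycles U" "A = picard_class U c" by blast
  obtain F \<theta> where F: "F \<in> picard_class U c" "represents U F c \<theta>" using U c(1) by (rule picard_class_nonempty)
  then have "invertible_oset (on U) \<O> F" by (simp add: picard_class_def)
  moreover have "A = invertible_iso_rel (on U) \<O> `` {F}"
    using invertible_iso_rel_picard_class[OF U F(1)] c(2) by simp
  ultimately show "A \<in> carrier (pic U)"
    by (simp add: picard_def quotientI)
qed

lemma one_picard:
  assumes U: "openin X U"
  shows "\<one>\<^bsub>pic U\<^esub> = picard_class U (\<lambda>_. \<one>)"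
proof -
  have "regular_oset \<O> \<in> picard_class U (\<lambda>_. \<one>)"
    using represents_invertible[OF represents_regular U cocycles_one[OF U]] represents_regular
    by (auto simp: picard_class_def)
  from invertible_iso_rel_picard_class[OF U this] show ?thesis by (simp add: picard_def)
qed

text \<open>Being isomorphic to the smash sheaf of members of the two classes amounts to having the
  product cocycle. For one direction a sheaf has to be picked in each factor, which is possible
  because every cocycle is represented by a sheaf with sections in \<open>'r\<close>.\<close>

lemma mult_picard:
  assumes U: "openin X U" and c: "c \<in> cocycles U" and d: "d \<in> cocycles U"
  shows "picard_class U c \<otimes>\<^bsub>pic U\<^esub> picard_class U d = picard_class U (\<lambda>x. c x \<otimes> d x)"
proof -
  have smash: "\<exists>\<tau>. represents U (smash_sheaf (on U) \<O> F G) (\<lambda>x. c x \<otimes> d x) \<tau>"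
    if "represents U F c \<theta>" "represents U G d \<theta>'"
    for F G :: "('x, 'r, ('r, 'r) bset) presheaf" and \<theta> \<theta>'
  proof -
    interpret represented_pair K X \<eta> D R \<O> ev U F G c d \<theta> \<theta>'
      by (intro represented_pair.intro represented_pair_axioms.intro generic_binoid_space_axioms U c d that)
    show ?thesis using represents_smash_sheaf by blast
  qed
  have "(\<exists>F \<in> picard_class U c. \<exists>G \<in> picard_class U d. oset_isomorphic (on U) \<O> H
      (smash_sheaf (on U) \<O> F G)) \<longleftrightarrow> (\<exists>\<theta>. represents U H (\<lambda>x. c x \<otimes> d x) \<theta>)"
    if H: "invertible_oset (on U) \<O> H" for H :: "('x, 'r, ('r, 'r) bset) presheaf"
  proof
    assume "\<exists>F \<in> picard_class U c. \<exists>G \<in> picard_class U d. oset_isomorphic (on U) \<O> H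
      (smash_sheaf (on U) \<O> F G)"
    then obtain F G :: "('x, 'r, ('r, 'r) bset) presheaf" and \<theta> \<theta>' where FG: "represents U F c \<theta>" "represents U G d \<theta>'"
      and iso: "oset_isomorphic (on U) \<O> H (smash_sheaf (on U) \<O> F G)"
      unfolding picard_class_def by blast
    show "\<exists>\<theta>. represents U H (\<lambda>x. c x \<otimes> d x) \<theta>"
      using H smash[OF FG] represents_transfer[OF _ U iso] by (auto simp: invertible_oset_def)
  next
    assume "\<exists>\<theta>. represents U H (\<lambda>x. c x \<otimes> d x) \<theta>"
    then obtain \<theta> where \<theta>: "represents U H (\<lambda>x. c x \<otimes> d x) \<theta>" by blast
    obtain F \<tau> where F: "F \<in> picard_class U c" "represents U F c \<tau>" using U c by (rule picard_class_nonempty)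
    obtain G \<tau>' where G: "G \<in> picard_class U d" "represents U G d \<tau>'" using U d by (rule picard_class_nonempty)
    show "\<exists>F \<in> picard_class U c. \<exists>G \<in> picard_class U d. oset_isomorphic (on U) \<O> H
      (smash_sheaf (on U) \<O> F G)"
      using represents_isomorphic[OF \<theta> _ U] smash[OF F(2) G(2)] F(1) G(1) by blast
  qed
  then show ?thesis unfolding picard_def picard_class_def[of U "\<lambda>x. c x \<otimes> d x"] by auto
qed

lemma group_picard:
  assumes U: "openin X U"
  shows "group (pic U)"
proof (rule groupI)
  note closed = cocycles_one[OF U] cocycles_mult[OF U] cocycles_inv[OF U]
  fix A assume "A \<in> carrier (pic U)"
  then obtain a where a: "a \<in> cocycles U" "A = picard_class U a" by (auto simp: carrier_picard[OF U])
  show "\<one>\<^bsub>pic U\<^esub> \<otimes>\<^bsub>pic U\<^esub> A = A"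
    unfolding one_picard[OF U] a(2) mult_picard[OF U closed(1) a(1)]
    by (rule picard_class_cong[OF U]) (use a(1) closed in \<open>simp_all add: cocycles_Units[OF a(1)]\<close>)
  have "picard_class U (\<lambda>x. inv (a x)) \<otimes>\<^bsub>pic U\<^esub> A = \<one>\<^bsub>pic U\<^esub>"
    unfolding one_picard[OF U] a(2) mult_picard[OF U closed(3)[OF a(1)] a(1)]
    by (rule picard_class_cong[OF U]) (use a(1) closed in \<open>simp_all add: cocycles_Units[OF a(1)]\<close>)
  then show "\<exists>B \<in> carrier (pic U).
      B \<otimes>\<^bsub>pic U\<^esub> A = \<one>\<^bsub>pic U\<^esub>"
    using a(1) closed by (auto simp: carrier_picard[OF U])
  fix B assume "B \<in> carrier (pic U)"
  then obtain b where b: "b \<in> cocycles U" "B = picard_class U b" by (auto simp: carrier_picard[OF U])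
  show "A \<otimes>\<^bsub>pic U\<^esub> B \<in> carrier (pic U)"
    using a b closed by (simp add: mult_picard[OF U] carrier_picard[OF U])
  fix C assume "C \<in> carrier (pic U)"
  then obtain c where c: "c \<in> cocycles U" "C = picard_class U c" by (auto simp: carrier_picard[OF U])
  have "picard_class U (\<lambda>x. a x \<otimes> b x \<otimes> c x) = picard_class U (\<lambda>x. a x \<otimes> (b x \<otimes> c x))"
    using a b c closed
    by (intro picard_class_cong[OF U])
      (simp_all add: cocycles_Units[OF a(1)] cocycles_Units[OF b(1)] cocycles_Units[OF c(1)] m_assoc)
  then show "A \<otimes>\<^bsub>pic U\<^esub> B \<otimes>\<^bsub>pic U\<^esub> C =
      A \<otimes>\<^bsub>pic U\<^esub> (B \<otimes>\<^bsub>pic U\<^esub> C)"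
    using a b c closed by (simp add: mult_picard[OF U])
next
  show "\<one>\<^bsub>pic U\<^esub> \<in> carrier (pic U)"
    using cocycles_one[OF U] by (simp add: one_picard[OF U] carrier_picard[OF U])
qed

text \<open>The hypothesis \<open>extend\<close> makes two cocycles on \<open>U\<close> equivalent
  over \<open>U'\<close> exactly when they are equivalent over \<open>U\<close>. One implication
  makes the map on classes well defined, the other makes it injective.\<close>

theorem picard_restriction:
  assumes U: "openin X U" and U': "openin X U'" and sub: "U' \<subseteq> U"
    and extend: "\<And>x u. \<lbrakk>x \<in> U; u \<in> Units K; \<And>y. \<lbrakk>y \<in> D x; y \<in> U'\<rbrakk> \<Longrightarrow> u \<in> unit_germs y\<rbrakk> \<Longrightarrow> u \<in> unit_germs x"
  shows "\<exists>\<phi>. group_hom (pic U) (pic U') \<phi> \<and>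
    inj_on \<phi> (carrier (pic U))"
proof -
  have coc: "c \<in> cocycles U'" if "c \<in> cocycles U" for c using cocycles_subset[OF sub] that by blast
  have iff: "picard_class U' c = picard_class U' d \<longleftrightarrow> picard_class U c = picard_class U d"
    if c: "c \<in> cocycles U" and d: "d \<in> cocycles U" for c d
  proof -
    have "c x \<otimes> inv (d x) \<otimes> \<gamma> \<in> unit_germs x"
      if \<gamma>: "\<gamma> \<in> Units K" "\<forall>x \<in> U'. c x \<otimes> inv (d x) \<otimes> \<gamma> \<in> unit_germs x" and x: "x \<in> U" for \<gamma> x
    proof (rule extend[OF x])
      show "c x \<otimes> inv (d x) \<otimes> \<gamma> \<in> Units K" using cocycles_Units c d x \<gamma> by simp
      fix y assume y: "y \<in> D x" "y \<in> U'"
      have Units: "c x \<in> Units K" "d x \<in> Units K" "c y \<in> Units K" "d y \<in> Units K"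
        using cocycles_Units c d x y sub by auto
      have top: "y \<in> topspace X" using y U' topspaceI by blast
      have g: "c x \<otimes> inv (c y) \<in> unit_germs y" "d x \<otimes> inv (d y) \<in> unit_germs y"
        "c y \<otimes> inv (d y) \<otimes> \<gamma> \<in> unit_germs y"
        using c d x y \<gamma> by (auto simp: cocycles_def)
      \<comment> \<open>The element at \<open>x\<close> is rewritten as the one at \<open>y\<close>,
        a unit by assumption, times the quotients of \<open>c\<close> and of \<open>d\<close>
        between \<open>x\<close> and \<open>y\<close>, units at \<open>y\<close> by the cocycle
        condition.\<close>
      have "c x \<otimes> inv (d x) \<otimes> \<gamma> = c y \<otimes> (inv (c y) \<otimes> (d y \<otimes> (inv (d y) \<otimes> (c x \<otimes> inv (d x) \<otimes> \<gamma>))))"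
        using Units \<gamma>(1) by (simp add: Units_cancel)
      also have "\<dots> = (c x \<otimes> inv (c y)) \<otimes> inv (d x \<otimes> inv (d y)) \<otimes> (c y \<otimes> inv (d y) \<otimes> \<gamma>)"
        using Units \<gamma>(1) by (simp add: inv_mult_Units m_ac)
      also have "\<dots> \<in> unit_germs y" by (rule unit_germs_mult[OF top unit_germs_mult[OF top g(1) unit_germs_inv[OF g(2)]] g(3)])
      finally show "c x \<otimes> inv (d x) \<otimes> \<gamma> \<in> unit_germs y" .
    qed
    then show ?thesis
      unfolding picard_class_eq_iff[OF U c d] picard_class_eq_iff[OF U' coc[OF c] coc[OF d]]
      using sub by blast
  qed
  \<comment> \<open>A class is a set of sheaves and does not name a cocycle; by \<open>iff\<close>
    any choice gives the same result.\<close>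
  define \<phi> where "\<phi> A = picard_class U' (SOME c. c \<in> cocycles U \<and> picard_class U c = A)" for A
  have \<phi>: "\<phi> (picard_class U c) = picard_class U' c" if c: "c \<in> cocycles U" for c
  proof -
    define d where "d = (SOME d. d \<in> cocycles U \<and> picard_class U d = picard_class U c)"
    have "d \<in> cocycles U \<and> picard_class U d = picard_class U c" unfolding d_def by (rule someI[of _ c]) (simp add: c)
    then have "picard_class U' d = picard_class U' c" using iff c by blast
    then show ?thesis by (simp add: \<phi>_def d_def)
  qed
  have "\<phi> \<in> hom (pic U) (pic U')"
  proof (rule homI)
    fix A assume "A \<in> carrier (pic U)"
    then obtain a where a: "a \<in> cocycles U" "A = picard_class U a" by (auto simp: carrier_picard[OF U])
    then show "\<phi> A \<in> carrier (pic U')" by (simp add: \<phi> carrier_picard[OF U'] coc)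
    fix B assume "B \<in> carrier (pic U)"
    then obtain b where b: "b \<in> cocycles U" "B = picard_class U b" by (auto simp: carrier_picard[OF U])
    show "\<phi> (A \<otimes>\<^bsub>pic U\<^esub> B) = \<phi> A \<otimes>\<^bsub>pic U'\<^esub> \<phi> B"
      using a b by (simp add: \<phi> coc mult_picard[OF U] mult_picard[OF U'] cocycles_mult[OF U])
  qed
  then have "group_hom (pic U) (pic U') \<phi>"
    using group_picard U U' by (simp add: group_hom_def group_hom_axioms_def)
  moreover have "inj_on \<phi> (carrier (pic U))"
    by (rule inj_onI) (auto simp: carrier_picard[OF U] \<phi> iff)
  ultimately show ?thesis by blast
qed

end


section \<open>The spectrum of a toric binoid\<close>

lemma (in binoid) binoid_localization:
  assumes S: "submonoid S M"
  shows "binoid (localization M S)"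
proof -
  interpret S: submonoid S M by fact
  let ?L = "localization M S"
  have cases: thesis if "x \<in> carrier ?L" "\<And>a s. \<lbrakk>a \<in> carrier M; s \<in> S; x = fraction M S a s\<rbrakk> \<Longrightarrow> thesis"
    for x thesis using that by (auto simp: localization_def)
  have mem: "fraction M S a s \<in> carrier ?L" if "a \<in> carrier M" "s \<in> S" for a s
    using that by (auto simp: localization_def)
  note SM = S.mem_carrier
  have one: "\<one>\<^bsub>?L\<^esub> = fraction M S \<one> \<one>" and abs: "absorb ?L = fraction M S (absorb M) \<one>"
    by (simp_all add: localization_def)
  show ?thesis
  proof (intro binoid.intro comm_monoidI binoid_axioms.intro)
    show "\<one>\<^bsub>?L\<^esub> \<in> carrier ?L" "absorb ?L \<in> carrier ?L"
      unfolding one abs by (intro mem one_closed absorb_closed S.one_closed)+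
    fix x assume x: "x \<in> carrier ?L"
    then obtain a s where a: "a \<in> carrier M" "s \<in> S" "x = fraction M S a s" by (rule cases)
    show "\<one>\<^bsub>?L\<^esub> \<otimes>\<^bsub>?L\<^esub> x = x"
      unfolding one a(3) using a SM by (simp add: fraction_mult[OF S])
    have "fraction M S (absorb M) s = fraction M S (absorb M) \<one>"
      using a SM S.one_closed absorb_closed absorb_left
      by (subst fraction_eq_iff[OF S]) (auto intro!: bexI[of _ \<one>])
    then show "x \<otimes>\<^bsub>?L\<^esub> absorb ?L = absorb ?L"
      unfolding abs a(3) using a SM by (simp add: fraction_mult[OF S] absorb_closed absorb_mult)
    fix y assume y: "y \<in> carrier ?L"
    then obtain b t where b: "b \<in> carrier M" "t \<in> S" "y = fraction M S b t" by (rule cases)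
    show "x \<otimes>\<^bsub>?L\<^esub> y \<in> carrier ?L"
      unfolding a(3) b(3) using a b by (simp add: fraction_mult[OF S] mem)
    show "x \<otimes>\<^bsub>?L\<^esub> y = y \<otimes>\<^bsub>?L\<^esub> x"
      unfolding a(3) b(3) using a b SM by (simp add: fraction_mult[OF S] m_comm)
    fix z assume z: "z \<in> carrier ?L"
    then obtain c r where c: "c \<in> carrier M" "r \<in> S" "z = fraction M S c r" by (rule cases)
    show "x \<otimes>\<^bsub>?L\<^esub> y \<otimes>\<^bsub>?L\<^esub> z = x \<otimes>\<^bsub>?L\<^esub> (y \<otimes>\<^bsub>?L\<^esub> z)"
      unfolding a(3) b(3) c(3) using a b c SM by (simp add: fraction_mult[OF S] m_assoc)
  qed
qed

context binoid
begin

lemma prime_ideal_mult_iff: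
  assumes "prime_ideal M p" "a \<in> carrier M" "b \<in> carrier M"
  shows "a \<otimes> b \<in> p \<longleftrightarrow> a \<in> p \<or> b \<in> p"
  using basic_open_mult[OF assms(2,3)] assms(1) by (auto simp: basic_open_def)

lemma prime_idealD:
  assumes "prime_ideal M p"
  shows "p \<subseteq> carrier M" "absorb M \<in> p" "\<one> \<notin> p" "submonoid (carrier M - p) M"
  using assms submonoid.one_closed[of "carrier M - p" M] by (auto simp: prime_ideal_def)

lemma topspace_Spec: "topspace (Spec M) = {p. prime_ideal M p}"
  using prime_idealD(3) by (auto simp: Spec_def basic_open_def)

lemma Spec_generization:
  assumes "openin (Spec M) V" "p \<in> V" "prime_ideal M q" "q \<subseteq> p"
  shows "q \<in> V"
  using assms by (auto simp: openin_Spec_iff basic_open_def)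

text \<open>The witness is the product of the elements of \<open>A\<close>: a prime ideal contains a
  product exactly when it contains a factor.\<close>

lemma finite_prime_avoidance:
  assumes "finite A" "A \<subseteq> carrier M"
  shows "\<exists>f \<in> carrier M. \<forall>p. prime_ideal M p \<longrightarrow> (f \<in> p \<longleftrightarrow> A \<inter> p \<noteq> {})"
  using assms
proof (induction A rule: finite_induct)
  case empty
  then show ?case using prime_idealD(3) by (auto intro!: bexI[of _ \<one>])
next
  case (insert b A)
  then obtain f where f: "f \<in> carrier M" "\<forall>p. prime_ideal M p \<longrightarrow> (f \<in> p \<longleftrightarrow> A \<inter> p \<noteq> {})" by auto
  then show ?case using insert.prems prime_ideal_mult_iff by (auto intro!: bexI[of _ "b \<otimes> f"])
qed

end

context toric_binoid
begin

text \<open>The set is \<open>basic_open M f\<close> for \<open>f\<close> the product of the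
  generators outside \<open>p\<close>: a prime that avoids \<open>f\<close> contains no generator
  other than those in \<open>p\<close>.\<close>

lemma openin_generizations:
  assumes p: "prime_ideal M p"
  shows "openin (Spec M) {q. prime_ideal M q \<and> q \<subseteq> p}"
proof -
  obtain B where B: "B \<subseteq> carrier M" "finite B"
    "\<forall>H. submonoid H M \<and> absorb M \<in> H \<and> B \<subseteq> H \<longrightarrow> H = carrier M"
    using finitely_generated unfolding finitely_generated_def by (elim exE conjE)
  obtain f where f: "f \<in> carrier M" "\<And>q. prime_ideal M q \<Longrightarrow> f \<in> q \<longleftrightarrow> (B - p) \<inter> q \<noteq> {}"
    using finite_prime_avoidance[of "B - p"] B by blast
  have "q \<subseteq> p" if q: "prime_ideal M q" "f \<notin> q" for q
  proof -
    \<comment> \<open>The inclusion of \<open>q\<close> in \<open>p\<close> has to be tested on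
      generators only: a product with a factor in \<open>p\<close> is in \<open>p\<close>, and a
      product of two elements outside \<open>q\<close> is outside \<open>q\<close>.\<close>
    let ?H = "{x \<in> carrier M. x \<in> p \<or> x \<notin> q}"
    have "submonoid ?H M"
      using prime_idealD(3)[OF q(1)] prime_ideal_mult_iff[OF q(1)] prime_ideal_mult_iff[OF p]
      by unfold_locales auto
    moreover have "absorb M \<in> ?H" using prime_idealD(2)[OF p] absorb_closed by simp
    moreover have "B \<subseteq> ?H" using f(2)[OF q(1)] q(2) B(1) by blast
    ultimately have "?H = carrier M" using B(3) by simp
    then show ?thesis using prime_idealD(1)[OF q(1)] by blast
  qed
  moreover have "f \<notin> q" if "prime_ideal M q" "q \<subseteq> p" for q using f(2)[OF that(1)] that(2) by blast
  ultimately have "{q. prime_ideal M q \<and> q \<subseteq> p} = basic_open M f" by (auto simp: basic_open_def)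
  then show ?thesis using openin_basic_open[OF f(1)] by simp
qed

section \<open>Integrality, cancellation and the binoid of fractions\<close>

abbreviation "N \<equiv> finite_part M"

lemma finite_part_submonoid: "submonoid N M"
  using integral by (simp add: integral_binoid_def)

lemma finite_part_iff: "a \<in> N \<longleftrightarrow> a \<in> carrier M \<and> a \<noteq> absorb M"
  by (simp add: finite_part_def)

lemma one_finite: "\<one> \<in> N"
  using finite_part_submonoid by (rule submonoid.one_closed)

lemma mult_finite_iff:
  assumes "a \<in> carrier M" "b \<in> carrier M"
  shows "a \<otimes> b \<in> N \<longleftrightarrow> a \<in> N \<and> b \<in> N"
  using assms submonoid.m_closed[OF finite_part_submonoid] by (auto simp: finite_part_iff absorb_mult absorb_left)

lemma finite_cancel:
  assumes "a \<in> N" "b \<in> carrier M" "c \<in> carrier M" "a \<otimes> b = a \<otimes> c"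
  shows "b = c"
proof (cases "a \<otimes> c = absorb M")
  case True
  then have "b = absorb M" "c = absorb M"
    using assms mult_finite_iff[of a b] mult_finite_iff[of a c] by (auto simp: finite_part_iff)
  then show ?thesis by simp
next
  case False
  then show ?thesis using assms cancellative unfolding cancellative_def finite_part_iff by blast
qed

text \<open>Finite elements cancel, so the auxiliary factor \<open>u\<close> disappears. The
  resulting equation does not mention \<open>S\<close>, which is why localizations at different
  primes embed into one another.\<close>

lemma fraction_eq_cross:
  assumes S: "submonoid S M" "S \<subseteq> N" and a: "a \<in> carrier M" "s \<in> S" "b \<in> carrier M" "t \<in> S"
  shows "fraction M S a s = fraction M S b t \<longleftrightarrow> a \<otimes> t = b \<otimes> s"
proof -
  have "s \<in> carrier M" "t \<in> carrier M" using a S finite_part_iff by blast+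
  then have closed: "a \<otimes> t \<in> carrier M" "b \<otimes> s \<in> carrier M" using a by simp_all
  have "(\<exists>u \<in> S. u \<otimes> (a \<otimes> t) = u \<otimes> (b \<otimes> s)) \<longleftrightarrow> a \<otimes> t = b \<otimes> s"
  proof
    assume "\<exists>u \<in> S. u \<otimes> (a \<otimes> t) = u \<otimes> (b \<otimes> s)"
    then show "a \<otimes> t = b \<otimes> s" using finite_cancel[OF _ closed] S(2) by blast
  next
    assume "a \<otimes> t = b \<otimes> s"
    then show "\<exists>u \<in> S. u \<otimes> (a \<otimes> t) = u \<otimes> (b \<otimes> s)"
      by (intro bexI[OF _ submonoid.one_closed[OF S(1)]]) simp
  qed
  then show ?thesis using fraction_eq_iff[OF S(1) a] by simp
qed

lemma generic_prime: "prime_ideal M {absorb M}"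
  using finite_part_submonoid absorb_closed absorb_left by (auto simp: prime_ideal_def finite_part_def)

lemma prime_compl_finite: "prime_ideal M p \<Longrightarrow> carrier M - p \<subseteq> N"
  using prime_idealD(2) by (auto simp: finite_part_iff)

text \<open>Everything except the absorbing element is invertible here: it is the difference group
  with an absorbing element adjoined, and also the localization at the generic prime
  \<open>{absorb M}\<close>.\<close>

definition fractions :: "('a \<times> 'a) set binoid" where
  "fractions = localization M N"

abbreviation frac :: "'a \<Rightarrow> 'a \<Rightarrow> ('a \<times> 'a) set" where
  "frac \<equiv> fraction M N"

abbreviation fmult (infixl "\<cdot>" 70) where
  "x \<cdot> y \<equiv> x \<otimes>\<^bsub>fractions\<^esub> y"

sublocale K: binoid fractions
  unfolding fractions_def using finite_part_submonoid by (rule binoid_localization)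

lemmas frac_eq_iff = fraction_eq_cross[OF finite_part_submonoid subset_refl]

lemma frac_mult:
  "\<lbrakk>a \<in> carrier M; s \<in> N; b \<in> carrier M; t \<in> N\<rbrakk>
    \<Longrightarrow> frac a s \<cdot> frac b t = frac (a \<otimes> b) (s \<otimes> t)"
  unfolding fractions_def by (rule fraction_mult[OF finite_part_submonoid])

lemma frac_closed: "\<lbrakk>a \<in> carrier M; s \<in> N\<rbrakk> \<Longrightarrow> frac a s \<in> carrier fractions"
  by (auto simp: fractions_def localization_def)

lemma fractions_cases:
  assumes "x \<in> carrier fractions"
  obtains a s where "a \<in> carrier M" "s \<in> N" "x = frac a s"
  using assms by (auto simp: fractions_def localization_def)

lemma one_fractions: "\<one>\<^bsub>fractions\<^esub> = frac \<one> \<one>"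
  and absorb_fractions: "absorb fractions = frac (absorb M) \<one>"
  by (simp_all add: fractions_def localization_def)

lemma frac_inverse:
  assumes "a \<in> N" "s \<in> N"
  shows "frac a s \<cdot> frac s a = \<one>\<^bsub>fractions\<^esub>"
  using assms one_finite mult_finite_iff by (simp add: frac_mult one_fractions frac_eq_iff finite_part_iff m_comm)

lemma frac_Units:
  assumes "a \<in> N" "s \<in> N"
  shows "frac a s \<in> Units fractions"
  unfolding Units_def using assms frac_inverse[of a s] frac_inverse[of s a] frac_closed
  by (auto simp: finite_part_iff intro!: bexI[of _ "frac s a"])

lemma frac_inv:
  assumes "a \<in> N" "s \<in> N"
  shows "inv\<^bsub>fractions\<^esub> (frac a s) = frac s a"
  using assms K.Units_l_inv[OF frac_Units[OF assms]] frac_inverse[OF assms] frac_closed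
  by (intro K.inv_unique[of "inv\<^bsub>fractions\<^esub> (frac a s)" "frac a s" "frac s a"])
    (simp_all add: frac_Units finite_part_iff)

lemma Units_fractions_cases:
  assumes u: "u \<in> Units fractions"
  obtains a s where "a \<in> N" "s \<in> N" "u = frac a s"
proof -
  obtain a s where a: "a \<in> carrier M" "s \<in> N" "u = frac a s"
    using K.Units_closed[OF u] by (rule fractions_cases)
  have "a \<noteq> absorb M"
  proof
    assume "a = absorb M"
    then have "u = absorb fractions"
      using a one_finite by (simp add: absorb_fractions frac_eq_iff finite_part_iff absorb_left)
    then have "\<one>\<^bsub>fractions\<^esub> = absorb fractions"
      using K.Units_l_inv[OF u] K.absorb_mult u by simp
    then show False
      using one_finite absorb_closed by (simp add: one_fractions absorb_fractions frac_eq_iff finite_part_iff)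
  qed
  then show thesis using a by (intro that) (simp_all add: finite_part_iff)
qed

text \<open>A copy of the localization at \<open>p\<close>: the classes are formed with all of
  \<open>N\<close> as denominators, so that the copies for different primes are subsets of the same
  binoid and can be compared.\<close>

definition stalk_fractions :: "'a set \<Rightarrow> ('a \<times> 'a) set set" where
  "stalk_fractions p = {frac a f | a f. a \<in> carrier M \<and> f \<in> carrier M - p}"

lemma stalk_fractions_submonoid:
  assumes p: "prime_ideal M p"
  shows "submonoid (stalk_fractions p) fractions"
proof
  note N = prime_compl_finite[OF p]
  show "stalk_fractions p \<subseteq> carrier fractions" using N frac_closed by (auto simp: stalk_fractions_def)
  show "\<one>\<^bsub>fractions\<^esub> \<in> stalk_fractions p"
    using prime_idealD(3)[OF p] by (auto simp: stalk_fractions_def one_fractions)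
  fix x y assume "x \<in> stalk_fractions p" "y \<in> stalk_fractions p"
  then obtain a f b g where xy: "a \<in> carrier M" "f \<in> carrier M - p" "b \<in> carrier M" "g \<in> carrier M - p"
    "x = frac a f" "y = frac b g" by (auto simp: stalk_fractions_def)
  moreover have "f \<in> N" "g \<in> N" using N xy by auto
  moreover have "f \<otimes> g \<in> carrier M - p" using xy prime_ideal_mult_iff[OF p] by simp
  ultimately have "x \<cdot> y = frac (a \<otimes> b) (f \<otimes> g)" "a \<otimes> b \<in> carrier M" "f \<otimes> g \<in> carrier M - p"
    by (simp_all add: frac_mult)
  then show "x \<cdot> y \<in> stalk_fractions p" unfolding stalk_fractions_def by blast
qed

section \<open>Sections of the structure sheaf as elements of the binoid of fractions\<close>

abbreviation germ_fraction :: "'a set \<Rightarrow> 'a \<Rightarrow> 'a \<Rightarrow> ('a \<times> 'a) set" where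
  "germ_fraction q \<equiv> fraction M (carrier M - q)"

abbreviation generizations :: "'a set \<Rightarrow> 'a set set" where
  "generizations p \<equiv> {q. prime_ideal M q \<and> q \<subseteq> p}"

text \<open>A neighbourhood of \<open>p\<close> on which a section is a single fraction contains all
  primes below \<open>p\<close>, and these form an open set, so that it can serve as the
  neighbourhood.\<close>

lemma structure_sections_iff:
  assumes V: "openin (Spec M) V"
  shows "s \<in> structure_sections M V \<longleftrightarrow> s \<in> extensional V \<and>
    (\<forall>p \<in> V. \<exists>a \<in> carrier M. \<exists>f \<in> carrier M - p. \<forall>q. prime_ideal M q \<and> q \<subseteq> p \<longrightarrow>
      s q = germ_fraction q a f)" (is "_ \<longleftrightarrow> ?rhs")
proof
  assume s: "s \<in> structure_sections M V"
  have "\<exists>a \<in> carrier M. \<exists>f \<in> carrier M - p. \<forall>q. prime_ideal M q \<and> q \<subseteq> p \<longrightarrow>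
      s q = germ_fraction q a f" if p: "p \<in> V" for p
  proof -
    have "\<exists>W. openin (Spec M) W \<and> p \<in> W \<and> W \<subseteq> V \<and>
        (\<exists>a \<in> carrier M. \<exists>f \<in> carrier M. \<forall>q \<in> W. f \<notin> q \<and> s q = germ_fraction q a f)"
      using s p by (simp add: structure_sections_def)
    then obtain W a f where W: "openin (Spec M) W" "p \<in> W" and af: "a \<in> carrier M" "f \<in> carrier M"
      "\<forall>q \<in> W. f \<notin> q \<and> s q = germ_fraction q a f"
      by (elim exE conjE bexE)
    then have "\<forall>q. prime_ideal M q \<and> q \<subseteq> p \<longrightarrow> s q = germ_fraction q a f"
      using Spec_generization[OF W] by simp
    moreover have "f \<in> carrier M - p" using af W(2) by simp
    ultimately show ?thesis using af(1) by blast
  qed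
  then show ?rhs using s by (simp add: structure_sections_def PiE_def)
next
  assume s: ?rhs
  have "s p \<in> carrier (localization M (carrier M - p)) \<and>
      (\<exists>W. openin (Spec M) W \<and> p \<in> W \<and> W \<subseteq> V \<and>
        (\<exists>a \<in> carrier M. \<exists>f \<in> carrier M. \<forall>q \<in> W. f \<notin> q \<and> s q = germ_fraction q a f))"
    if p: "p \<in> V" for p
  proof -
    have pp: "prime_ideal M p" using openin_subset[OF V] p by (auto simp: topspace_Spec)
    obtain a f where af: "a \<in> carrier M" "f \<in> carrier M - p"
      "\<forall>q. prime_ideal M q \<and> q \<subseteq> p \<longrightarrow> s q = germ_fraction q a f"
      using bspec[OF conjunct2[OF s] p] by (elim bexE)
    have sp: "s p = germ_fraction p a f" using af(3) pp by simp
    let ?W = "generizations p"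
    have W: "openin (Spec M) ?W" "p \<in> ?W" "?W \<subseteq> V"
      using openin_generizations[OF pp] pp Spec_generization[OF V p] by blast+
    have "\<forall>q \<in> ?W. f \<notin> q \<and> s q = germ_fraction q a f" using af by blast
    moreover have "f \<in> carrier M" using af(2) by blast
    ultimately have "\<exists>a \<in> carrier M. \<exists>f \<in> carrier M. \<forall>q \<in> ?W. f \<notin> q \<and> s q = germ_fraction q a f"
      using af(1) by blast
    moreover have "s p \<in> carrier (localization M (carrier M - p))"
      unfolding sp using af(1,2) by (auto simp: localization_def)
    ultimately show ?thesis using W by blast
  qed
  then show "s \<in> structure_sections M V"
    using s unfolding structure_sections_def PiE_def Pi_def by blast
qed

lemma structure_sections_cases:
  assumes "openin (Spec M) V" "s \<in> structure_sections M V" "p \<in> V"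
  obtains a f where "a \<in> carrier M" "f \<in> carrier M" "f \<notin> p"
    and "\<And>q. \<lbrakk>prime_ideal M q; q \<subseteq> p\<rbrakk> \<Longrightarrow> s q = germ_fraction q a f"
proof -
  have "\<exists>a \<in> carrier M. \<exists>f \<in> carrier M - p. \<forall>q. prime_ideal M q \<and> q \<subseteq> p \<longrightarrow>
      s q = germ_fraction q a f"
    using assms by (simp add: structure_sections_iff)
  then obtain a f where "a \<in> carrier M" "f \<in> carrier M - p"
    "\<forall>q. prime_ideal M q \<and> q \<subseteq> p \<longrightarrow> s q = germ_fraction q a f"
    by (elim bexE)
  then show thesis by (intro that[of a f]) simp_all
qed

lemma structure_sheaf_sec:
  "carrier (sec (structure_sheaf M) V) = structure_sections M V"
  "mult (sec (structure_sheaf M) V) = (\<lambda>s t. \<lambda>\<pp> \<in> V. s \<pp> \<otimes>\<^bsub>localization M (carrier M - \<pp>)\<^esub> t \<pp>)"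
  "\<one>\<^bsub>sec (structure_sheaf M) V\<^esub> = (\<lambda>\<pp> \<in> V. \<one>\<^bsub>localization M (carrier M - \<pp>)\<^esub>)"
  "absorb (sec (structure_sheaf M) V) = (\<lambda>\<pp> \<in> V. absorb (localization M (carrier M - \<pp>)))"
  "res (structure_sheaf M) V W s = restrict s W"
  by (simp_all add: structure_sheaf_def)

lemma structure_sections_const:
  assumes V: "openin (Spec M) V" and a: "a \<in> carrier M"
  shows "(\<lambda>q \<in> V. germ_fraction q a \<one>) \<in> structure_sections M V"
  unfolding structure_sections_iff[OF V]
proof (intro conjI ballI)
  fix p assume p: "p \<in> V"
  then have pp: "prime_ideal M p" using openin_subset[OF V] by (auto simp: topspace_Spec)
  show "\<exists>b \<in> carrier M. \<exists>f \<in> carrier M - p. \<forall>q. prime_ideal M q \<and> q \<subseteq> p \<longrightarrow>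
      (\<lambda>q \<in> V. germ_fraction q a \<one>) q = germ_fraction q b f"
    using a prime_idealD(3)[OF pp] Spec_generization[OF V p]
    by (intro bexI[of _ a] bexI[of _ \<one>]) auto
qed simp

lemma binoid_structure_sheaf:
  assumes V: "openin (Spec M) V"
  shows "binoid (sec (structure_sheaf M) V)"
proof -
  let ?O = "sec (structure_sheaf M) V"
  have prime: "prime_ideal M p" if "p \<in> V" for p using openin_subset[OF V] that by (auto simp: topspace_Spec)
  have L: "binoid (localization M (carrier M - p))" if "p \<in> V" for p
    using prime_idealD(4)[OF prime[OF that]] by (rule binoid_localization)
  note L_comm = binoid.axioms(1)[OF L] and L_monoid = comm_monoid.axioms(1)[OF binoid.axioms(1)[OF L]]
  have germ: "s p \<in> carrier (localization M (carrier M - p))" if "s \<in> carrier ?O" "p \<in> V" for s p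
    using that by (auto simp: structure_sheaf_sec structure_sections_def)
  have ext: "s = t" if "s \<in> carrier ?O" "t \<in> carrier ?O" "\<And>p. p \<in> V \<Longrightarrow> s p = t p" for s t
    using that by (intro extensionalityI[of s V t]) (auto simp: structure_sheaf_sec structure_sections_iff[OF V])
  have one: "\<one>\<^bsub>?O\<^esub> \<in> carrier ?O"
    using structure_sections_const[OF V one_closed] by (simp add: structure_sheaf_sec localization_def)
  have abs: "absorb ?O \<in> carrier ?O"
    using structure_sections_const[OF V absorb_closed] by (simp add: structure_sheaf_sec localization_def)
  have mult: "s \<otimes>\<^bsub>?O\<^esub> t \<in> carrier ?O" if s: "s \<in> carrier ?O" and t: "t \<in> carrier ?O" for s t
    unfolding structure_sheaf_sec structure_sections_iff[OF V]
  proof (intro conjI ballI)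
    fix p assume p: "p \<in> V"
    obtain a f where a: "a \<in> carrier M" "f \<in> carrier M" "f \<notin> p"
      "\<And>q. \<lbrakk>prime_ideal M q; q \<subseteq> p\<rbrakk> \<Longrightarrow> s q = germ_fraction q a f"
      using V s[unfolded structure_sheaf_sec] p by (rule structure_sections_cases) blast
    obtain b g where b: "b \<in> carrier M" "g \<in> carrier M" "g \<notin> p"
      "\<And>q. \<lbrakk>prime_ideal M q; q \<subseteq> p\<rbrakk> \<Longrightarrow> t q = germ_fraction q b g"
      using V t[unfolded structure_sheaf_sec] p by (rule structure_sections_cases) blast
    have "(\<lambda>p \<in> V. s p \<otimes>\<^bsub>localization M (carrier M - p)\<^esub> t p) q =
        germ_fraction q (a \<otimes> b) (f \<otimes> g)" if q: "prime_ideal M q" "q \<subseteq> p" for q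
    proof -
      have "f \<in> carrier M - q" "g \<in> carrier M - q" using a b q by auto
      then show ?thesis
        using Spec_generization[OF V p q] a b q by (simp add: fraction_mult[OF prime_idealD(4)[OF q(1)]])
    qed
    moreover have "f \<otimes> g \<in> carrier M - p" using a b prime_ideal_mult_iff[OF prime[OF p]] by simp
    ultimately show "\<exists>c \<in> carrier M. \<exists>h \<in> carrier M - p. \<forall>q. prime_ideal M q \<and> q \<subseteq> p \<longrightarrow>
        (\<lambda>p \<in> V. s p \<otimes>\<^bsub>localization M (carrier M - p)\<^esub> t p) q = germ_fraction q c h"
      using a(1) b(1) by (intro bexI[of _ "a \<otimes> b"] bexI[of _ "f \<otimes> g"]) simp_all
  qed simp
  have at: "(s \<otimes>\<^bsub>?O\<^esub> t) p = s p \<otimes>\<^bsub>localization M (carrier M - p)\<^esub> t p"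
    "\<one>\<^bsub>?O\<^esub> p = \<one>\<^bsub>localization M (carrier M - p)\<^esub>" "absorb ?O p = absorb (localization M (carrier M - p))"
    if "p \<in> V" for s t p
    using that by (simp_all add: structure_sheaf_sec)
  show ?thesis
  proof (intro binoid.intro comm_monoidI binoid_axioms.intro)
    show "\<one>\<^bsub>?O\<^esub> \<in> carrier ?O" "absorb ?O \<in> carrier ?O" by fact+
    fix s assume s: "s \<in> carrier ?O"
    show "\<one>\<^bsub>?O\<^esub> \<otimes>\<^bsub>?O\<^esub> s = s"
      by (rule ext) (use s in \<open>simp_all add: at one mult germ monoid.l_one[OF L_monoid]\<close>)
    show "s \<otimes>\<^bsub>?O\<^esub> absorb ?O = absorb ?O"
      by (rule ext) (use s in \<open>simp_all add: at abs mult germ binoid.absorb_mult[OF L]\<close>)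
    fix t assume t: "t \<in> carrier ?O"
    show "s \<otimes>\<^bsub>?O\<^esub> t \<in> carrier ?O" using s t by (rule mult)
    show "s \<otimes>\<^bsub>?O\<^esub> t = t \<otimes>\<^bsub>?O\<^esub> s"
      by (rule ext) (use s t in \<open>simp_all add: at mult germ comm_monoid.m_comm[OF L_comm]\<close>)
    fix u assume u: "u \<in> carrier ?O"
    show "s \<otimes>\<^bsub>?O\<^esub> t \<otimes>\<^bsub>?O\<^esub> u = s \<otimes>\<^bsub>?O\<^esub> (t \<otimes>\<^bsub>?O\<^esub> u)"
      by (rule ext) (use s t u in \<open>simp_all add: at mult germ monoid.m_assoc[OF L_monoid]\<close>)
  qed
qed

lemma localization_generic: "localization M (carrier M - {absorb M}) = fractions"
  by (simp add: fractions_def finite_part_def)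

lemma generic_value:
  assumes V: "openin (Spec M) V" "V \<noteq> {}"
  shows "{absorb M} \<in> V"
proof -
  obtain p where p: "p \<in> V" using V(2) by blast
  then have "prime_ideal M p" using openin_subset[OF V(1)] by (auto simp: topspace_Spec)
  then show ?thesis using Spec_generization[OF V(1) p generic_prime] prime_idealD(2) by blast
qed

text \<open>Equality of two fractions is the same cross-multiplied equation at every prime, so the
  germ at the generic prime determines the others. Conversely an element of all stalks has a
  fraction for each \<open>p\<close>, and the same equation shows that these fractions agree at
  smaller primes.\<close>

lemma generic_value_bij:
  assumes V: "openin (Spec M) V" "V \<noteq> {}"
  shows "bij_betw (\<lambda>s. s {absorb M}) (structure_sections M V) (\<Inter>p \<in> V. stalk_fractions p)"
  unfolding bij_betw_def
proof
  have prime: "prime_ideal M p" if "p \<in> V" for p using openin_subset[OF V(1)] that by (auto simp: topspace_Spec)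
  have generic: "{absorb M} \<subseteq> p" if "p \<in> V" for p using prime_idealD(2)[OF prime[OF that]] by simp
  have rep: "\<exists>a f. a \<in> carrier M \<and> f \<in> carrier M - p \<and> s p = germ_fraction p a f \<and> s {absorb M} = frac a f"
    if s: "s \<in> structure_sections M V" and p: "p \<in> V" for s p
  proof -
    obtain a f where a: "a \<in> carrier M" "f \<in> carrier M" "f \<notin> p"
      "\<And>q. \<lbrakk>prime_ideal M q; q \<subseteq> p\<rbrakk> \<Longrightarrow> s q = germ_fraction q a f"
      using V(1) s p by (rule structure_sections_cases) blast
    then show ?thesis using prime[OF p] generic_prime generic[OF p]
      by (intro exI[of _ a] exI[of _ f]) (simp add: finite_part_def)
  qed
  have cross: "germ_fraction p a f = germ_fraction p b g \<longleftrightarrow> frac a f = frac b g"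
    if "prime_ideal M p" "a \<in> carrier M" "f \<in> carrier M - p" "b \<in> carrier M" "g \<in> carrier M - p" for p a f b g
  proof -
    have "f \<in> N" "g \<in> N" using prime_compl_finite[OF that(1)] that(3,5) by auto
    then show ?thesis
      using that fraction_eq_cross[OF prime_idealD(4)[OF that(1)] prime_compl_finite[OF that(1)], of a f b g]
      by (simp add: frac_eq_iff)
  qed
  show "inj_on (\<lambda>s. s {absorb M}) (structure_sections M V)"
  proof (rule inj_onI)
    fix s t assume s: "s \<in> structure_sections M V" and t: "t \<in> structure_sections M V"
      and eq: "s {absorb M} = t {absorb M}"
    have "s p = t p" if p: "p \<in> V" for p
      using rep[OF s p] rep[OF t p] cross[OF prime[OF p]] eq by metis
    then show "s = t"
      using s t by (intro extensionalityI[of s V t]) (auto simp: structure_sections_iff[OF V(1)])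
  qed
  show "(\<lambda>s. s {absorb M}) ` structure_sections M V = (\<Inter>p \<in> V. stalk_fractions p)"
  proof (intro subset_antisym subsetI)
    fix k assume "k \<in> (\<lambda>s. s {absorb M}) ` structure_sections M V"
    then obtain s where s: "s \<in> structure_sections M V" "k = s {absorb M}" by blast
    have "k \<in> stalk_fractions p" if "p \<in> V" for p
      using rep[OF s(1) that] unfolding s(2) stalk_fractions_def by blast
    then show "k \<in> (\<Inter>p \<in> V. stalk_fractions p)" by blast
  next
    fix k assume k: "k \<in> (\<Inter>p \<in> V. stalk_fractions p)"
    have "\<forall>p \<in> V. \<exists>x. fst x \<in> carrier M \<and> snd x \<in> carrier M - p \<and> k = frac (fst x) (snd x)"
    proof
      fix p assume "p \<in> V"
      then obtain a f where "a \<in> carrier M" "f \<in> carrier M - p" "k = frac a f"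
        using k by (auto simp: stalk_fractions_def)
      then show "\<exists>x. fst x \<in> carrier M \<and> snd x \<in> carrier M - p \<and> k = frac (fst x) (snd x)"
        by (intro exI[of _ "(a, f)"]) simp
    qed
    then obtain x where x: "\<forall>p \<in> V. fst (x p) \<in> carrier M \<and> snd (x p) \<in> carrier M - p \<and> k = frac (fst (x p)) (snd (x p))"
      by metis
    define s where "s = (\<lambda>p \<in> V. germ_fraction p (fst (x p)) (snd (x p)))"
    have "s \<in> structure_sections M V"
      unfolding structure_sections_iff[OF V(1)]
    proof (intro conjI ballI)
      show "s \<in> extensional V" by (simp add: s_def)
      fix p assume p: "p \<in> V"
      have "s q = germ_fraction q (fst (x p)) (snd (x p))" if q: "prime_ideal M q" "q \<subseteq> p" for q
      proof -
        have qV: "q \<in> V" using Spec_generization[OF V(1) p q] .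
        have "snd (x p) \<in> carrier M - q" using x p q by blast
        then show ?thesis using x p qV cross[OF q(1)] by (simp add: s_def) metis
      qed
      then show "\<exists>a \<in> carrier M. \<exists>f \<in> carrier M - p. \<forall>q. prime_ideal M q \<and> q \<subseteq> p \<longrightarrow>
          s q = germ_fraction q a f"
        using x p by blast
    qed
    moreover have "s {absorb M} = k"
      using x generic_value[OF V] by (simp add: s_def finite_part_def)
    ultimately show "k \<in> (\<lambda>s. s {absorb M}) ` structure_sections M V" by blast
  qed
qed

lemma structure_sections_empty: "structure_sections M {} = {\<lambda>x. undefined}"
  by (simp add: structure_sections_def)

sublocale Spec: generic_binoid_space fractions "Spec M" "{absorb M}" "generizations"
  stalk_fractions "structure_sheaf M" "\<lambda>V s. s {absorb M}"
proof (intro generic_binoid_space.intro generic_binoid_space_axioms.intro K.binoid_axioms)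
  fix p assume "p \<in> topspace (Spec M)"
  then have p: "prime_ideal M p" by (simp add: topspace_Spec)
  show "openin (Spec M) (generizations p)" using p by (rule openin_generizations)
  show "p \<in> generizations p" using p by simp
  show "submonoid (stalk_fractions p) fractions" using p by (rule stalk_fractions_submonoid)
  show "absorb fractions \<in> stalk_fractions p"
    using prime_idealD(3)[OF p] absorb_closed by (auto simp: absorb_fractions stalk_fractions_def)
  fix q assume "q \<in> generizations p"
  then show "stalk_fractions p \<subseteq> stalk_fractions q" by (auto simp: stalk_fractions_def)
next
  fix V p assume "openin (Spec M) V" "p \<in> V"
  then show "generizations p \<subseteq> V" using Spec_generization by blast
next
  have "{q. prime_ideal M q \<and> q \<subseteq> {absorb M}} = {{absorb M}}"
    using generic_prime prime_idealD(2) by blast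
  then show "openin (Spec M) {{absorb M}}" using openin_generizations[OF generic_prime] by simp
next
  show "stalk_fractions {absorb M} = carrier fractions"
    by (auto simp: stalk_fractions_def fractions_def localization_def finite_part_def)
next
  fix V assume V: "openin (Spec M) V"
  then show "binoid (sec (structure_sheaf M) V)" by (rule binoid_structure_sheaf)
next
  fix V W a assume V: "openin (Spec M) V" "openin (Spec M) W" "W \<subseteq> V" "a \<in> carrier (sec (structure_sheaf M) V)"
  show "res (structure_sheaf M) V W a \<in> carrier (sec (structure_sheaf M) W)"
    unfolding structure_sheaf_sec structure_sections_iff[OF V(2)]
  proof (intro conjI ballI)
    fix p assume p: "p \<in> W"
    obtain b f where b: "b \<in> carrier M" "f \<in> carrier M" "f \<notin> p"
      "\<And>q. \<lbrakk>prime_ideal M q; q \<subseteq> p\<rbrakk> \<Longrightarrow> a q = germ_fraction q b f"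
      using V(1) V(4)[unfolded structure_sheaf_sec] subsetD[OF V(3) p] by (rule structure_sections_cases) blast
    then show "\<exists>b \<in> carrier M. \<exists>f \<in> carrier M - p. \<forall>q. prime_ideal M q \<and> q \<subseteq> p \<longrightarrow>
        restrict a W q = germ_fraction q b f"
      using Spec_generization[OF V(2) p] by (intro bexI[of _ b] bexI[of _ f]) auto
  qed simp
  assume "W \<noteq> {}"
  then show "res (structure_sheaf M) V W a {absorb M} = a {absorb M}"
    using generic_value[OF V(2)] by (simp add: structure_sheaf_sec)
next
  fix V assume "openin (Spec M) V" "V \<noteq> {}"
  then show "bij_betw (\<lambda>s. s {absorb M}) (carrier (sec (structure_sheaf M) V)) (\<Inter>p \<in> V. stalk_fractions p)"
    unfolding structure_sheaf_sec by (rule generic_value_bij)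
qed (simp_all add: generic_value structure_sheaf_sec structure_sections_empty localization_generic)

end


section \<open>Divisibility and normality\<close>

text \<open>There is a monotone subsequence. If it decreases, it is constant from an index
  \<open>m\<close> of its minimum on, and the tail starting at \<open>m\<close> is
  increasing.\<close>

lemma monotone_subsequence_nat:
  fixes s :: "nat \<Rightarrow> nat"
  shows "\<exists>r. strict_mono r \<and> incseq (\<lambda>n. s (r n))"
proof -
  obtain f where f: "strict_mono f" "monoseq (\<lambda>n. s (f n))" using seq_monosub by blast
  show ?thesis
  proof (cases "incseq (\<lambda>n. s (f n))")
    case False
    then have dec: "decseq (\<lambda>n. s (f n))" using f(2) by (simp add: monoseq_iff)
    obtain m where m: "\<And>n. s (f m) \<le> s (f n)"
      using ex_has_least_nat[of "\<lambda>_. True" _ "\<lambda>n. s (f n)"] by blast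
    have "s (f (m + n)) = s (f m)" for n
      using m[of "m + n"] decseqD[OF dec, of m "m + n"] by simp
    then have "incseq (\<lambda>n. s (f (m + n)))" by (simp add: incseq_def)
    moreover have "strict_mono (\<lambda>n. f (m + n))" using f(1) by (simp add: strict_mono_def)
    ultimately show ?thesis by blast
  qed (use f(1) in blast)
qed

text \<open>Coordinates are treated one at a time: those already increasing stay so along any
  further subsequence.\<close>

lemma Dickson_subsequence:
  fixes e :: "nat \<Rightarrow> 'b \<Rightarrow> nat"
  assumes "finite B"
  shows "\<exists>r. strict_mono r \<and> (\<forall>b \<in> B. incseq (\<lambda>n. e (r n) b))"
  using assms
proof (induction B rule: finite_induct)
  case empty
  show ?case by (intro exI[of _ id]) (simp add: strict_mono_def)
next
  case (insert b B)
  then obtain r where r: "strict_mono r" "\<And>c. c \<in> B \<Longrightarrow> incseq (\<lambda>n. e (r n) c)" by blast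
  obtain g where g: "strict_mono g" "incseq (\<lambda>n. e (r (g n)) b)"
    using monotone_subsequence_nat[of "\<lambda>n. e (r n) b"] by blast
  have "incseq (\<lambda>n. e (r (g n)) c)" if "c \<in> insert b B" for c
    using that g r(2)[of c] by (auto simp: incseq_def strict_mono_less_eq)
  moreover have "strict_mono (\<lambda>n. r (g n))" using r(1) g(1) by (simp add: strict_mono_def)
  ultimately show ?case by (intro exI[of _ "\<lambda>n. r (g n)"]) simp
qed

context toric_binoid
begin

text \<open>The monomials in the generators, together with the absorbing element, are closed under
  multiplication and contain the generators. The absorbing element is kept apart because it need not
  be a monomial.\<close>

lemma generated_by_powers:
  "\<exists>B. finite B \<and> B \<subseteq> carrier M \<and>
    (\<forall>x \<in> carrier M. x = absorb M \<or> (\<exists>e :: 'a \<Rightarrow> nat. x = (\<Otimes>b \<in> B. b [^] e b)))"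
proof -
  obtain B where B: "B \<subseteq> carrier M" "finite B"
    "\<forall>H. submonoid H M \<and> absorb M \<in> H \<and> B \<subseteq> H \<longrightarrow> H = carrier M"
    using finitely_generated unfolding finitely_generated_def by (elim exE conjE)
  define E where "E e = (\<Otimes>b \<in> B. b [^] e b)" for e :: "'a \<Rightarrow> nat"
  let ?H = "insert (absorb M) (range E)"
  have E_closed: "E e \<in> carrier M" for e unfolding E_def using B(1) by (intro finprod_closed) auto
  have E_mult: "E e \<otimes> E e' = E (\<lambda>b. e b + e' b)" for e e'
  proof -
    have "E e \<otimes> E e' = (\<Otimes>b \<in> B. b [^] e b \<otimes> b [^] e' b)"
      unfolding E_def using B(1) by (intro finprod_multf[symmetric]) auto
    also have "\<dots> = E (\<lambda>b. e b + e' b)"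
      unfolding E_def using B(1) by (intro finprod_cong') (auto simp: nat_pow_mult)
    finally show ?thesis .
  qed
  have "E (\<lambda>_. 0) = \<one>" unfolding E_def using B(1) by (intro finprod_one_eqI) auto
  then have one: "\<one> \<in> ?H" by (metis insertI2 rangeI)
  have "submonoid ?H M"
  proof
    show "?H \<subseteq> carrier M" using E_closed absorb_closed by auto
    show "\<one> \<in> ?H" by (rule one)
    fix x y assume "x \<in> ?H" "y \<in> ?H"
    then show "x \<otimes> y \<in> ?H" using E_closed absorb_closed E_mult by (auto simp: absorb_mult absorb_left)
  qed
  moreover have "B \<subseteq> ?H"
  proof
    fix b assume b: "b \<in> B"
    have "E (\<lambda>c. if b = c then 1 else 0) = (\<Otimes>c \<in> B. if b = c then c else \<one>)"
      unfolding E_def using B(1) by (intro finprod_cong') auto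
    also have "\<dots> = b" using b B by (intro finprod_singleton) auto
    finally show "b \<in> ?H" by (metis insertI2 rangeI)
  qed
  ultimately have "?H = carrier M" using B(3) by simp
  then have "\<forall>x \<in> carrier M. x = absorb M \<or> (\<exists>e :: 'a \<Rightarrow> nat. x = (\<Otimes>b \<in> B. b [^] e b))"
    unfolding E_def by blast
  then show ?thesis using B by blast
qed

text \<open>Along a subsequence all exponents of the generators increase, and componentwise
  inequality of exponents means divisibility. This takes the place of the ascending chain condition
  on ideals.\<close>

lemma divisible_pair:
  fixes x :: "nat \<Rightarrow> 'a"
  assumes x: "\<And>n. x n \<in> carrier M"
  shows "\<exists>i j z. i < j \<and> z \<in> carrier M \<and> x j = x i \<otimes> z"
proof (cases "\<exists>n. x (Suc n) = absorb M")
  case True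
  \<comment> \<open>The absorbing element is a multiple of everything; looking for it from index one
    on leaves \<open>x 0\<close> as the earlier term.\<close>
  then obtain n where "x (Suc n) = absorb M" by blast
  then show ?thesis
    using x absorb_closed by (intro exI[of _ 0] exI[of _ "Suc n"] exI[of _ "absorb M"]) (simp add: absorb_mult)
next
  case False
  obtain B where B: "finite B" "B \<subseteq> carrier M"
    "\<forall>x \<in> carrier M. x = absorb M \<or> (\<exists>e :: 'a \<Rightarrow> nat. x = (\<Otimes>b \<in> B. b [^] e b))"
    using generated_by_powers by blast
  have "\<forall>n. \<exists>e :: 'a \<Rightarrow> nat. x (Suc n) = (\<Otimes>b \<in> B. b [^] e b)" using False x B(3) by blast
  then obtain e :: "nat \<Rightarrow> 'a \<Rightarrow> nat" where e: "\<And>n. x (Suc n) = (\<Otimes>b \<in> B. b [^] e n b)" by metis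
  obtain r where r: "strict_mono r" "\<forall>b \<in> B. incseq (\<lambda>n. e (r n) b)" using Dickson_subsequence[OF B(1)] by blast
  let ?z = "\<Otimes>b \<in> B. b [^] (e (r 1) b - e (r 0) b)"
  have le: "e (r 0) b \<le> e (r 1) b" if "b \<in> B" for b using r(2) that by (auto simp: incseq_def)
  have "x (Suc (r 0)) \<otimes> ?z = (\<Otimes>b \<in> B. b [^] e (r 0) b \<otimes> b [^] (e (r 1) b - e (r 0) b))"
    unfolding e using B(2) by (intro finprod_multf[symmetric]) auto
  also have "\<dots> = x (Suc (r 1))"
    unfolding e using B(2) le by (intro finprod_cong') (auto simp: nat_pow_mult)
  finally have "x (Suc (r 1)) = x (Suc (r 0)) \<otimes> ?z" by simp
  moreover have "?z \<in> carrier M" using B(2) by (intro finprod_closed) auto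
  moreover have "Suc (r 0) < Suc (r 1)" using r(1) by (simp add: strict_mono_less)
  ultimately show ?thesis by blast
qed

section \<open>The embedding of the binoid into its fractions, and primes of height one\<close>

abbreviation fpow (infixr "\<up>" 75) where
  "x \<up> (n::nat) \<equiv> x [^]\<^bsub>fractions\<^esub> n"

abbreviation incl :: "'a \<Rightarrow> ('a \<times> 'a) set" where
  "incl a \<equiv> frac a \<one>"

lemma incl_mult: "\<lbrakk>a \<in> carrier M; b \<in> carrier M\<rbrakk> \<Longrightarrow> incl (a \<otimes> b) = incl a \<cdot> incl b"
  using one_finite by (simp add: frac_mult)

lemma incl_eq_iff: "\<lbrakk>a \<in> carrier M; b \<in> carrier M\<rbrakk> \<Longrightarrow> incl a = incl b \<longleftrightarrow> a = b"
  using one_finite by (simp add: frac_eq_iff)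

lemma incl_closed: "a \<in> carrier M \<Longrightarrow> incl a \<in> carrier fractions"
  using one_finite by (rule frac_closed[rotated])

lemma incl_Units: "a \<in> N \<Longrightarrow> incl a \<in> Units fractions"
  using one_finite by (intro frac_Units)

lemma frac_incl: "\<lbrakk>a \<in> carrier M; s \<in> N\<rbrakk> \<Longrightarrow> frac a s \<cdot> incl s = incl a"
  using one_finite mult_finite_iff by (simp add: frac_mult frac_eq_iff finite_part_iff)

lemma incl_pow: "a \<in> carrier M \<Longrightarrow> incl (a [^] (n::nat)) = incl a \<up> n"
  by (induction n) (simp_all add: incl_mult one_fractions)

lemma incl_Units_iff:
  assumes "a \<in> carrier M" "incl a \<in> Units fractions" shows "a \<in> N"
proof -
  obtain b s where b: "b \<in> N" "s \<in> N" "incl a = frac b s"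
    using assms(2) by (rule Units_fractions_cases)
  then have "a \<otimes> s = b" using assms(1) one_finite by (simp add: frac_eq_iff finite_part_iff)
  then show ?thesis using b assms(1) mult_finite_iff[of a s] by (simp add: finite_part_iff)
qed

lemma normal_fractions:
  assumes normal: "normal_binoid M" and u: "u \<in> Units fractions" and n: "n \<ge> (1::nat)"
    and pow: "u \<up> n \<in> incl ` N"
  shows "u \<in> incl ` N"
proof -
  obtain a s where "a \<in> N" "s \<in> N" "u = frac a s"
    using u by (rule Units_fractions_cases)
  then have "u \<in> carrier (difference_group M)" by (auto simp: difference_group_def)
  \<comment> \<open>Powers only involve product and unit, which the difference group shares with
    \<open>fractions\<close>; only the carriers differ.\<close>
  moreover have "u [^]\<^bsub>difference_group M\<^esub> n = u \<up> n"
    by (simp add: nat_pow_def difference_group_def fractions_def)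
  moreover have "\<forall>\<gamma> \<in> carrier (difference_group M). \<forall>n::nat. n \<ge> 1 \<and>
      \<gamma> [^]\<^bsub>difference_group M\<^esub> n \<in> incl ` N \<longrightarrow> \<gamma> \<in> incl ` N"
    using normal by (simp only: normal_binoid_def Let_def)
  ultimately show ?thesis using n pow by metis
qed

lemma incl_stalk: "\<lbrakk>prime_ideal M p; a \<in> carrier M\<rbrakk> \<Longrightarrow> incl a \<in> stalk_fractions p"
  using prime_idealD(3) by (auto simp: stalk_fractions_def)

lemma inv_incl_stalk:
  assumes p: "prime_ideal M p" and f: "f \<in> carrier M - p"
  shows "inv\<^bsub>fractions\<^esub> (incl f) \<in> stalk_fractions p"
proof -
  have "f \<in> N" using prime_compl_finite[OF p] f by blast
  then have "inv\<^bsub>fractions\<^esub> (incl f) = frac \<one> f" using one_finite by (simp add: frac_inv)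
  then show ?thesis using f by (auto simp: stalk_fractions_def)
qed

lemma stalk_fractions_cases:
  assumes p: "prime_ideal M p" and k: "k \<in> stalk_fractions p"
  obtains a f where "a \<in> carrier M" "f \<in> carrier M" "f \<notin> p" "f \<in> N" "k \<cdot> incl f = incl a"
proof -
  obtain a f where af: "a \<in> carrier M" "f \<in> carrier M - p" "k = frac a f"
    using k by (auto simp: stalk_fractions_def)
  moreover have "f \<in> N" using af prime_compl_finite[OF p] by blast
  ultimately show thesis using that frac_incl by auto
qed

text \<open>In a chain of length at least two that ends in \<open>q\<close>, the last member but one
  contains a smaller prime, so it differs from \<open>{absorb M}\<close>; being strictly inside
  \<open>q\<close>, it contradicts minimality.\<close>

lemma height_oneI:
  assumes q: "prime_ideal M q" and ne: "q \<noteq> {absorb M}"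
    and min: "\<And>q'. \<lbrakk>prime_ideal M q'; q' \<noteq> {absorb M}; q' \<subseteq> q\<rbrakk> \<Longrightarrow> q' = q"
  shows "height M q = 1"
proof -
  let ?N = "{n. \<exists>P. P n = q \<and> (\<forall>i \<le> n. prime_ideal M (P i)) \<and> (\<forall>i < n. P i \<subset> P (Suc i))}"
  have "{absorb M} \<subset> q" using prime_idealD(2)[OF q] ne by blast
  then have "1 \<in> ?N"
    using q generic_prime by (intro CollectI exI[of _ "\<lambda>i. if i = (0::nat) then {absorb M} else q"]) auto
  then have "enat 1 \<le> (SUP n \<in> ?N. enat n)" by (rule SUP_upper)
  moreover have "(SUP n \<in> ?N. enat n) \<le> enat 1"
  proof (rule SUP_least)
    fix n assume "n \<in> ?N"
    then obtain P where P: "P n = q" "\<forall>i \<le> n. prime_ideal M (P i)" "\<forall>i < n. P i \<subset> P (Suc i)" by blast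
    have False if n: "n = Suc (Suc m)" for m
    proof -
      have pr: "prime_ideal M (P m)" "prime_ideal M (P (Suc m))" and sub: "P m \<subset> P (Suc m)" "P (Suc m) \<subset> q"
        using P n by auto
      have "absorb M \<in> P m" using prime_idealD(2)[OF pr(1)] .
      then have "P (Suc m) \<noteq> {absorb M}" using sub(1) by (metis psubsetE subset_singletonD empty_iff subset_refl)
      then show False using min[OF pr(2)] sub(2) by blast
    qed
    then have "n \<le> 1" by (metis One_nat_def not_less_eq_eq not0_implies_Suc le_zero_eq nle_le le_SucE)
    then show "enat n \<le> enat 1" by simp
  qed
  ultimately show ?thesis unfolding height_def by (simp add: one_enat_def)
qed

text \<open>The denominators of \<delta> over the stalk at \<open>p\<close>, the analogue of the
  annihilator of \<delta> modulo the stalk. The absorbing element is left out so that all members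
  can be cancelled; with it one has an ideal.\<close>

definition conductor :: "'a set \<Rightarrow> ('a \<times> 'a) set \<Rightarrow> 'a set" where
  "conductor p \<delta> = {m \<in> N. incl m \<cdot> \<delta> \<in> stalk_fractions p}"

lemma incl_ac:
  "\<lbrakk>a \<in> carrier M; b \<in> carrier M; \<delta> \<in> carrier fractions\<rbrakk> \<Longrightarrow> incl (a \<otimes> b) \<cdot> \<delta> = incl a \<cdot> (incl b \<cdot> \<delta>)"
  by (simp add: incl_mult K.m_assoc incl_closed)

lemma stalk_fractions_mult:
  "\<lbrakk>prime_ideal M p; k \<in> stalk_fractions p; l \<in> stalk_fractions p\<rbrakk> \<Longrightarrow> k \<cdot> l \<in> stalk_fractions p"
  using stalk_fractions_submonoid submonoid.m_closed by metis

lemma conductor_mult: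
  assumes p: "prime_ideal M p" and \<delta>: "\<delta> \<in> carrier fractions"
    and m: "m \<in> conductor p \<delta>" and n: "n \<in> N"
  shows "m \<otimes> n \<in> conductor p \<delta>"
proof -
  have car: "m \<in> carrier M" "n \<in> carrier M" using m n by (simp_all add: conductor_def finite_part_iff)
  have "incl (n \<otimes> m) \<cdot> \<delta> \<in> stalk_fractions p"
    unfolding incl_ac[OF car(2,1) \<delta>]
    by (rule stalk_fractions_mult[OF p incl_stalk[OF p car(2)]]) (use m in \<open>simp add: conductor_def\<close>)
  then show ?thesis using car m n mult_finite_iff by (simp add: conductor_def m_comm)
qed

lemma conductor_incl_mult:
  assumes "n \<in> N" "m \<in> N" "\<delta> \<in> carrier fractions"
  shows "m \<in> conductor p (incl n \<cdot> \<delta>) \<longleftrightarrow> m \<otimes> n \<in> conductor p \<delta>"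
  using assms mult_finite_iff[of m n] by (simp add: conductor_def incl_ac finite_part_iff)

text \<open>This parallels the existence of associated primes over a noetherian ring. Multiplying
  \<gamma> enlarges the conductor. An infinite strict increase would yield elements
  \<open>y i\<close> that are new at step \<open>Suc i\<close>; by \<open>divisible_pair\<close>
  some \<open>y j\<close> is a multiple of an earlier \<open>y i\<close>, so it already lies in the
  conductor of step \<open>j\<close>.\<close>

lemma maximal_conductor:
  assumes p: "prime_ideal M p" and \<gamma>: "\<gamma> \<in> carrier fractions" "\<gamma> \<notin> stalk_fractions p"
  shows "\<exists>n \<in> N. incl n \<cdot> \<gamma> \<notin> stalk_fractions p \<and>
    (\<forall>m \<in> N. incl m \<cdot> (incl n \<cdot> \<gamma>) \<notin> stalk_fractions p \<longrightarrow>
      conductor p (incl m \<cdot> (incl n \<cdot> \<gamma>)) = conductor p (incl n \<cdot> \<gamma>))"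
proof (rule ccontr)
  assume contr: "\<not> ?thesis"
  let ?P = "\<lambda>n. n \<in> N \<and> incl n \<cdot> \<gamma> \<notin> stalk_fractions p"
  let ?I = "\<lambda>n. conductor p (incl n \<cdot> \<gamma>)"
  have mono: "?I n \<subseteq> ?I (m \<otimes> n)" if "n \<in> N" "m \<in> N" for m n
  proof
    fix y assume y: "y \<in> ?I n"
    have car: "n \<in> carrier M" "m \<in> carrier M" "y \<in> carrier M" "y \<in> N"
      using that y by (simp_all add: conductor_def finite_part_iff)
    have "y \<otimes> m \<in> ?I n" using p _ y that(2) by (rule conductor_mult) (use \<gamma> car incl_closed in simp)
    then show "y \<in> ?I (m \<otimes> n)"
      using conductor_incl_mult[OF that(2) car(4), of "incl n \<cdot> \<gamma>" p] \<gamma> car incl_closed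
      by (simp add: incl_ac)
  qed
  have step: "\<exists>n'. ?P n' \<and> (\<exists>m \<in> N. n' = m \<otimes> n) \<and> (\<exists>y. y \<in> ?I n' \<and> y \<notin> ?I n)" if n: "?P n" for n
  proof -
    obtain m where m: "m \<in> N" "incl m \<cdot> (incl n \<cdot> \<gamma>) \<notin> stalk_fractions p"
      "conductor p (incl m \<cdot> (incl n \<cdot> \<gamma>)) \<noteq> ?I n"
      using contr n by blast
    have eq: "incl m \<cdot> (incl n \<cdot> \<gamma>) = incl (m \<otimes> n) \<cdot> \<gamma>"
      using m(1) n \<gamma> by (simp add: incl_ac finite_part_iff)
    have "m \<otimes> n \<in> N" using m(1) n mult_finite_iff by (simp add: finite_part_iff)
    moreover have "\<exists>y. y \<in> ?I (m \<otimes> n) \<and> y \<notin> ?I n" using mono[of n m] m n unfolding eq by blast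
    ultimately show ?thesis using m unfolding eq by blast
  qed
  have "?P \<one>" using \<gamma> one_finite by (simp add: one_fractions[symmetric])
  with step obtain n where n: "\<And>i. ?P (n i)" "\<And>i. \<exists>m \<in> N. n (Suc i) = m \<otimes> n i"
    "\<And>i. \<exists>y. y \<in> ?I (n (Suc i)) \<and> y \<notin> ?I (n i)"
    using dependent_nat_choice[of "\<lambda>_. ?P" "\<lambda>_ n n'. (\<exists>m \<in> N. n' = m \<otimes> n) \<and> (\<exists>y. y \<in> ?I n' \<and> y \<notin> ?I n)"]
    by metis
  have inc: "?I (n i) \<subseteq> ?I (n j)" if "i \<le> j" for i j
  proof (rule lift_Suc_mono_le[of "\<lambda>i. ?I (n i)", OF _ that])
    fix i show "?I (n i) \<subseteq> ?I (n (Suc i))" using n(1)[of i] n(2)[of i] mono[of "n i"] by (elim bexE) simp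
  qed
  obtain y where y: "\<And>i. y i \<in> ?I (n (Suc i))" "\<And>i. y i \<notin> ?I (n i)" using n(3) by metis
  have yf: "y i \<in> N" for i using y(1)[of i] by (simp add: conductor_def)
  obtain i j z where ij: "i < j" "z \<in> carrier M" "y j = y i \<otimes> z"
    using divisible_pair[of y] yf by (auto simp: finite_part_iff)
  have "z \<in> N" using yf[of j] yf[of i] ij mult_finite_iff by (simp add: finite_part_iff)
  moreover have "y i \<in> ?I (n j)" using y(1)[of i] inc[of "Suc i" j] ij(1) by auto
  moreover have "incl (n j) \<cdot> \<gamma> \<in> carrier fractions"
    using n(1)[of j] \<gamma> incl_closed by (simp add: finite_part_iff)
  ultimately have "y j \<in> ?I (n j)" unfolding ij(3) using p by (intro conductor_mult)
  then show False using y(2) by blast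
qed

text \<open>If \<open>x\<close> is outside the ideal, \<open>incl x \<cdot> \<delta>\<close> is
  still outside the stalk and by maximality has the same conductor; so \<open>x \<otimes> y\<close>
  in the conductor forces \<open>y\<close> into it. The ideal lies in \<open>p\<close> because
  elements outside \<open>p\<close> are units of the stalk and could be divided off.\<close>

lemma conductor_prime:
  assumes p: "prime_ideal M p" and \<delta>: "\<delta> \<in> carrier fractions" "\<delta> \<notin> stalk_fractions p"
    and max: "\<And>m. \<lbrakk>m \<in> N; incl m \<cdot> \<delta> \<notin> stalk_fractions p\<rbrakk>
      \<Longrightarrow> conductor p (incl m \<cdot> \<delta>) = conductor p \<delta>"
  shows "prime_ideal M (insert (absorb M) (conductor p \<delta>))" and "insert (absorb M) (conductor p \<delta>) \<subseteq> p"
proof -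
  let ?q = "insert (absorb M) (conductor p \<delta>)"
  have "a \<otimes> b \<in> ?q" if "a \<in> ?q" "b \<in> carrier M" for a b
    using that conductor_mult[OF p \<delta>(1), of a b] absorb_left absorb_mult
    by (cases "b = absorb M") (auto simp: conductor_def finite_part_iff)
  moreover have "submonoid (carrier M - ?q) M"
  proof
    show "\<one> \<in> carrier M - ?q"
      using \<delta> one_finite by (simp add: conductor_def finite_part_iff one_fractions[symmetric])
    fix x y assume xy: "x \<in> carrier M - ?q" "y \<in> carrier M - ?q"
    then have fin: "x \<in> N" "y \<in> N" by (simp_all add: finite_part_iff)
    have "x \<otimes> y \<notin> conductor p \<delta>"
    proof
      assume "x \<otimes> y \<in> conductor p \<delta>"
      then have "y \<in> conductor p (incl x \<cdot> \<delta>)"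
        using fin \<delta> xy by (simp add: conductor_incl_mult m_comm)
      moreover have "incl x \<cdot> \<delta> \<notin> stalk_fractions p" using xy fin by (simp add: conductor_def)
      ultimately show False using max[OF fin(1)] xy by blast
    qed
    moreover have "x \<otimes> y \<noteq> absorb M" using fin mult_finite_iff[of x y] by (simp add: finite_part_iff)
    ultimately show "x \<otimes> y \<in> carrier M - ?q" using xy by simp
  qed auto
  ultimately show "prime_ideal M ?q"
    using absorb_closed by (auto simp: prime_ideal_def conductor_def finite_part_iff)
  have "m \<in> p" if m: "m \<in> conductor p \<delta>" for m
  proof (rule ccontr)
    assume "m \<notin> p"
    then have mp: "m \<in> carrier M - p" using m by (simp add: conductor_def finite_part_iff)
    have mu: "incl m \<in> Units fractions" using m by (simp add: conductor_def incl_Units)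
    have "inv\<^bsub>fractions\<^esub> (incl m) \<cdot> (incl m \<cdot> \<delta>) \<in> stalk_fractions p"
      by (rule stalk_fractions_mult[OF p inv_incl_stalk[OF p mp]]) (use m in \<open>simp add: conductor_def\<close>)
    then show False using \<delta> mu Spec.Units_cancel by simp
  qed
  then show "?q \<subseteq> p" using prime_idealD(2)[OF p] by blast
qed

text \<open>
  If the height is larger, then either multiplication by \<open>\<delta>\<close> maps the ideal into itself locally, so that
  \<open>\<delta>\<close> is integral, contradicting normality, or the ideal is locally generated by a single element \<open>a\<close>,
  and the elements of a smaller nonzero prime ideal are infinitely divisible by \<open>a\<close>.
\<close>

lemma conductor_height:
  assumes normal: "normal_binoid M" and p: "prime_ideal M p"
    and \<delta>: "\<delta> \<in> Units fractions" "\<delta> \<notin> stalk_fractions p"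
    and q: "prime_ideal M (insert (absorb M) (conductor p \<delta>))"
    and sub: "insert (absorb M) (conductor p \<delta>) \<subseteq> p"
  shows "height M (insert (absorb M) (conductor p \<delta>)) = 1"
proof (rule height_oneI[OF q])
  let ?I = "conductor p \<delta>" and ?q = "insert (absorb M) (conductor p \<delta>)"
  let ?C = "carrier M - ?q"
  have \<delta>c: "\<delta> \<in> carrier fractions" using \<delta>(1) by (rule K.Units_closed)
  have Ifin: "m \<in> N" "m \<in> carrier M" "m \<noteq> absorb M" if "m \<in> ?I" for m
    using that by (simp_all add: conductor_def finite_part_iff)
  have nq: "f \<in> N" "f \<in> carrier M" if "f \<in> ?C" for f
    using that by (simp_all add: finite_part_iff)
  have nq_mult: "f \<otimes> g \<in> ?C" if "f \<in> ?C" "g \<in> ?C" for f g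
    using that prime_ideal_mult_iff[OF q] by simp
  obtain a0 b0 where ab: "a0 \<in> N" "b0 \<in> N" "\<delta> = frac a0 b0"
    using \<delta>(1) by (rule Units_fractions_cases)
  \<comment> \<open>A denominator of \<delta> lies in the conductor, so the ideal is not just
    \<open>{absorb M}\<close>.\<close>
  have b0: "b0 \<in> ?I"
  proof -
    have "incl b0 \<cdot> \<delta> = incl a0"
      using ab frac_incl[of a0 b0] incl_closed[of b0] \<delta>c by (simp add: finite_part_iff K.m_comm)
    then show ?thesis using ab incl_stalk[OF p] by (simp add: conductor_def finite_part_iff)
  qed
  show "?q \<noteq> {absorb M}" using b0 Ifin by blast
  fix q' assume q': "prime_ideal M q'" "q' \<noteq> {absorb M}" "q' \<subseteq> ?q"
  show "q' = ?q"
  proof (rule ccontr)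
    assume "q' \<noteq> ?q"
    then obtain y where y: "y \<in> ?I" "y \<notin> q'" using q'(3) prime_idealD(2)[OF q'(1)] by blast
    obtain x where x: "x \<in> q'" "x \<noteq> absorb M" using q'(2) prime_idealD(2)[OF q'(1)] by blast
    show False
    \<comment> \<open>The condition says that, after localization at the ideal, multiplication by
      \<delta> maps it into itself; the elements of \<open>?C\<close> are the denominators of this
      localization.\<close>
    proof (cases "\<forall>a \<in> ?I. \<exists>b \<in> ?I. \<exists>f \<in> ?C. incl a \<cdot> \<delta> \<cdot> incl f = incl b")
      case True
      have "\<exists>a. \<forall>i. a i \<in> ?I \<and> (\<exists>f \<in> ?C. incl (a i) \<cdot> \<delta> \<cdot> incl f = incl (a (Suc i)))"
      proof (rule dependent_nat_choice)
        show "\<exists>a. a \<in> ?I" using b0 by blast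
        show "\<exists>b. b \<in> ?I \<and> (\<exists>f \<in> ?C. incl a \<cdot> \<delta> \<cdot> incl f = incl b)" if "a \<in> ?I" for a
          using bspec[OF True that] by blast
      qed
      then obtain a where "\<forall>i. a i \<in> ?I \<and> (\<exists>f \<in> ?C. incl (a i) \<cdot> \<delta> \<cdot> incl f = incl (a (Suc i)))"
        by (elim exE)
      then have a: "a i \<in> ?I" "\<exists>f \<in> ?C. incl (a i) \<cdot> \<delta> \<cdot> incl f = incl (a (Suc i))" for i
        by (simp_all only:)
      have ac: "incl (a i) \<in> carrier fractions" for i by (rule incl_closed[OF Ifin(2)[OF a(1)]])
      have chain: "\<exists>f \<in> ?C. incl (a i) \<cdot> (\<delta> \<up> k \<cdot> incl f) = incl (a (i + k))" for i and k :: nat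
      proof (induction k)
        case 0
        show ?case
          using prime_idealD(3)[OF q] ac by (intro bexI[of _ \<one>]) (simp_all add: one_fractions[symmetric])
      next
        case (Suc k)
        then obtain f where f: "f \<in> ?C" "incl (a i) \<cdot> (\<delta> \<up> k \<cdot> incl f) = incl (a (i + k))" by blast
        obtain g where g: "g \<in> ?C" "incl (a (i + k)) \<cdot> \<delta> \<cdot> incl g = incl (a (i + Suc k))"
          using a(2)[of "i + k"] by auto
        have c: "incl f \<in> carrier fractions" "incl g \<in> carrier fractions" "f \<in> carrier M" "g \<in> carrier M"
          using nq(2)[OF f(1)] nq(2)[OF g(1)] by (simp_all add: incl_closed)
        have "incl (a i) \<cdot> (\<delta> \<up> Suc k \<cdot> incl (f \<otimes> g)) =
            incl (a i) \<cdot> (\<delta> \<up> k \<cdot> incl f) \<cdot> \<delta> \<cdot> incl g"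
          using c \<delta>c ac by (simp add: incl_mult K.m_ac)
        then show ?case using f g nq_mult by (intro bexI[of _ "f \<otimes> g"]) simp_all
      qed
      \<comment> \<open>In place of the determinant argument for integrality: \<open>a j\<close> is
        \<open>a i\<close> times a power of \<delta> up to a denominator \<open>f\<close>, and also
        a multiple of \<open>a i\<close> in \<open>M\<close>. Cancelling \<open>a i\<close> leaves a
        power of \<delta> in the localization.\<close>
      obtain i j z where ij: "i < j" "z \<in> carrier M" "a j = a i \<otimes> z"
        using divisible_pair[of a, OF Ifin(2)[OF a(1)]] by (elim exE conjE)
      define k where "k = j - i"
      have k: "k \<ge> 1" "j = i + k" using ij(1) by (simp_all add: k_def)
      have z: "z \<in> N"
        using Ifin(1)[OF a(1)[of j]] Ifin(2)[OF a(1)[of i]] ij mult_finite_iff by simp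
      obtain f where f: "f \<in> ?C" "incl (a i) \<cdot> (\<delta> \<up> k \<cdot> incl f) = incl (a j)"
        using chain[of i k] k(2) by blast
      have fc: "incl f \<in> carrier fractions" "f \<in> carrier M" using nq(2)[OF f(1)] by (simp_all add: incl_closed)
      have "incl (a i) \<cdot> (\<delta> \<up> k \<cdot> incl f) = incl (a i) \<cdot> incl z"
        using f(2) ij(2,3) Ifin(2)[OF a(1)[of i]] by (simp add: incl_mult)
      then have eq: "\<delta> \<up> k \<cdot> incl f = incl z"
        using incl_Units[OF Ifin(1)[OF a(1)[of i]]] fc \<delta>c incl_closed[OF ij(2)] by simp
      \<comment> \<open>One factor \<open>f\<close> clears the denominator of the power and the
        other \<open>k - 1\<close> remain as elements of \<open>M\<close>. Normality then puts
        \<open>\<delta> \<cdot> incl f\<close> into \<open>M\<close>, so that \<open>f\<close> lies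
        in the conductor after all.\<close>
      have "(\<delta> \<cdot> incl f) \<up> k = \<delta> \<up> k \<cdot> incl f \<cdot> incl (f [^] (k - 1))"
      proof -
        have "(\<delta> \<cdot> incl f) \<up> k = \<delta> \<up> k \<cdot> incl f \<up> k"
          using fc \<delta>c by (simp add: K.nat_pow_distrib)
        also have "incl f \<up> k = incl f \<cdot> incl f \<up> (k - 1)"
          using k(1) fc by (cases k) (simp_all add: K.m_comm)
        finally show ?thesis using fc \<delta>c by (simp add: incl_pow K.m_assoc)
      qed
      also have "\<dots> = incl (z \<otimes> f [^] (k - 1))" unfolding eq using ij(2) fc by (simp add: incl_mult)
      finally have pow: "(\<delta> \<cdot> incl f) \<up> k = incl (z \<otimes> f [^] (k - 1))" .
      have u: "\<delta> \<cdot> incl f \<in> Units fractions" using \<delta>(1) incl_Units nq(1)[OF f(1)] by simp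
      have "(\<delta> \<cdot> incl f) \<up> k \<in> Units fractions"
        using u by (induction k) simp_all
      then have "z \<otimes> f [^] (k - 1) \<in> N"
        unfolding pow using ij(2) fc by (intro incl_Units_iff) simp_all
      then have "(\<delta> \<cdot> incl f) \<up> k \<in> incl ` N" using pow by blast
      from normal_fractions[OF normal u k(1) this] obtain w where "w \<in> N" "\<delta> \<cdot> incl f = incl w" by blast
      then have "incl f \<cdot> \<delta> \<in> stalk_fractions p"
        using fc \<delta>c incl_stalk[OF p, of w] by (simp add: K.m_comm finite_part_iff)
      then show False using f(1) nq(1)[OF f(1)] by (simp add: conductor_def)
    next
      case False
      then obtain a where a: "a \<in> ?I"
        and no: "\<And>b f. \<lbrakk>b \<in> ?I; f \<in> ?C\<rbrakk> \<Longrightarrow> incl a \<cdot> \<delta> \<cdot> incl f \<noteq> incl b" by blast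
      have ac: "a \<in> carrier M" "incl a \<in> carrier fractions" "incl a \<in> Units fractions" "a \<in> N"
        using Ifin[OF a] by (simp_all add: incl_closed incl_Units)
      obtain m s where ms: "m \<in> carrier M" "s \<in> carrier M" "s \<notin> p" "s \<in> N" "incl a \<cdot> \<delta> \<cdot> incl s = incl m"
        using p a by (elim stalk_fractions_cases[of p "incl a \<cdot> \<delta>"]) (simp add: conductor_def)
      have s: "s \<in> ?C" using ms(2,3) sub by blast
      have mfin: "m \<in> N"
        using ms(1,4,5) ac(3) \<delta>(1) incl_Units by (intro incl_Units_iff) (simp_all add: ms(5)[symmetric])
      \<comment> \<open>Otherwise \<open>m\<close> and \<open>s\<close> would be what
        \<open>no\<close> excludes. With both \<open>m\<close> and \<open>s\<close> outside the
        ideal, \<open>a\<close> is the inverse of \<delta> up to units of the localization at the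
        ideal.\<close>
      then have m: "m \<in> ?C" using no[OF _ s, of m] ms(5) by (auto simp: finite_part_iff)
      have sc: "incl s \<in> carrier fractions" "incl m \<in> carrier fractions" using ms(1,2) by (simp_all add: incl_closed)
      \<comment> \<open>Since \<delta> acts locally as the inverse of \<open>a\<close>, membership
        of \<open>b\<close> in the conductor says that \<open>a\<close> divides \<open>b\<close> up
        to a factor outside the ideal: locally the ideal is generated by \<open>a\<close>.\<close>
      have step: "\<exists>n \<in> carrier M. \<exists>g \<in> ?C. b \<otimes> g = a \<otimes> n" if b: "b \<in> ?I" for b
      proof -
        obtain n t where nt: "n \<in> carrier M" "t \<in> carrier M" "t \<notin> p" "t \<in> N" "incl b \<cdot> \<delta> \<cdot> incl t = incl n"
          using p b by (elim stalk_fractions_cases[of p "incl b \<cdot> \<delta>"]) (simp add: conductor_def)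
        have t: "t \<in> ?C" using nt(2,3) sub by blast
        have bc: "b \<in> carrier M" "incl b \<in> carrier fractions" "incl t \<in> carrier fractions" "incl n \<in> carrier fractions"
          using Ifin[OF b] nt(1,2) by (simp_all add: incl_closed)
        have "\<delta> \<cdot> incl (b \<otimes> (t \<otimes> m)) = incl b \<cdot> \<delta> \<cdot> incl t \<cdot> incl m"
          using bc nt(1,2) ms(1) sc \<delta>c by (simp add: incl_mult K.m_ac)
        also have "\<dots> = incl n \<cdot> (incl a \<cdot> \<delta> \<cdot> incl s)" unfolding nt(5) ms(5) ..
        also have "\<dots> = \<delta> \<cdot> incl (a \<otimes> (n \<otimes> s))"
          using bc nt(1) ms(2) sc ac(1,2) \<delta>c by (simp add: incl_mult K.m_ac)
        finally have "incl (b \<otimes> (t \<otimes> m)) = incl (a \<otimes> (n \<otimes> s))"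
          using \<delta>(1) bc nt ms ac incl_closed by (simp del: incl_mult)
        then have "b \<otimes> (t \<otimes> m) = a \<otimes> (n \<otimes> s)" using bc nt ms ac by (simp add: incl_eq_iff)
        then show ?thesis
          using nq_mult[OF t m] nt(1) ms(2) by (intro bexI[of _ "n \<otimes> s"] bexI[of _ "t \<otimes> m"]) simp_all
      qed
      \<comment> \<open>A multiple of \<open>y\<close> by an element outside the ideal is divisible
        by \<open>a\<close>; were \<open>a\<close> in the smaller prime \<open>q'\<close>, then
        \<open>y\<close> would be too. Hence division by \<open>a\<close> does not lead out of
        \<open>q'\<close> and can be repeated.\<close>
      have aq': "a \<notin> q'"
      proof
        assume "a \<in> q'"
        obtain n g where ng: "n \<in> carrier M" "g \<in> ?C" "y \<otimes> g = a \<otimes> n" using step[OF y(1)] by blast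
        then have "y \<otimes> g \<in> q'" using prime_ideal_mult_iff[OF q'(1) ac(1)] \<open>a \<in> q'\<close> by simp
        then show False using prime_ideal_mult_iff[OF q'(1)] Ifin(2)[OF y(1)] ng y(2) q'(3) by blast
      qed
      have step': "\<exists>n. (n \<in> q' \<and> n \<noteq> absorb M) \<and> (\<exists>g \<in> ?C. b \<otimes> g = a \<otimes> n)"
        if b: "b \<in> q' \<and> b \<noteq> absorb M" for b
      proof -
        have bI: "b \<in> ?I" using b q'(3) by blast
        obtain n g where ng: "n \<in> carrier M" "g \<in> ?C" "b \<otimes> g = a \<otimes> n" using step[OF bI] by blast
        have "b \<otimes> g \<in> q'" using prime_ideal_mult_iff[OF q'(1)] Ifin(2)[OF bI] ng b by blast
        then have "n \<in> q'" using prime_ideal_mult_iff[OF q'(1) ac(1) ng(1)] aq' ng(3) by simp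
        moreover have "b \<otimes> g \<in> N"
          using mult_finite_iff[of b g] Ifin[OF bI] nq[OF ng(2)] by simp
        then have "n \<noteq> absorb M" unfolding ng(3) using ac(1) by (auto simp: finite_part_iff absorb_mult)
        ultimately show ?thesis using ng by blast
      qed
      have "\<exists>b. \<forall>i. (b i \<in> q' \<and> b i \<noteq> absorb M) \<and> (\<exists>g \<in> ?C. b i \<otimes> g = a \<otimes> b (Suc i))"
      proof (rule dependent_nat_choice)
        show "\<exists>b. b \<in> q' \<and> b \<noteq> absorb M" using x by blast
      qed (rule step')
      then obtain b where "\<forall>i. (b i \<in> q' \<and> b i \<noteq> absorb M) \<and> (\<exists>g \<in> ?C. b i \<otimes> g = a \<otimes> b (Suc i))"
        by (elim exE)
      then have b: "b i \<in> q' \<and> b i \<noteq> absorb M" "\<exists>g \<in> ?C. b i \<otimes> g = a \<otimes> b (Suc i)" for i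
        by simp_all
      have bI: "b i \<in> ?I" for i using b(1)[of i] q'(3) by blast
      note bc = Ifin[OF bI]
      have chain: "\<exists>g \<in> ?C. b i \<otimes> g = a [^] k \<otimes> b (i + k)" for i and k :: nat
      proof (induction k)
        case 0
        show ?case using prime_idealD(3)[OF q] bc by (intro bexI[of _ \<one>]) simp_all
      next
        case (Suc k)
        then obtain g where g: "g \<in> ?C" "b i \<otimes> g = a [^] k \<otimes> b (i + k)" by blast
        obtain h where h: "h \<in> ?C" "b (i + k) \<otimes> h = a \<otimes> b (i + Suc k)" using b(2)[of "i + k"] by auto
        note gh = nq(2)[OF g(1)] nq(2)[OF h(1)]
        have "b i \<otimes> (g \<otimes> h) = a [^] k \<otimes> (b (i + k) \<otimes> h)" using g(2) gh bc ac by (simp add: m_assoc[symmetric])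
        also have "\<dots> = a [^] Suc k \<otimes> b (i + Suc k)" unfolding h(2) using bc ac by (simp add: m_assoc)
        finally show ?case using nq_mult[OF g(1) h(1)] by blast
      qed
      obtain i j z where ij: "i < j" "z \<in> carrier M" "b j = b i \<otimes> z"
        using divisible_pair[of b, OF bc(2)] by (elim exE conjE)
      \<comment> \<open>The exponent of \<open>a\<close> between steps \<open>i\<close> and
        \<open>j\<close> is \<open>Suc k\<close>, so after cancelling \<open>b i\<close> at least
        one factor \<open>a\<close> is left in \<open>g\<close>. This puts \<open>g\<close> into the
        ideal, although it was chosen outside.\<close>
      define k where "k = j - Suc i"
      have j: "j = i + Suc k" using ij(1) by (simp add: k_def)
      obtain g where g: "g \<in> ?C" "b i \<otimes> g = a [^] Suc k \<otimes> b j" using chain[of i "Suc k"] j by blast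
      have "b i \<otimes> g = b i \<otimes> (a \<otimes> (a [^] k \<otimes> z))"
        unfolding g(2) ij(3) using bc(2)[of i] ac ij(2) by (simp add: m_ac)
      then have "g = a \<otimes> (a [^] k \<otimes> z)"
        using nq(2)[OF g(1)] ac(1) ij(2) finite_cancel[OF bc(1)[of i], of g "a \<otimes> (a [^] k \<otimes> z)"] by simp
      then have "g \<in> ?q" using prime_ideal_mult_iff[OF q ac(1), of "a [^] k \<otimes> z"] a ac ij(2) by simp
      then show False using g(1) by blast
    qed
  qed
qed

text \<open>If \<open>u\<close> were not in the stalk at \<open>p\<close>, some multiple of it by
  \<open>n\<close> in \<open>M\<close> would have a maximal conductor, giving a prime of height one
  below \<open>p\<close>. As \<open>u\<close> lies in the stalk at that prime, it has a denominator
  \<open>f\<close> outside it; but \<open>f\<close> also clears the denominator of the multiple,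
  hence belongs to the conductor.\<close>

proposition stalk_fractions_codim_one:
  assumes normal: "normal_binoid M" and p: "prime_ideal M p" and u: "u \<in> Units fractions"
    and codim: "\<And>q. \<lbrakk>prime_ideal M q; q \<subseteq> p; height M q = 1\<rbrakk> \<Longrightarrow> u \<in> stalk_fractions q"
  shows "u \<in> stalk_fractions p"
proof (rule ccontr)
  assume not_mem: "u \<notin> stalk_fractions p"
  have uc: "u \<in> carrier fractions" using u by (rule K.Units_closed)
  obtain n where n: "n \<in> N" "incl n \<cdot> u \<notin> stalk_fractions p"
    "\<forall>m \<in> N. incl m \<cdot> (incl n \<cdot> u) \<notin> stalk_fractions p \<longrightarrow>
      conductor p (incl m \<cdot> (incl n \<cdot> u)) = conductor p (incl n \<cdot> u)"
    using maximal_conductor[OF p uc not_mem] by (elim bexE conjE)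
  let ?q = "insert (absorb M) (conductor p (incl n \<cdot> u))"
  have \<delta>: "incl n \<cdot> u \<in> Units fractions" using incl_Units[OF n(1)] u by simp
  have q: "prime_ideal M ?q" "?q \<subseteq> p"
    using conductor_prime[OF p K.Units_closed[OF \<delta>] n(2)] n(3) by simp_all
  have "u \<in> stalk_fractions ?q"
    using q conductor_height[OF normal p \<delta> n(2) q] by (rule codim)
  then obtain a f where af: "a \<in> carrier M" "f \<in> carrier M" "f \<notin> ?q" "f \<in> N" "u \<cdot> incl f = incl a"
    using q(1) by (elim stalk_fractions_cases[rotated])
  have "incl f \<cdot> (incl n \<cdot> u) = incl n \<cdot> (u \<cdot> incl f)"
    using af(2) n(1) uc incl_closed by (simp add: K.m_ac finite_part_iff)
  also have "\<dots> \<in> stalk_fractions p"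
    unfolding af(5) using af(1) n(1) by (intro stalk_fractions_mult[OF p] incl_stalk[OF p]) (simp_all add: finite_part_iff)
  finally show False using af(3,4) by (simp add: conductor_def)
qed

end

theorem proposition1p122:
  fixes M :: "'a binoid" and U U' :: "'a set set"
  assumes "toric_binoid M"
    and "normal_binoid M"
    and "openin (Spec M) U"
    and "openin (Spec M) U'"
    and "U' \<subseteq> U"
    and "height_one_points M U = height_one_points M U'"
  shows "\<exists>\<phi>. group_hom (Pic M U) (Pic M U') \<phi> \<and> inj_on \<phi> (carrier (Pic M U))"
proof -
  interpret toric_binoid M by fact
  show ?thesis
    unfolding Pic_def
  proof (rule Spec.picard_restriction[OF assms(3-5)])
    fix p u assume p: "p \<in> U" and u: "u \<in> Units fractions"
      and germ: "\<And>q. \<lbrakk>q \<in> generizations p; q \<in> U'\<rbrakk> \<Longrightarrow> u \<in> Spec.unit_germs q"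
    have pp: "prime_ideal M p" using openin_subset[OF assms(3)] p by (auto simp: topspace_Spec)
    \<comment> \<open>Open sets contain every prime below one of their members, so \<open>q\<close>
      lies in \<open>U\<close> and, being of height one, in \<open>U'\<close>.\<close>
    have "u \<in> Spec.unit_germs q" if "prime_ideal M q" "q \<subseteq> p" "height M q = 1" for q
    proof -
      have "q \<in> height_one_points M U"
        using Spec_generization[OF assms(3) p that(1,2)] that(3) by (simp add: height_one_points_def)
      then have "q \<in> U'" unfolding assms(6) by (simp add: height_one_points_def)
      then show ?thesis using germ that by blast
    qed
    \<comment> \<open>A unit of a stalk is an element that lies in it together with its inverse, so
      the codimension-one statement is applied to both.\<close>
    then have "u \<in> stalk_fractions p" "inv\<^bsub>fractions\<^esub> u \<in> stalk_fractions p"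
      using u by (auto intro!: stalk_fractions_codim_one[OF assms(2) pp] simp: Spec.unit_germs_def)
    then show "u \<in> Spec.unit_germs p" using u by (simp add: Spec.unit_germs_def)
  qed
qed

end
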